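(* Let $S_1,S_2,T_1,T_2,P_1$ and $P_2$ be Cu-semigroups, let $x\in[\![S_1,S_2]\!]$, $y\in[\![T_1,T_2]\!]$, and $z\in[\![P_1,P_2]\!]$. For $k=1,2$, identify $(S_k\otimes T_k)\otimes P_k$ with $S_k\otimes(T_k\otimes P_k)$ using the natural associativity isomorphism. Then $$(x\boxtimes y)\boxtimes z=x\boxtimes(y\boxtimes z).$$
   Context: A positively ordered semigroup is a commutative monoid $(S,+,0)$ with a partial order $\le$ compatible with addition such that $0\le a$ for all $a$. For $a,b\in S$, $a\ll b$ (way-below) means: whenever $(c_n)_n$ is an increasing sequence in $S$ whose supremum exists and satisfies $b\le\sup_n c_n$, there is $k$ with $a\le c_k$. A Cu-semigroup is a positively ordered semigroup satisfying: (O1) every increasing sequence has a supremum; (O2) every $a$ is the supremum of a sequence $(a_n)_n$ with $a_n\ll a_{n+1}$ for all $n$; (O3) $a'\ll a$ and $b'\ll b$ imply $a'+b'\ll a+b$; (O4) $\sup_n(a_n+b_n)=\sup_n a_n+\sup_n b_n$ for increasing sequences. A generalized Cu-morphism is a map between Cu-semigroups preserving addition, zero, order and suprema of increasing sequences; a Cu-morphism additionally preserves $\ll$. $\mathrm{Cu}[S,T]$ and $\mathrm{Cu}(S,T)$ denote the sets of generalized Cu-morphisms and of Cu-morphisms $S\to T$, with pointwise order and addition. A Cu-bimorphism $\varphi\colon S\times T\to P$ is a map that is additive, zero- and order-preserving in each variable, satisfies $\sup_k\varphi(a_k,b_k)=\varphi(\sup_k a_k,\sup_k b_k)$ for increasing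 sequences, and satisfies $\varphi(a',b')\ll\varphi(a,b)$ whenever $a'\ll a$ and $b'\ll b$. $S\otimes T$ denotes the Cu-semigroup with universal Cu-bimorphism $S\times T\to S\otimes T$, $(a,b)\mapsto a\otimes b$: every Cu-bimorphism $S\times T\to P$ factors through a unique Cu-morphism $S\otimes T\to P$, and Cu-morphisms $\alpha_1,\alpha_2\colon S\otimes T\to P$ satisfy $\alpha_1\le\alpha_2$ iff $\alpha_1(a\otimes b)\le\alpha_2(a\otimes b)$ for all $a,b$. The tensor product is associative (via $(a\otimes b)\otimes c\mapsto a\otimes(b\otimes c)$) and symmetric up to natural isomorphism. For (generalized) Cu-morphisms $\varphi_k\colon S_k\to T_k$, $k=1,2$, $\varphi_1\otimes\varphi_2\colon S_1\otimes S_2\to T_1\otimes T_2$ is the unique (generalized) Cu-morphism with $(\varphi_1\otimes\varphi_2)(a\otimes b)=\varphi_1(a)\otimes\varphi_2(b)$. Let $I_{\mathbb Q}=\mathbb Q\cap(0,1)$. For $\varphi,\psi\in\mathrm{Cu}[S,T]$ write $\varphi\prec\psi$ if $\varphi(a')\ll\psi(a)$ whenever $a'\ll a$ in $S$. A path in $\mathrm{Cu}[S,T]$ is a family $\mathbf f=(f_\lambda)_{\lambda\in I_{\mathbb Q}}$ with $f_{\lambda'}\prec f_\lambda$ whenever $\lambda'<\lambda$. Write $\mathbf f\lesssim\mathbf g$ if for every $\lambda$ there is $\mu$ with $f_\lambda\prec g_\mu$. The internal hom $[\![S,T]\!]$ is the set of classes $[\mathbf f]$ of paths modulo ($\mathbf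 f\lesssim\mathbf g$ and $\mathbf g\lesssim\mathbf f$), with $[\mathbf f]+[\mathbf g]=[(f_\lambda+g_\lambda)_\lambda]$ and $[\mathbf f]\le[\mathbf g]$ iff $\mathbf f\lesssim\mathbf g$; it is a Cu-semigroup. The endpoint map $\sigma_{S,T}\colon[\![S,T]\!]\to\mathrm{Cu}[S,T]$ is $\sigma_{S,T}([\mathbf f])(a)=\sup_\lambda f_\lambda(a)$. It is known that for Cu-semigroups $S,T,P$ there is a bijection $\mathrm{Cu}(S,[\![T,P]\!])\cong\mathrm{Cu}(S\otimes T,P)$ sending $\alpha$ to the Cu-morphism $a\otimes b\mapsto\sigma_{T,P}(\alpha(a))(b)$. The evaluation map $\mathrm e_{S,T}\colon[\![S,T]\!]\otimes S\to T$ is the Cu-morphism corresponding to $\mathrm{id}_{[\![S,T]\!]}$. The external tensor product $\boxtimes\colon[\![S_1,T_1]\!]\otimes[\![S_2,T_2]\!]\to[\![S_1\otimes S_2,T_1\otimes T_2]\!]$, $x_1\otimes x_2\mapsto x_1\boxtimes x_2$, is (for arbitrary Cu-semigroups $S_1,S_2,T_1,T_2$) the Cu-morphism corresponding, under the bijection $\mathrm{Cu}([\![S_1,T_1]\!]\otimes[\![S_2,T_2]\!],[\![S_1\otimes S_2,T_1\otimes T_2]\!])\cong\mathrm{Cu}([\![S_1,T_1]\!]\otimes[\![S_2,T_2]\!]\otimes S_1\otimes S_2,T_1\otimes T_2)$ sending $\alpha$ to the Cu-morphism $u\otimes v\mapsto\sigma_{S_1\otimes S_2,T_1\otimes T_2}(\alpha(u))(v)$,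 to the Cu-morphism $(\mathrm e_{S_1,T_1}\otimes\mathrm e_{S_2,T_2})\circ(\mathrm{id}_{[\![S_1,T_1]\!]}\otimes\sigma\otimes\mathrm{id}_{S_2})\colon[\![S_1,T_1]\!]\otimes[\![S_2,T_2]\!]\otimes S_1\otimes S_2\to T_1\otimes T_2$, where $\sigma\colon[\![S_2,T_2]\!]\otimes S_1\to S_1\otimes[\![S_2,T_2]\!]$ is the flip isomorphism. *)

theory Defs
  imports "HOL-Algebra.Group" "HOL-Library.FuncSet" "HOL.Rat"
begin

section \<open>Cu-semigroups\<close>

text \<open>
  The monoid is the one of HOL-Algebra, written additively: the abbreviations below only
  rename \<open>mult\<close> and \<open>one\<close>.
\<close>

record 'a posemigroup = "'a monoid" +
  leq :: "'a \<Rightarrow> 'a \<Rightarrow> bool"  (infix "\<preceq>\<index>" 50)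

abbreviation posg_add :: "('a, 'm) posemigroup_scheme \<Rightarrow> 'a \<Rightarrow> 'a \<Rightarrow> 'a"  (infixl "\<oplus>\<index>" 65)
  where "posg_add S \<equiv> mult S"

abbreviation posg_zero :: "('a, 'm) posemigroup_scheme \<Rightarrow> 'a"  ("\<zero>\<index>")
  where "posg_zero S \<equiv> one S"

locale positively_ordered_semigroup = comm_monoid S
  for S :: "('a, 'm) posemigroup_scheme" (structure) +
  assumes leq_refl: "a \<in> carrier S \<Longrightarrow> a \<preceq> a"
    and leq_antisym:
      "\<lbrakk>a \<in> carrier S; b \<in> carrier S; a \<preceq> b; b \<preceq> a\<rbrakk> \<Longrightarrow> a = b"
    and leq_trans:
      "\<lbrakk>a \<in> carrier S; b \<in> carrier S; c \<in> carrier S; a \<preceq> b; b \<preceq> c\<rbrakk> \<Longrightarrow> a \<preceq> c"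
    and add_mono:
      "\<lbrakk>a \<in> carrier S; a' \<in> carrier S; b \<in> carrier S; b' \<in> carrier S; a \<preceq> a'; b \<preceq> b'\<rbrakk>
        \<Longrightarrow> a \<oplus> b \<preceq> a' \<oplus> b'"
    and zero_leq: "a \<in> carrier S \<Longrightarrow> \<zero> \<preceq> a"

definition is_supremum :: "('a, 'm) posemigroup_scheme \<Rightarrow> 'a set \<Rightarrow> 'a \<Rightarrow> bool"
  where "is_supremum S A s \<longleftrightarrow>
    s \<in> carrier S \<and> (\<forall>a\<in>A. a \<preceq>\<^bsub>S\<^esub> s) \<and>
    (\<forall>u\<in>carrier S. (\<forall>a\<in>A. a \<preceq>\<^bsub>S\<^esub> u) \<longrightarrow> s \<preceq>\<^bsub>S\<^esub> u)"

definition supremum :: "('a, 'm) posemigroup_scheme \<Rightarrow> 'a set \<Rightarrow> 'a"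
  where "supremum S A = (THE s. is_supremum S A s)"

definition increasing_seq :: "('a, 'm) posemigroup_scheme \<Rightarrow> (nat \<Rightarrow> 'a) \<Rightarrow> bool"
  where "increasing_seq S c \<longleftrightarrow>
    (\<forall>n. c n \<in> carrier S) \<and> (\<forall>n. c n \<preceq>\<^bsub>S\<^esub> c (Suc n))"

definition way_below :: "('a, 'm) posemigroup_scheme \<Rightarrow> 'a \<Rightarrow> 'a \<Rightarrow> bool"
    (infix "\<lless>\<index>" 50)
  where "a \<lless>\<^bsub>S\<^esub> b \<longleftrightarrow>
    (\<forall>c s. increasing_seq S c \<longrightarrow> is_supremum S (range c) s \<longrightarrow> b \<preceq>\<^bsub>S\<^esub> s \<longrightarrow>
      (\<exists>k. a \<preceq>\<^bsub>S\<^esub> c k))"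

locale cu_semigroup = positively_ordered_semigroup +
  assumes O1: "increasing_seq S c \<Longrightarrow> \<exists>s. is_supremum S (range c) s"
    and O2: "a \<in> carrier S \<Longrightarrow>
      \<exists>c. (\<forall>n. c n \<in> carrier S) \<and> (\<forall>n. c n \<lless> c (Suc n)) \<and> is_supremum S (range c) a"
    and O3: "\<lbrakk>a \<in> carrier S; a' \<in> carrier S; b \<in> carrier S; b' \<in> carrier S; a' \<lless> a; b' \<lless> b\<rbrakk>
      \<Longrightarrow> a' \<oplus> b' \<lless> a \<oplus> b"
    and O4: "\<lbrakk>increasing_seq S c; increasing_seq S d\<rbrakk> \<Longrightarrow>
      supremum S (range (\<lambda>n. c n \<oplus> d n)) = supremum S (range c) \<oplus> supremum S (range d)"


section \<open>Morphisms\<close>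

text \<open>
  Morphisms are extensional functions (undefined off the carrier), so that equality of
  elements of \<open>gen_cu_mor S T\<close> is equality of maps on the carrier.
\<close>

definition gen_cu_mor ::
    "('a, 'm) posemigroup_scheme \<Rightarrow> ('b, 'n) posemigroup_scheme \<Rightarrow> ('a \<Rightarrow> 'b) set"
  where "gen_cu_mor S T = {f \<in> carrier S \<rightarrow>\<^sub>E carrier T.
    (\<forall>a\<in>carrier S. \<forall>b\<in>carrier S. f (a \<oplus>\<^bsub>S\<^esub> b) = f a \<oplus>\<^bsub>T\<^esub> f b) \<and>
    f \<zero>\<^bsub>S\<^esub> = \<zero>\<^bsub>T\<^esub> \<and>
    (\<forall>a\<in>carrier S. \<forall>b\<in>carrier S. a \<preceq>\<^bsub>S\<^esub> b \<longrightarrow> f a \<preceq>\<^bsub>T\<^esub> f b) \<and>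
    (\<forall>c. increasing_seq S c \<longrightarrow> f (supremum S (range c)) = supremum T (range (\<lambda>n. f (c n))))}"

definition cu_mor ::
    "('a, 'm) posemigroup_scheme \<Rightarrow> ('b, 'n) posemigroup_scheme \<Rightarrow> ('a \<Rightarrow> 'b) set"
  where "cu_mor S T = {f \<in> gen_cu_mor S T.
    \<forall>a\<in>carrier S. \<forall>b\<in>carrier S. a \<lless>\<^bsub>S\<^esub> b \<longrightarrow> f a \<lless>\<^bsub>T\<^esub> f b}"

definition cu_id :: "('a, 'm) posemigroup_scheme \<Rightarrow> 'a \<Rightarrow> 'a"
  where "cu_id S = (\<lambda>a\<in>carrier S. a)"

definition cu_bimorphism ::
    "('a, 'm) posemigroup_scheme \<Rightarrow> ('b, 'n) posemigroup_scheme \<Rightarrow> ('c, 'k) posemigroup_scheme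
      \<Rightarrow> ('a \<Rightarrow> 'b \<Rightarrow> 'c) \<Rightarrow> bool"
  where "cu_bimorphism S T P \<phi> \<longleftrightarrow>
    (\<forall>a\<in>carrier S. \<forall>b\<in>carrier T. \<phi> a b \<in> carrier P) \<and>
    (\<forall>a\<in>carrier S. \<forall>a'\<in>carrier S. \<forall>b\<in>carrier T.
      \<phi> (a \<oplus>\<^bsub>S\<^esub> a') b = \<phi> a b \<oplus>\<^bsub>P\<^esub> \<phi> a' b) \<and>
    (\<forall>a\<in>carrier S. \<forall>b\<in>carrier T. \<forall>b'\<in>carrier T.
      \<phi> a (b \<oplus>\<^bsub>T\<^esub> b') = \<phi> a b \<oplus>\<^bsub>P\<^esub> \<phi> a b') \<and>
    (\<forall>b\<in>carrier T. \<phi> \<zero>\<^bsub>S\<^esub> b = \<zero>\<^bsub>P\<^esub>) \<and>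
    (\<forall>a\<in>carrier S. \<phi> a \<zero>\<^bsub>T\<^esub> = \<zero>\<^bsub>P\<^esub>) \<and>
    (\<forall>a\<in>carrier S. \<forall>a'\<in>carrier S. \<forall>b\<in>carrier T.
      a \<preceq>\<^bsub>S\<^esub> a' \<longrightarrow> \<phi> a b \<preceq>\<^bsub>P\<^esub> \<phi> a' b) \<and>
    (\<forall>a\<in>carrier S. \<forall>b\<in>carrier T. \<forall>b'\<in>carrier T.
      b \<preceq>\<^bsub>T\<^esub> b' \<longrightarrow> \<phi> a b \<preceq>\<^bsub>P\<^esub> \<phi> a b') \<and>
    (\<forall>a b. increasing_seq S a \<longrightarrow> increasing_seq T b \<longrightarrow>
      supremum P (range (\<lambda>k. \<phi> (a k) (b k)))
        = \<phi> (supremum S (range a)) (supremum T (range b))) \<and>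
    (\<forall>a\<in>carrier S. \<forall>a'\<in>carrier S. \<forall>b\<in>carrier T. \<forall>b'\<in>carrier T.
      a' \<lless>\<^bsub>S\<^esub> a \<longrightarrow> b' \<lless>\<^bsub>T\<^esub> b \<longrightarrow> \<phi> a' b' \<lless>\<^bsub>P\<^esub> \<phi> a b)"


section \<open>Tensor products\<close>

text \<open>
  The universal property: \<open>\<tau>\<close> is a Cu-bimorphism through which every Cu-bimorphism factors
  uniquely, and the order of Cu-morphisms out of \<open>X\<close> is detected on the elements \<open>\<tau> a b\<close>.
  HOL cannot quantify over types inside a formula, so the test objects \<open>P\<close> range over all
  Cu-semigroups with carrier in the type of \<open>X\<close>.
\<close>

definition is_cu_tensor ::
    "'a posemigroup \<Rightarrow> 'b posemigroup \<Rightarrow> 'c posemigroup \<Rightarrow> ('a \<Rightarrow> 'b \<Rightarrow> 'c) \<Rightarrow> bool"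
  where "is_cu_tensor S T X \<tau> \<longleftrightarrow>
    cu_semigroup X \<and> cu_bimorphism S T X \<tau> \<and>
    (\<forall>(P :: 'c posemigroup) \<phi>. cu_semigroup P \<longrightarrow> cu_bimorphism S T P \<phi> \<longrightarrow>
      (\<exists>!\<alpha>. \<alpha> \<in> cu_mor X P \<and> (\<forall>a\<in>carrier S. \<forall>b\<in>carrier T. \<alpha> (\<tau> a b) = \<phi> a b))) \<and>
    (\<forall>(P :: 'c posemigroup) \<alpha>\<^sub>1 \<alpha>\<^sub>2. cu_semigroup P \<longrightarrow> \<alpha>\<^sub>1 \<in> cu_mor X P \<longrightarrow> \<alpha>\<^sub>2 \<in> cu_mor X P \<longrightarrow>
      ((\<forall>u\<in>carrier X. \<alpha>\<^sub>1 u \<preceq>\<^bsub>P\<^esub> \<alpha>\<^sub>2 u) \<longleftrightarrow>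
       (\<forall>a\<in>carrier S. \<forall>b\<in>carrier T. \<alpha>\<^sub>1 (\<tau> a b) \<preceq>\<^bsub>P\<^esub> \<alpha>\<^sub>2 (\<tau> a b))))"

text \<open>
  The carrier type below is large enough for a tensor product of \<open>S\<close> and \<open>T\<close> which is universal
  with respect to all Cu-semigroups, of any type: every element of \<open>S \<otimes> T\<close> is the
  supremum of an increasing sequence of finite sums of elements \<open>a \<otimes> b\<close>, so \<open>S \<otimes> T\<close> has at most
  as many elements as there are sequences of lists of pairs, hence at most as many as there are
  sets of such lists. (Concretely, it may be built from countably generated round ideals of
  finite formal sums.) A pair satisfying \<open>is_cu_tensor\<close> on this type is isomorphic
  to it by uniqueness of universal objects, and so is itself universal for all types.
\<close>

type_synonym ('a, 'b) tensor_elem = "('a \<times> 'b) list set"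

definition cu_tensor_choice ::
    "'a posemigroup \<Rightarrow> 'b posemigroup \<Rightarrow>
      ('a, 'b) tensor_elem posemigroup \<times> ('a \<Rightarrow> 'b \<Rightarrow> ('a, 'b) tensor_elem)"
  where "cu_tensor_choice S T = (SOME p. is_cu_tensor S T (fst p) (snd p))"

definition cu_tensor ::
    "'a posemigroup \<Rightarrow> 'b posemigroup \<Rightarrow> ('a, 'b) tensor_elem posemigroup"
    (infixl "\<otimes>\<^sub>C\<^sub>u" 70)
  where "S \<otimes>\<^sub>C\<^sub>u T = fst (cu_tensor_choice S T)"

definition pure_tensor ::
    "'a posemigroup \<Rightarrow> 'b posemigroup \<Rightarrow> 'a \<Rightarrow> 'b \<Rightarrow> ('a, 'b) tensor_elem"
  where "pure_tensor S T = snd (cu_tensor_choice S T)"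

definition tensor_mor ::
    "'a posemigroup \<Rightarrow> 'b posemigroup \<Rightarrow> 'c posemigroup \<Rightarrow> 'd posemigroup \<Rightarrow>
      ('a \<Rightarrow> 'c) \<Rightarrow> ('b \<Rightarrow> 'd) \<Rightarrow> ('a, 'b) tensor_elem \<Rightarrow> ('c, 'd) tensor_elem"
  where "tensor_mor S\<^sub>1 S\<^sub>2 T\<^sub>1 T\<^sub>2 \<phi>\<^sub>1 \<phi>\<^sub>2 =
    (THE \<alpha>. \<alpha> \<in> cu_mor (S\<^sub>1 \<otimes>\<^sub>C\<^sub>u S\<^sub>2) (T\<^sub>1 \<otimes>\<^sub>C\<^sub>u T\<^sub>2) \<and>
      (\<forall>a\<in>carrier S\<^sub>1. \<forall>b\<in>carrier S\<^sub>2.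
        \<alpha> (pure_tensor S\<^sub>1 S\<^sub>2 a b) = pure_tensor T\<^sub>1 T\<^sub>2 (\<phi>\<^sub>1 a) (\<phi>\<^sub>2 b)))"

definition tensor_assoc ::
    "'a posemigroup \<Rightarrow> 'b posemigroup \<Rightarrow> 'c posemigroup \<Rightarrow>
      (('a, 'b) tensor_elem, 'c) tensor_elem \<Rightarrow> ('a, ('b, 'c) tensor_elem) tensor_elem"
  where "tensor_assoc S T P =
    (THE \<alpha>. \<alpha> \<in> cu_mor ((S \<otimes>\<^sub>C\<^sub>u T) \<otimes>\<^sub>C\<^sub>u P) (S \<otimes>\<^sub>C\<^sub>u (T \<otimes>\<^sub>C\<^sub>u P)) \<and>
      (\<forall>a\<in>carrier S. \<forall>b\<in>carrier T. \<forall>c\<in>carrier P.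
        \<alpha> (pure_tensor (S \<otimes>\<^sub>C\<^sub>u T) P (pure_tensor S T a b) c)
          = pure_tensor S (T \<otimes>\<^sub>C\<^sub>u P) a (pure_tensor T P b c)))"

definition tensor_assoc_inv ::
    "'a posemigroup \<Rightarrow> 'b posemigroup \<Rightarrow> 'c posemigroup \<Rightarrow>
      ('a, ('b, 'c) tensor_elem) tensor_elem \<Rightarrow> (('a, 'b) tensor_elem, 'c) tensor_elem"
  where "tensor_assoc_inv S T P =
    restrict (inv_into (carrier ((S \<otimes>\<^sub>C\<^sub>u T) \<otimes>\<^sub>C\<^sub>u P)) (tensor_assoc S T P))
      (carrier (S \<otimes>\<^sub>C\<^sub>u (T \<otimes>\<^sub>C\<^sub>u P)))"

definition tensor_flip ::
    "'a posemigroup \<Rightarrow> 'b posemigroup \<Rightarrow> ('a, 'b) tensor_elem \<Rightarrow> ('b, 'a) tensor_elem"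
  where "tensor_flip S T =
    (THE \<alpha>. \<alpha> \<in> cu_mor (S \<otimes>\<^sub>C\<^sub>u T) (T \<otimes>\<^sub>C\<^sub>u S) \<and>
      (\<forall>a\<in>carrier S. \<forall>b\<in>carrier T. \<alpha> (pure_tensor S T a b) = pure_tensor T S b a))"


section \<open>The internal hom\<close>

definition mor_prec ::
    "'a posemigroup \<Rightarrow> 'b posemigroup \<Rightarrow> ('a \<Rightarrow> 'b) \<Rightarrow> ('a \<Rightarrow> 'b) \<Rightarrow> bool"
  where "mor_prec S T \<phi> \<psi> \<longleftrightarrow>
    (\<forall>a\<in>carrier S. \<forall>a'\<in>carrier S. a' \<lless>\<^bsub>S\<^esub> a \<longrightarrow> \<phi> a' \<lless>\<^bsub>T\<^esub> \<psi> a)"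

definition I\<^sub>Q :: "rat set"
  where "I\<^sub>Q = {0<..<1}"

type_synonym ('a, 'b) path = "rat \<Rightarrow> 'a \<Rightarrow> 'b"

definition paths :: "'a posemigroup \<Rightarrow> 'b posemigroup \<Rightarrow> ('a, 'b) path set"
  where "paths S T = {f \<in> I\<^sub>Q \<rightarrow>\<^sub>E gen_cu_mor S T.
    \<forall>s\<in>I\<^sub>Q. \<forall>t\<in>I\<^sub>Q. s < t \<longrightarrow> mor_prec S T (f s) (f t)}"

definition path_le ::
    "'a posemigroup \<Rightarrow> 'b posemigroup \<Rightarrow> ('a, 'b) path \<Rightarrow> ('a, 'b) path \<Rightarrow> bool"
  where "path_le S T f g \<longleftrightarrow> (\<forall>s\<in>I\<^sub>Q. \<exists>t\<in>I\<^sub>Q. mor_prec S T (f s) (g t))"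

definition path_equiv ::
    "'a posemigroup \<Rightarrow> 'b posemigroup \<Rightarrow> (('a, 'b) path \<times> ('a, 'b) path) set"
  where "path_equiv S T =
    {(f, g). f \<in> paths S T \<and> g \<in> paths S T \<and> path_le S T f g \<and> path_le S T g f}"

definition path_class ::
    "'a posemigroup \<Rightarrow> 'b posemigroup \<Rightarrow> ('a, 'b) path \<Rightarrow> ('a, 'b) path set"
  where "path_class S T f = path_equiv S T `` {f}"

definition path_add ::
    "'a posemigroup \<Rightarrow> 'b posemigroup \<Rightarrow> ('a, 'b) path \<Rightarrow> ('a, 'b) path \<Rightarrow> ('a, 'b) path"
  where "path_add S T f g = (\<lambda>t\<in>I\<^sub>Q. \<lambda>a\<in>carrier S. f t a \<oplus>\<^bsub>T\<^esub> g t a)"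

definition path_zero :: "'a posemigroup \<Rightarrow> 'b posemigroup \<Rightarrow> ('a, 'b) path"
  where "path_zero S T = (\<lambda>t\<in>I\<^sub>Q. \<lambda>a\<in>carrier S. \<zero>\<^bsub>T\<^esub>)"

definition ihom :: "'a posemigroup \<Rightarrow> 'b posemigroup \<Rightarrow> ('a, 'b) path set posemigroup"
    ("\<lbrakk>_, _\<rbrakk>\<^sub>C\<^sub>u")
  where "\<lbrakk>S, T\<rbrakk>\<^sub>C\<^sub>u =
    \<lparr> carrier = paths S T // path_equiv S T,
      mult = (\<lambda>X Y. \<Union>f\<in>X. \<Union>g\<in>Y. path_class S T (path_add S T f g)),
      one = path_class S T (path_zero S T),
      leq = (\<lambda>X Y. \<exists>f\<in>X. \<exists>g\<in>Y. path_le S T f g) \<rparr>"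

definition endpoint ::
    "'a posemigroup \<Rightarrow> 'b posemigroup \<Rightarrow> ('a, 'b) path set \<Rightarrow> 'a \<Rightarrow> 'b"
  where "endpoint S T X = (let f = (SOME f. f \<in> X) in
    (\<lambda>a\<in>carrier S. supremum T ((\<lambda>t. f t a) ` I\<^sub>Q)))"

text \<open>
  The bijection \<open>Cu(S, \<lbrakk>T, P\<rbrakk>) \<cong> Cu(S \<otimes> T, P)\<close> and its inverse.
\<close>

definition cu_uncurry ::
    "'a posemigroup \<Rightarrow> 'b posemigroup \<Rightarrow> 'c posemigroup \<Rightarrow>
      ('a \<Rightarrow> ('b, 'c) path set) \<Rightarrow> ('a, 'b) tensor_elem \<Rightarrow> 'c"
  where "cu_uncurry S T P \<alpha> =
    (THE \<beta>. \<beta> \<in> cu_mor (S \<otimes>\<^sub>C\<^sub>u T) P \<and>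
      (\<forall>a\<in>carrier S. \<forall>b\<in>carrier T. \<beta> (pure_tensor S T a b) = endpoint T P (\<alpha> a) b))"

definition cu_curry ::
    "'a posemigroup \<Rightarrow> 'b posemigroup \<Rightarrow> 'c posemigroup \<Rightarrow>
      (('a, 'b) tensor_elem \<Rightarrow> 'c) \<Rightarrow> 'a \<Rightarrow> ('b, 'c) path set"
  where "cu_curry S T P \<beta> =
    (THE \<alpha>. \<alpha> \<in> cu_mor S \<lbrakk>T, P\<rbrakk>\<^sub>C\<^sub>u \<and> cu_uncurry S T P \<alpha> = \<beta>)"

definition cu_eval ::
    "'a posemigroup \<Rightarrow> 'b posemigroup \<Rightarrow> (('a, 'b) path set, 'a) tensor_elem \<Rightarrow> 'b"
  where "cu_eval S T = cu_uncurry \<lbrakk>S, T\<rbrakk>\<^sub>C\<^sub>u S T (cu_id \<lbrakk>S, T\<rbrakk>\<^sub>C\<^sub>u)"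

text \<open>
  The map \<open>\<lbrakk>S, T\<rbrakk> \<rightarrow> \<lbrakk>S', T'\<rbrakk>\<close>, \<open>[(f\<^sub>t)] \<mapsto> [(\<beta> \<circ> f\<^sub>t \<circ> \<alpha>)]\<close>, induced by Cu-morphisms
  \<open>\<alpha> : S' \<rightarrow> S\<close> and \<open>\<beta> : T \<rightarrow> T'\<close>.
\<close>

definition ihom_map ::
    "'a posemigroup \<Rightarrow> 'b posemigroup \<Rightarrow> 'c posemigroup \<Rightarrow> 'd posemigroup \<Rightarrow>
      ('c \<Rightarrow> 'a) \<Rightarrow> ('b \<Rightarrow> 'd) \<Rightarrow> ('a, 'b) path set \<Rightarrow> ('c, 'd) path set"
  where "ihom_map S T S' T' \<alpha> \<beta> X =
    (\<Union>f\<in>X. path_class S' T'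
      (\<lambda>t\<in>I\<^sub>Q. compose (carrier S') \<beta> (compose (carrier S') (f t) \<alpha>)))"


section \<open>The external tensor product\<close>

text \<open>
  The isomorphism \<open>(A \<otimes> B) \<otimes> (C \<otimes> D) \<rightarrow> (A \<otimes> C) \<otimes> (B \<otimes> D)\<close>, that is, \<open>id \<otimes> flip \<otimes> id\<close>
  on \<open>A \<otimes> B \<otimes> C \<otimes> D\<close> with the bracketings made explicit:
  \<open>(A \<otimes> B) \<otimes> (C \<otimes> D) \<rightarrow> A \<otimes> (B \<otimes> (C \<otimes> D)) \<rightarrow> A \<otimes> ((B \<otimes> C) \<otimes> D)
    \<rightarrow> A \<otimes> ((C \<otimes> B) \<otimes> D) \<rightarrow> A \<otimes> (C \<otimes> (B \<otimes> D)) \<rightarrow> (A \<otimes> C) \<otimes> (B \<otimes> D)\<close>.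
\<close>

definition middle_flip ::
    "'a posemigroup \<Rightarrow> 'b posemigroup \<Rightarrow> 'c posemigroup \<Rightarrow> 'd posemigroup \<Rightarrow>
      (('a, 'b) tensor_elem, ('c, 'd) tensor_elem) tensor_elem \<Rightarrow>
      (('a, 'c) tensor_elem, ('b, 'd) tensor_elem) tensor_elem"
  where "middle_flip A B C D =
    (\<lambda>u\<in>carrier ((A \<otimes>\<^sub>C\<^sub>u B) \<otimes>\<^sub>C\<^sub>u (C \<otimes>\<^sub>C\<^sub>u D)).
      tensor_assoc_inv A C (B \<otimes>\<^sub>C\<^sub>u D)
      (tensor_mor A ((C \<otimes>\<^sub>C\<^sub>u B) \<otimes>\<^sub>C\<^sub>u D) A (C \<otimes>\<^sub>C\<^sub>u (B \<otimes>\<^sub>C\<^sub>u D))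
        (cu_id A) (tensor_assoc C B D)
      (tensor_mor A ((B \<otimes>\<^sub>C\<^sub>u C) \<otimes>\<^sub>C\<^sub>u D) A ((C \<otimes>\<^sub>C\<^sub>u B) \<otimes>\<^sub>C\<^sub>u D)
        (cu_id A) (tensor_mor (B \<otimes>\<^sub>C\<^sub>u C) D (C \<otimes>\<^sub>C\<^sub>u B) D (tensor_flip B C) (cu_id D))
      (tensor_mor A (B \<otimes>\<^sub>C\<^sub>u (C \<otimes>\<^sub>C\<^sub>u D)) A ((B \<otimes>\<^sub>C\<^sub>u C) \<otimes>\<^sub>C\<^sub>u D)
        (cu_id A) (tensor_assoc_inv B C D)
      (tensor_assoc A B (C \<otimes>\<^sub>C\<^sub>u D) u)))))"

definition ext_tensor_mor ::
    "'a posemigroup \<Rightarrow> 'b posemigroup \<Rightarrow> 'c posemigroup \<Rightarrow> 'd posemigroup \<Rightarrow>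
      (('a, 'b) path set, ('c, 'd) path set) tensor_elem \<Rightarrow>
      (('a, 'c) tensor_elem, ('b, 'd) tensor_elem) path set"
  where "ext_tensor_mor S\<^sub>1 T\<^sub>1 S\<^sub>2 T\<^sub>2 =
    cu_curry (\<lbrakk>S\<^sub>1, T\<^sub>1\<rbrakk>\<^sub>C\<^sub>u \<otimes>\<^sub>C\<^sub>u \<lbrakk>S\<^sub>2, T\<^sub>2\<rbrakk>\<^sub>C\<^sub>u) (S\<^sub>1 \<otimes>\<^sub>C\<^sub>u S\<^sub>2) (T\<^sub>1 \<otimes>\<^sub>C\<^sub>u T\<^sub>2)
      (compose (carrier ((\<lbrakk>S\<^sub>1, T\<^sub>1\<rbrakk>\<^sub>C\<^sub>u \<otimes>\<^sub>C\<^sub>u \<lbrakk>S\<^sub>2, T\<^sub>2\<rbrakk>\<^sub>C\<^sub>u) \<otimes>\<^sub>C\<^sub>u (S\<^sub>1 \<otimes>\<^sub>C\<^sub>u S\<^sub>2)))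
        (tensor_mor (\<lbrakk>S\<^sub>1, T\<^sub>1\<rbrakk>\<^sub>C\<^sub>u \<otimes>\<^sub>C\<^sub>u S\<^sub>1) (\<lbrakk>S\<^sub>2, T\<^sub>2\<rbrakk>\<^sub>C\<^sub>u \<otimes>\<^sub>C\<^sub>u S\<^sub>2) T\<^sub>1 T\<^sub>2
          (cu_eval S\<^sub>1 T\<^sub>1) (cu_eval S\<^sub>2 T\<^sub>2))
        (middle_flip \<lbrakk>S\<^sub>1, T\<^sub>1\<rbrakk>\<^sub>C\<^sub>u \<lbrakk>S\<^sub>2, T\<^sub>2\<rbrakk>\<^sub>C\<^sub>u S\<^sub>1 S\<^sub>2))"

text \<open>
  \<open>ext_tensor S\<^sub>1 T\<^sub>1 S\<^sub>2 T\<^sub>2 x\<^sub>1 x\<^sub>2\<close> is the element \<open>x\<^sub>1 \<boxtimes> x\<^sub>2\<close> of \<open>\<lbrakk>S\<^sub>1 \<otimes> S\<^sub>2, T\<^sub>1 \<otimes> T\<^sub>2\<rbrakk>\<close>, for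
  \<open>x\<^sub>1 \<in> \<lbrakk>S\<^sub>1, T\<^sub>1\<rbrakk>\<close> and \<open>x\<^sub>2 \<in> \<lbrakk>S\<^sub>2, T\<^sub>2\<rbrakk>\<close>.
\<close>

definition ext_tensor ::
    "'a posemigroup \<Rightarrow> 'b posemigroup \<Rightarrow> 'c posemigroup \<Rightarrow> 'd posemigroup \<Rightarrow>
      ('a, 'b) path set \<Rightarrow> ('c, 'd) path set \<Rightarrow>
      (('a, 'c) tensor_elem, ('b, 'd) tensor_elem) path set"
  where "ext_tensor S\<^sub>1 T\<^sub>1 S\<^sub>2 T\<^sub>2 x\<^sub>1 x\<^sub>2 =
    ext_tensor_mor S\<^sub>1 T\<^sub>1 S\<^sub>2 T\<^sub>2 (pure_tensor \<lbrakk>S\<^sub>1, T\<^sub>1\<rbrakk>\<^sub>C\<^sub>u \<lbrakk>S\<^sub>2, T\<^sub>2\<rbrakk>\<^sub>C\<^sub>u x\<^sub>1 x\<^sub>2)"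

end

theory Submission
  imports Defs "HOL-Library.Countable"
begin

text \<open>
  Write \<open>\<sigma>\<close> for the endpoint map. The external tensor product is a Cu-bimorphism with
  \<open>\<sigma>(x \<boxtimes> y)(a \<otimes> b) = \<sigma>(x)(a) \<otimes> \<sigma>(y)(b)\<close>, so the two sides of the claim have the same
  endpoint up to the associator. An element \<open>x\<close> of an internal hom is not determined by
  \<open>\<sigma>(x)\<close>, but it is determined by the maps \<open>\<sigma>(x\<^sub>n)\<close> for any sequence
  \<open>x\<^sub>0 \<lless> x\<^sub>1 \<lless> \<dots>\<close> with supremum \<open>x\<close>; as \<open>\<boxtimes>\<close> preserves such sequences, applying the
  formula to approximating sequences of \<open>x\<close>, \<open>y\<close> and \<open>z\<close> gives the theorem.

  Tensor products and internal homs are both obtained as countably generated round ideals of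
  a monoid with an additive, transitive, interpolating relation. For the tensor product the
  monoid consists of the finite formal sums of pairs; this makes the universal property hold
  for test objects of every type.
\<close>

section \<open>Basic facts on Cu-semigroups\<close>

text \<open>The tensor product, the associator and currying are given by \<open>SOME\<close> and
  \<open>THE\<close>, and \<open>is_cu_tensor\<close> speaks only of Cu-morphisms into test objects
  on one carrier type. An explicit model is therefore needed twice: to show that the choice
  succeeds, and to reach targets of other types by comparison with the chosen product. The model
  also extends maps that ignore \<open>\<lless>\<close>. These cannot be avoided: the
  \<open>\<lless>\<close>-condition on a bimorphism is joint, so it is lost when one variable is
  frozen, and freezing a variable is how the associator is constructed. For the internal hom,
  \<open>mor_prec\<close> alone does not give a basis relation with interpolation, so the relation
  used has to remember a path between its two arguments. Endpoints along an approximating sequence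
  determine an element because they interleave with every path \<open>f\<close> representing it:
  each \<open>f s\<close> lies below the endpoint of some \<open>x\<^sub>n\<close>, and each such
  endpoint lies below some \<open>f t\<close>.\<close>

context positively_ordered_semigroup
begin

lemma is_supremum_unique:
  "is_supremum S A s \<Longrightarrow> is_supremum S A s' \<Longrightarrow> s = s'"
  unfolding is_supremum_def by (meson leq_antisym)

lemma supremum_eq: "is_supremum S A s \<Longrightarrow> supremum S A = s"
  unfolding supremum_def by (blast intro: is_supremum_unique the_equality)

lemma increasing_seq_le: "increasing_seq S c \<Longrightarrow> m \<le> n \<Longrightarrow> c m \<preceq> c n"
proof (induction n)
  case 0 then show ?case by (simp add: increasing_seq_def leq_refl)
next
  case (Suc n)
  then show ?case
    by (metis increasing_seq_def le_Suc_eq leq_refl leq_trans)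
qed

lemma is_supremum_cofinal:
  assumes "is_supremum S A s" "A \<subseteq> carrier S" "B \<subseteq> carrier S"
    and "\<And>a. a \<in> A \<Longrightarrow> \<exists>b\<in>B. a \<preceq> b" and "\<And>b. b \<in> B \<Longrightarrow> \<exists>a\<in>A. b \<preceq> a"
  shows "is_supremum S B s"
  using assms unfolding is_supremum_def by (meson leq_trans subsetD)

lemma is_supremum_const: "a \<in> carrier S \<Longrightarrow> is_supremum S (range (\<lambda>n::nat. a)) a"
  by (auto simp: is_supremum_def leq_refl)

lemma increasing_seq_const: "a \<in> carrier S \<Longrightarrow> increasing_seq S (\<lambda>n. a)"
  by (auto simp: increasing_seq_def leq_refl)

lemma increasing_seq_carrier: "increasing_seq S c \<Longrightarrow> c n \<in> carrier S"
  by (auto simp: increasing_seq_def)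

lemma is_supremum_carrier: "is_supremum S A s \<Longrightarrow> s \<in> carrier S"
  by (auto simp: is_supremum_def)

lemma is_supremum_upper: "is_supremum S (range c) s \<Longrightarrow> c n \<preceq> s"
  by (auto simp: is_supremum_def)

lemma is_supremum_least:
  "is_supremum S (range c) s \<Longrightarrow> u \<in> carrier S \<Longrightarrow> (\<And>n. c n \<preceq> u) \<Longrightarrow> s \<preceq> u"
  by (auto simp: is_supremum_def)

lemma way_below_leq: "a \<lless> b \<Longrightarrow> a \<in> carrier S \<Longrightarrow> b \<in> carrier S \<Longrightarrow> a \<preceq> b"
  unfolding way_below_def using increasing_seq_const is_supremum_const leq_refl by blast

lemma leq_way_below_trans:
  "a \<preceq> b \<Longrightarrow> b \<lless> c \<Longrightarrow> a \<in> carrier S \<Longrightarrow> b \<in> carrier S \<Longrightarrow> a \<lless> c"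
  unfolding way_below_def by (meson increasing_seq_carrier leq_trans)

lemma way_below_leq_trans:
  "a \<lless> b \<Longrightarrow> b \<preceq> c \<Longrightarrow> b \<in> carrier S \<Longrightarrow> c \<in> carrier S \<Longrightarrow> a \<lless> c"
  unfolding way_below_def by (meson is_supremum_carrier leq_trans)

lemma way_below_trans:
  "a \<lless> b \<Longrightarrow> b \<lless> c \<Longrightarrow> a \<in> carrier S \<Longrightarrow> b \<in> carrier S \<Longrightarrow> c \<in> carrier S \<Longrightarrow> a \<lless> c"
  using way_below_leq way_below_leq_trans by blast

lemma zero_way_below: "\<zero> \<lless> a"
  unfolding way_below_def by (meson increasing_seq_carrier zero_leq)

lemma way_below_supremum:
  "a \<lless> b \<Longrightarrow> increasing_seq S c \<Longrightarrow> is_supremum S (range c) s \<Longrightarrow> b \<preceq> s \<Longrightarrow> \<exists>k. a \<preceq> c k"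
  unfolding way_below_def by blast

lemma leq_zero_eq: "a \<in> carrier S \<Longrightarrow> a \<preceq> \<zero> \<Longrightarrow> a = \<zero>"
  by (meson leq_antisym one_closed zero_leq)

lemma increasing_seq_add:
  "increasing_seq S c \<Longrightarrow> increasing_seq S d \<Longrightarrow> increasing_seq S (\<lambda>n. c n \<oplus> d n)"
  by (auto simp: increasing_seq_def add_mono)

end

definition way_below_seq :: "('a, 'm) posemigroup_scheme \<Rightarrow> (nat \<Rightarrow> 'a) \<Rightarrow> bool"
  where "way_below_seq S c \<longleftrightarrow> (\<forall>n. c n \<in> carrier S \<and> c n \<lless>\<^bsub>S\<^esub> c (Suc n))"

context positively_ordered_semigroup
begin

lemma way_below_seq_increasing: "way_below_seq S c \<Longrightarrow> increasing_seq S c"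
  unfolding way_below_seq_def increasing_seq_def using way_below_leq by blast

lemma way_below_seq_supremum:
  assumes "way_below_seq S c" "is_supremum S (range c) a" shows "c n \<lless> a"
  using assms unfolding way_below_seq_def
  by (meson is_supremum_carrier is_supremum_upper way_below_leq_trans)

end

context cu_semigroup
begin

lemma is_supremum_supremum:
  "increasing_seq S c \<Longrightarrow> is_supremum S (range c) (supremum S (range c))"
  using O1 supremum_eq by metis

lemma way_below_approx:
  assumes "a \<in> carrier S"
  obtains c where "way_below_seq S c" "is_supremum S (range c) a"
  using O2[OF assms] that unfolding way_below_seq_def by blast

text \<open>An approximating sequence of \<open>c\<close> reaches above \<open>a\<close> at some
  index \<open>k\<close>; the member after it has room on both sides.\<close>

lemma way_below_interpolation:
  assumes "a \<lless> c" "a \<in> carrier S" "c \<in> carrier S"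
  obtains b where "b \<in> carrier S" "a \<lless> b" "b \<lless> c"
proof -
  obtain d where d: "way_below_seq S d" "is_supremum S (range d) c"
    using way_below_approx assms by blast
  then obtain k where "a \<preceq> d k"
    using assms way_below_supremum[OF assms(1) way_below_seq_increasing[OF d(1)] d(2)] leq_refl
    by blast
  with d assms have "a \<lless> d (Suc k)" "d (Suc k) \<in> carrier S" "d (Suc k) \<lless> c"
    using leq_way_below_trans way_below_seq_supremum unfolding way_below_seq_def by blast+
  then show ?thesis using that by blast
qed

text \<open>The definition of \<open>\<lless>\<close> yields only \<open>a \<preceq> c k\<close>.
  Applying it to an interpolated element \<open>d\<close> leaves a margin between \<open>a\<close>
  and \<open>c k\<close>.\<close>

lemma way_below_supremum':
  assumes "a \<lless> b" "a \<in> carrier S" "b \<in> carrier S"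
    and "increasing_seq S c" "is_supremum S (range c) b"
  obtains k where "a \<lless> c k"
proof -
  obtain d where d: "d \<in> carrier S" "a \<lless> d" "d \<lless> b"
    using way_below_interpolation assms by blast
  then obtain k where "d \<preceq> c k"
    using way_below_supremum assms leq_refl by blast
  then show ?thesis
    using that d assms way_below_leq_trans increasing_seq_carrier by blast
qed

lemma is_supremum_add:
  assumes "increasing_seq S c" "increasing_seq S d"
    "is_supremum S (range c) a" "is_supremum S (range d) b"
  shows "is_supremum S (range (\<lambda>n. c n \<oplus> d n)) (a \<oplus> b)"
  using is_supremum_supremum[OF increasing_seq_add[OF assms(1,2)]]
  unfolding O4[OF assms(1,2)] supremum_eq[OF assms(3)] supremum_eq[OF assms(4)] .

end

text \<open>For suprema only leastness is demanded: monotonicity already makes \<open>f s\<close> an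
  upper bound of the images. Phrasing it through \<open>is_supremum\<close> keeps the description
  operator in \<open>supremum\<close> out of later verifications.\<close>

lemma gen_cu_morI:
  assumes "cu_semigroup S" "cu_semigroup T" "f \<in> carrier S \<rightarrow>\<^sub>E carrier T"
    and "\<And>a b. a \<in> carrier S \<Longrightarrow> b \<in> carrier S \<Longrightarrow> f (a \<oplus>\<^bsub>S\<^esub> b) = f a \<oplus>\<^bsub>T\<^esub> f b"
    and "f \<zero>\<^bsub>S\<^esub> = \<zero>\<^bsub>T\<^esub>"
    and "\<And>a b. a \<in> carrier S \<Longrightarrow> b \<in> carrier S \<Longrightarrow> a \<preceq>\<^bsub>S\<^esub> b \<Longrightarrow> f a \<preceq>\<^bsub>T\<^esub> f b"
    and "\<And>c s u. increasing_seq S c \<Longrightarrow> is_supremum S (range c) s \<Longrightarrow> u \<in> carrier T \<Longrightarrow>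
      (\<And>n. f (c n) \<preceq>\<^bsub>T\<^esub> u) \<Longrightarrow> f s \<preceq>\<^bsub>T\<^esub> u"
  shows "f \<in> gen_cu_mor S T"
proof -
  interpret S: cu_semigroup S by fact
  interpret T: cu_semigroup T by fact
  have "f (supremum S (range c)) = supremum T (range (\<lambda>n. f (c n)))"
    if c: "increasing_seq S c" for c
  proof -
    have s: "is_supremum S (range c) (supremum S (range c))" (is "is_supremum S _ ?s")
      using c S.is_supremum_supremum by blast
    have "is_supremum T (range (\<lambda>n. f (c n))) (f ?s)"
      unfolding is_supremum_def
      using assms(3,6) assms(7)[OF c s] s S.is_supremum_upper[OF s] S.is_supremum_carrier[OF s]
        S.increasing_seq_carrier[OF c] by (auto simp: PiE_iff)
    then show ?thesis using T.supremum_eq by metis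
  qed
  then show ?thesis unfolding gen_cu_mor_def using assms by auto
qed

lemma gen_cu_mor_closed: "f \<in> gen_cu_mor S T \<Longrightarrow> a \<in> carrier S \<Longrightarrow> f a \<in> carrier T"
  and gen_cu_mor_add: "f \<in> gen_cu_mor S T \<Longrightarrow> a \<in> carrier S \<Longrightarrow> b \<in> carrier S \<Longrightarrow>
    f (a \<oplus>\<^bsub>S\<^esub> b) = f a \<oplus>\<^bsub>T\<^esub> f b"
  and gen_cu_mor_zero: "f \<in> gen_cu_mor S T \<Longrightarrow> f \<zero>\<^bsub>S\<^esub> = \<zero>\<^bsub>T\<^esub>"
  and gen_cu_mor_mono: "f \<in> gen_cu_mor S T \<Longrightarrow> a \<in> carrier S \<Longrightarrow> b \<in> carrier S \<Longrightarrow>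
    a \<preceq>\<^bsub>S\<^esub> b \<Longrightarrow> f a \<preceq>\<^bsub>T\<^esub> f b"
  and gen_cu_mor_extensional: "f \<in> gen_cu_mor S T \<Longrightarrow> f \<in> extensional (carrier S)"
  unfolding gen_cu_mor_def by (auto simp: PiE_iff)

lemma gen_cu_mor_increasing:
  "f \<in> gen_cu_mor S T \<Longrightarrow> increasing_seq S c \<Longrightarrow> increasing_seq T (\<lambda>n. f (c n))"
  unfolding increasing_seq_def using gen_cu_mor_closed gen_cu_mor_mono by metis

lemma gen_cu_mor_supremum:
  assumes "cu_semigroup S" "cu_semigroup T" "f \<in> gen_cu_mor S T"
    "increasing_seq S c" "is_supremum S (range c) s"
  shows "is_supremum T (range (\<lambda>n. f (c n))) (f s)"
proof -
  interpret S: cu_semigroup S by fact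
  interpret T: cu_semigroup T by fact
  have "f (supremum S (range c)) = supremum T (range (\<lambda>n. f (c n)))"
    using assms unfolding gen_cu_mor_def by blast
  then show ?thesis
    using S.supremum_eq[OF assms(5)] T.is_supremum_supremum gen_cu_mor_increasing assms by metis
qed

lemma gen_cu_mor_eqI:
  "f \<in> gen_cu_mor S T \<Longrightarrow> g \<in> gen_cu_mor S T \<Longrightarrow> (\<And>a. a \<in> carrier S \<Longrightarrow> f a = g a) \<Longrightarrow> f = g"
  using gen_cu_mor_extensional extensionalityI by metis

lemma cu_mor_gen: "f \<in> cu_mor S T \<Longrightarrow> f \<in> gen_cu_mor S T"
  and cu_mor_way_below: "f \<in> cu_mor S T \<Longrightarrow> a \<in> carrier S \<Longrightarrow> b \<in> carrier S \<Longrightarrow>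
    a \<lless>\<^bsub>S\<^esub> b \<Longrightarrow> f a \<lless>\<^bsub>T\<^esub> f b"
  unfolding cu_mor_def by auto

lemma gen_cu_mor_compose:
  assumes "cu_semigroup S" "cu_semigroup T" "cu_semigroup P"
    "f \<in> gen_cu_mor S T" "g \<in> gen_cu_mor T P"
  shows "compose (carrier S) g f \<in> gen_cu_mor S P"
proof -
  interpret S: cu_semigroup S by fact
  interpret P: cu_semigroup P by fact
  show ?thesis
  proof (rule gen_cu_morI)
    fix c s u
    assume c: "increasing_seq S c" "is_supremum S (range c) s" and u: "u \<in> carrier P"
      and le: "\<And>n. compose (carrier S) g f (c n) \<preceq>\<^bsub>P\<^esub> u"
    have "is_supremum P (range (\<lambda>n. g (f (c n)))) (g (f s))"
      using gen_cu_mor_supremum[OF assms(2,3,5) gen_cu_mor_increasing[OF assms(4) c(1)]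
        gen_cu_mor_supremum[OF assms(1,2,4) c]] .
    then have "g (f s) \<preceq>\<^bsub>P\<^esub> u"
      using P.is_supremum_least le u S.increasing_seq_carrier[OF c(1)]
      by (auto simp: compose_def)
    then show "compose (carrier S) g f s \<preceq>\<^bsub>P\<^esub> u"
      using S.is_supremum_carrier[OF c(2)] by (simp add: compose_def)
  qed (use assms in \<open>auto simp: compose_def gen_cu_mor_closed gen_cu_mor_add gen_cu_mor_zero
        gen_cu_mor_mono\<close>)
qed

lemma cu_mor_compose:
  assumes "cu_semigroup S" "cu_semigroup T" "cu_semigroup P"
    "f \<in> cu_mor S T" "g \<in> cu_mor T P"
  shows "compose (carrier S) g f \<in> cu_mor S P"
  using gen_cu_mor_compose[OF assms(1-3)] assms(4,5)
  by (auto simp: cu_mor_def compose_def gen_cu_mor_closed)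

lemma cu_id_mor: "cu_semigroup S \<Longrightarrow> cu_id S \<in> cu_mor S S"
proof -
  assume S: "cu_semigroup S"
  interpret cu_semigroup S by fact
  have "cu_id S \<in> gen_cu_mor S S"
    by (rule gen_cu_morI[OF S S])
      (auto simp: cu_id_def is_supremum_def increasing_seq_carrier)
  then show ?thesis by (auto simp: cu_mor_def cu_id_def)
qed

lemma gen_cu_mor_plus:
  assumes "cu_semigroup S" "cu_semigroup T" "f \<in> gen_cu_mor S T" "g \<in> gen_cu_mor S T"
  shows "(\<lambda>a\<in>carrier S. f a \<oplus>\<^bsub>T\<^esub> g a) \<in> gen_cu_mor S T"
proof -
  interpret S: cu_semigroup S by fact
  interpret T: cu_semigroup T by fact
  show ?thesis
  proof (rule gen_cu_morI)
    fix c s u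
    assume c: "increasing_seq S c" "is_supremum S (range c) s" and u: "u \<in> carrier T"
      and le: "\<And>n. (\<lambda>a\<in>carrier S. f a \<oplus>\<^bsub>T\<^esub> g a) (c n) \<preceq>\<^bsub>T\<^esub> u"
    have "is_supremum T (range (\<lambda>n. f (c n) \<oplus>\<^bsub>T\<^esub> g (c n))) (f s \<oplus>\<^bsub>T\<^esub> g s)"
      by (intro T.is_supremum_add gen_cu_mor_increasing[OF assms(3) c(1)]
          gen_cu_mor_increasing[OF assms(4) c(1)] gen_cu_mor_supremum[OF assms(1,2,3) c]
          gen_cu_mor_supremum[OF assms(1,2,4) c])
    then have "f s \<oplus>\<^bsub>T\<^esub> g s \<preceq>\<^bsub>T\<^esub> u"
      using T.is_supremum_least le u S.increasing_seq_carrier[OF c(1)] by auto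
    then show "(\<lambda>a\<in>carrier S. f a \<oplus>\<^bsub>T\<^esub> g a) s \<preceq>\<^bsub>T\<^esub> u"
      using S.is_supremum_carrier[OF c(2)] by simp
  qed (use assms in \<open>auto simp: gen_cu_mor_closed gen_cu_mor_add gen_cu_mor_zero
        gen_cu_mor_mono T.add_mono T.m_ac\<close>)
qed

lemma gen_cu_mor_const_zero:
  assumes "cu_semigroup S" "cu_semigroup T"
  shows "(\<lambda>a\<in>carrier S. \<zero>\<^bsub>T\<^esub>) \<in> gen_cu_mor S T"
proof -
  interpret S: cu_semigroup S by fact
  interpret T: cu_semigroup T by fact
  show ?thesis
    by (rule gen_cu_morI) (use assms in \<open>auto simp: T.leq_refl S.is_supremum_carrier T.zero_leq\<close>)
qed

text \<open>Additivity is (O4) in \<open>T\<close>, and suprema are preserved because two suprema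
  commute. This serves both for endpoints, as suprema along a chain, and for continuity in the third
  variable of a trimorphism.\<close>

lemma gen_cu_mor_pointwise_supremum:
  assumes "cu_semigroup S" "cu_semigroup T" and F: "\<And>k. F k \<in> gen_cu_mor S T"
    and inc: "\<And>k a. a \<in> carrier S \<Longrightarrow> F k a \<preceq>\<^bsub>T\<^esub> F (Suc k) a"
    and f: "f \<in> extensional (carrier S)"
      "\<And>a. a \<in> carrier S \<Longrightarrow> is_supremum T (range (\<lambda>k. F k a)) (f a)"
  shows "f \<in> gen_cu_mor S T"
proof -
  interpret S: cu_semigroup S by fact
  interpret T: cu_semigroup T by fact
  have incF: "increasing_seq T (\<lambda>k. F k a)" if "a \<in> carrier S" for a
    using inc that gen_cu_mor_closed[OF F] by (auto simp: increasing_seq_def)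
  have cl: "f a \<in> carrier T" if "a \<in> carrier S" for a
    using T.is_supremum_carrier f that by blast
  show ?thesis
  proof (rule gen_cu_morI)
    show "f \<in> carrier S \<rightarrow>\<^sub>E carrier T" using cl f by (auto simp: PiE_def)
    fix a b assume ab: "a \<in> carrier S" "b \<in> carrier S"
    have "is_supremum T (range (\<lambda>k. F k (a \<oplus>\<^bsub>S\<^esub> b))) (f a \<oplus>\<^bsub>T\<^esub> f b)"
      using T.is_supremum_add[OF incF incF f(2) f(2)] ab gen_cu_mor_add[OF F] by simp
    then show "f (a \<oplus>\<^bsub>S\<^esub> b) = f a \<oplus>\<^bsub>T\<^esub> f b"
      using f(2) ab T.is_supremum_unique by blast
    show "f a \<preceq>\<^bsub>T\<^esub> f b" if "a \<preceq>\<^bsub>S\<^esub> b"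
    proof (rule T.is_supremum_least[OF f(2)])
      show "F n a \<preceq>\<^bsub>T\<^esub> f b" for n
        using T.leq_trans[of "F n a" "F n b" "f b"] gen_cu_mor_mono[OF F ab that]
          T.is_supremum_upper[OF f(2)[OF ab(2)]] cl ab gen_cu_mor_closed[OF F] by blast
    qed (use ab cl in auto)
  next
    have "is_supremum T (range (\<lambda>k::nat. \<zero>\<^bsub>T\<^esub>)) (f \<zero>\<^bsub>S\<^esub>)"
      using f(2)[of "\<zero>\<^bsub>S\<^esub>"] gen_cu_mor_zero[OF F] by simp
    then show "f \<zero>\<^bsub>S\<^esub> = \<zero>\<^bsub>T\<^esub>"
      using T.is_supremum_const T.is_supremum_unique by blast
  next
    fix c s u
    assume c: "increasing_seq S c" "is_supremum S (range c) s" and u: "u \<in> carrier T"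
      and le: "\<And>n. f (c n) \<preceq>\<^bsub>T\<^esub> u"
    have s: "s \<in> carrier S" and cn: "\<And>n. c n \<in> carrier S"
      using c S.is_supremum_carrier S.increasing_seq_carrier by auto
    show "f s \<preceq>\<^bsub>T\<^esub> u"
    proof (rule T.is_supremum_least[OF f(2)[OF s] u])
      fix k
      show "F k s \<preceq>\<^bsub>T\<^esub> u"
      proof (rule T.is_supremum_least[OF gen_cu_mor_supremum[OF assms(1,2) F c] u])
        fix n
        show "F k (c n) \<preceq>\<^bsub>T\<^esub> u"
          using T.leq_trans[OF _ _ u T.is_supremum_upper[OF f(2)[OF cn]] le] cl cn
            gen_cu_mor_closed[OF F] by blast
      qed
    qed
  qed (use assms in auto)
qed

section \<open>Round ideal completions\<close>

text \<open>The common abstraction of formal sums and of generalized morphisms. Commutativity is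
  demanded only up to what lies below, because concatenation of lists is not commutative; for ideals
  this weak form gives genuine commutativity.\<close>

locale round_monoid =
  fixes B :: "'b set" and pls :: "'b \<Rightarrow> 'b \<Rightarrow> 'b" (infixl "\<boxplus>" 65) and zr :: 'b
    and prec :: "'b \<Rightarrow> 'b \<Rightarrow> bool" (infix "\<sqsubset>" 50)
  assumes prec_carrier: "f \<sqsubset> g \<Longrightarrow> f \<in> B \<and> g \<in> B"
    and prec_trans: "f \<sqsubset> g \<Longrightarrow> g \<sqsubset> h \<Longrightarrow> f \<sqsubset> h"
    and prec_interpolation: "f \<sqsubset> h \<Longrightarrow> \<exists>g. f \<sqsubset> g \<and> g \<sqsubset> h"
    and prec_plus: "f \<sqsubset> g \<Longrightarrow> f' \<sqsubset> g' \<Longrightarrow> f \<boxplus> f' \<sqsubset> g \<boxplus> g'"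
    and zr_prec: "f \<in> B \<Longrightarrow> zr \<sqsubset> f"
    and zr_carrier: "zr \<in> B"
    and plus_commute: "g \<in> B \<Longrightarrow> h \<in> B \<Longrightarrow> f \<sqsubset> g \<boxplus> h \<Longrightarrow> f \<sqsubset> h \<boxplus> g"
    and plus_assoc: "f \<in> B \<Longrightarrow> g \<in> B \<Longrightarrow> h \<in> B \<Longrightarrow> (f \<boxplus> g) \<boxplus> h = f \<boxplus> (g \<boxplus> h)"
    and zr_plus: "f \<in> B \<Longrightarrow> zr \<boxplus> f = f"
begin

definition chain :: "(nat \<Rightarrow> 'b) \<Rightarrow> bool"
  where "chain x \<longleftrightarrow> (\<forall>n. x n \<sqsubset> x (Suc n))"

text \<open>Ideals are generated by sequences, not by arbitrary directed sets, so that the countable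
  approximation axiom (O2) can hold in the completion.\<close>

definition ideal_of :: "(nat \<Rightarrow> 'b) \<Rightarrow> 'b set"
  where "ideal_of x = {f. \<exists>n. f \<sqsubset> x n}"

definition completion :: "'b set posemigroup"
  where "completion = \<lparr>carrier = ideal_of ` {x. chain x},
    mult = (\<lambda>I J. {f. \<exists>g\<in>I. \<exists>h\<in>J. f \<sqsubset> g \<boxplus> h}),
    one = {f. f \<sqsubset> zr},
    leq = (\<subseteq>)\<rparr>"

lemma chain_less:
  assumes "chain x" shows "m < n \<Longrightarrow> x m \<sqsubset> x n"
proof (induction n)
  case (Suc n) then show ?case
    using assms prec_trans unfolding chain_def less_Suc_eq by blast
qed simp

lemma ideal_of_in: "chain x \<Longrightarrow> ideal_of x \<in> carrier completion"
  by (simp add: completion_def)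

lemma completion_cases:
  assumes "I \<in> carrier completion"
  obtains x where "chain x" "I = ideal_of x"
  using assms by (auto simp: completion_def)

lemma chain_in_ideal: "chain x \<Longrightarrow> x n \<in> ideal_of x"
  unfolding chain_def ideal_of_def by blast

lemma ideal_down: "I \<in> carrier completion \<Longrightarrow> g \<in> I \<Longrightarrow> f \<sqsubset> g \<Longrightarrow> f \<in> I"
  by (auto simp: completion_def ideal_of_def intro: prec_trans)

lemma ideal_directed:
  assumes "I \<in> carrier completion" "f \<in> I" "g \<in> I"
  obtains h where "h \<in> I" "f \<sqsubset> h" "g \<sqsubset> h"
proof -
  obtain x where x: "chain x" "I = ideal_of x" using assms(1) by (rule completion_cases)
  obtain m n where mn: "f \<sqsubset> x m" "g \<sqsubset> x n" using assms x by (auto simp: ideal_of_def)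
  \<comment> \<open>\<open>chain_less\<close> needs a strict inequality of indices, so the common
    index is one past the larger of \<open>m\<close> and \<open>n\<close>.\<close>
  have "f \<sqsubset> x (Suc (max m n))" "g \<sqsubset> x (Suc (max m n))"
    using mn chain_less[OF x(1), of m "Suc (max m n)"] chain_less[OF x(1), of n "Suc (max m n)"]
      prec_trans less_Suc_eq_le by (blast intro: max.cobounded1 max.cobounded2)+
  then show ?thesis using that chain_in_ideal x by blast
qed

lemma ideal_round: "I \<in> carrier completion \<Longrightarrow> f \<in> I \<Longrightarrow> \<exists>g\<in>I. f \<sqsubset> g"
  using ideal_directed by metis

lemma ideal_subset: "I \<in> carrier completion \<Longrightarrow> I \<subseteq> B"
  by (auto simp: completion_def ideal_of_def dest: prec_carrier)

lemma zr_in_ideal: "I \<in> carrier completion \<Longrightarrow> zr \<in> I"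
  by (auto simp: completion_def ideal_of_def chain_def intro: zr_prec dest: prec_carrier)

text \<open>The cofinal family \<open>c\<close> may come in any order: dependent choice produces a
  chain whose member \<open>d (Suc n)\<close> dominates both \<open>d n\<close> and
  \<open>c n\<close>, and that chain generates \<open>D\<close>.\<close>

lemma ideal_intro:
  assumes down: "\<And>f g. g \<in> D \<Longrightarrow> f \<sqsubset> g \<Longrightarrow> f \<in> D"
    and dir: "\<And>f g. f \<in> D \<Longrightarrow> g \<in> D \<Longrightarrow> \<exists>h\<in>D. f \<sqsubset> h \<and> g \<sqsubset> h"
    and c: "\<And>n::nat. c n \<in> D" "\<And>f. f \<in> D \<Longrightarrow> \<exists>n. f \<sqsubset> c n"
  shows "D \<in> carrier completion"
proof -
  have "\<exists>d. \<forall>n. d n \<in> D \<and> (d n \<sqsubset> d (Suc n) \<and> c n \<sqsubset> d (Suc n))"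
    using dependent_nat_choice[of "\<lambda>n d. d \<in> D" "\<lambda>n d e. d \<sqsubset> e \<and> c n \<sqsubset> e"] dir c by metis
  then obtain d where d: "\<And>n. d n \<in> D" "\<And>n. d n \<sqsubset> d (Suc n)" "\<And>n. c n \<sqsubset> d (Suc n)"
    by blast
  have "chain d" using d by (simp add: chain_def)
  moreover have "D = ideal_of d"
  proof (intro Set.set_eqI iffI)
    fix f
    show "f \<in> ideal_of d" if "f \<in> D"
      using c(2)[OF that] d(3) prec_trans unfolding ideal_of_def by blast
    show "f \<in> D" if "f \<in> ideal_of d"
      using that down d(1) unfolding ideal_of_def by blast
  qed
  ultimately show ?thesis using ideal_of_in by blast
qed

lemma completion_add:
  "I \<oplus>\<^bsub>completion\<^esub> J = {f. \<exists>g\<in>I. \<exists>h\<in>J. f \<sqsubset> g \<boxplus> h}"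
  and completion_zero: "\<zero>\<^bsub>completion\<^esub> = {f. f \<sqsubset> zr}"
  and completion_leq: "I \<preceq>\<^bsub>completion\<^esub> J \<longleftrightarrow> I \<subseteq> J"
  by (simp_all add: completion_def)

lemma ideal_of_add:
  assumes "chain x" "chain y"
  shows "chain (\<lambda>n. x n \<boxplus> y n)"
    "ideal_of x \<oplus>\<^bsub>completion\<^esub> ideal_of y = ideal_of (\<lambda>n. x n \<boxplus> y n)"
proof -
  show ch: "chain (\<lambda>n. x n \<boxplus> y n)" using assms by (simp add: chain_def prec_plus)
  show "ideal_of x \<oplus>\<^bsub>completion\<^esub> ideal_of y = ideal_of (\<lambda>n. x n \<boxplus> y n)" (is "?L = ?R")
  proof
    show "?L \<subseteq> ?R"
    proof
      fix f assume "f \<in> ?L"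
      then obtain g h m n where *: "f \<sqsubset> g \<boxplus> h" "g \<sqsubset> x m" "h \<sqsubset> y n"
        by (auto simp: completion_add ideal_of_def)
      have "g \<sqsubset> x (Suc (max m n))" "h \<sqsubset> y (Suc (max m n))"
        using * chain_less[OF assms(1), of m "Suc (max m n)"]
          chain_less[OF assms(2), of n "Suc (max m n)"] prec_trans less_Suc_eq_le
        by (blast intro: max.cobounded1 max.cobounded2)+
      then have "f \<sqsubset> x (Suc (max m n)) \<boxplus> y (Suc (max m n))"
        using prec_trans[OF *(1) prec_plus] by blast
      then show "f \<in> ?R" unfolding ideal_of_def by blast
    qed
    show "?R \<subseteq> ?L"
      using chain_in_ideal assms by (auto simp: completion_add ideal_of_def[of "\<lambda>n. x n \<boxplus> y n"])
  qed
qed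

lemma Union_ideal:
  assumes "\<And>k::nat. I k \<in> carrier completion" "\<And>k. I k \<subseteq> I (Suc k)"
  shows "(\<Union>k. I k) \<in> carrier completion"
proof -
  have "\<forall>k. \<exists>x. chain x \<and> I k = ideal_of x" using assms(1) completion_cases by metis
  then obtain x where x: "\<And>k. chain (x k)" "\<And>k. I k = ideal_of (x k)" by metis
  have mono: "I k \<subseteq> I l" if "k \<le> l" for k l using that assms(2) lift_Suc_mono_le by metis
  \<comment> \<open>A diagonal enumeration of all members of all the generating chains, cofinal in
    the union but not increasing in general.\<close>
  define c where "c n = (case prod_decode n of (k, m) \<Rightarrow> x k m)" for n
  show ?thesis
  proof (rule ideal_intro[where c = c])
    show "c n \<in> (\<Union>k. I k)" for n
      using x(2) chain_in_ideal[OF x(1)] unfolding c_def by (simp split: prod.split) blast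
    show "\<exists>n. f \<sqsubset> c n" if f: "f \<in> (\<Union>k. I k)" for f
    proof -
      obtain k m where "f \<sqsubset> x k m" using f x by (auto simp: ideal_of_def)
      then show ?thesis by (intro exI[of _ "prod_encode (k, m)"]) (simp add: c_def)
    qed
    show "f \<in> (\<Union>k. I k)" if "g \<in> (\<Union>k. I k)" "f \<sqsubset> g" for f g
      using that ideal_down assms(1) by blast
    show "\<exists>h\<in>(\<Union>k. I k). f \<sqsubset> h \<and> g \<sqsubset> h" if fg: "f \<in> (\<Union>k. I k)" "g \<in> (\<Union>k. I k)" for f g
    proof -
      obtain k l where "f \<in> I k" "g \<in> I l" using fg by blast
      then have "f \<in> I (max k l)" "g \<in> I (max k l)" using mono[of k "max k l"] mono[of l "max k l"] by auto
      then obtain h where "h \<in> I (max k l)" "f \<sqsubset> h" "g \<sqsubset> h"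
        by (rule ideal_directed[OF assms(1)])
      then show ?thesis by blast
    qed
  qed
qed

lemma comm_monoid_completion: "comm_monoid completion"
proof (rule comm_monoidI)
  show add: "I \<oplus>\<^bsub>completion\<^esub> J \<in> carrier completion"
    if IJ: "I \<in> carrier completion" "J \<in> carrier completion" for I J
  proof -
    obtain x y where "chain x" "I = ideal_of x" "chain y" "J = ideal_of y"
      using completion_cases[OF IJ(1)] completion_cases[OF IJ(2)] by metis
    then show ?thesis using ideal_of_add ideal_of_in by simp
  qed
  show "\<zero>\<^bsub>completion\<^esub> \<in> carrier completion"
  proof -
    have "chain (\<lambda>n. zr)" "\<zero>\<^bsub>completion\<^esub> = ideal_of (\<lambda>n. zr)"
      by (auto simp: chain_def completion_zero ideal_of_def zr_prec zr_carrier)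
    then show ?thesis using ideal_of_in by metis
  qed
  show "\<zero>\<^bsub>completion\<^esub> \<oplus>\<^bsub>completion\<^esub> I = I" if I: "I \<in> carrier completion" for I
  proof -
    obtain x where x: "chain x" "I = ideal_of x" using I by (rule completion_cases)
    have z: "chain (\<lambda>n. zr)" "\<zero>\<^bsub>completion\<^esub> = ideal_of (\<lambda>n. zr)"
      by (auto simp: chain_def completion_zero ideal_of_def zr_prec zr_carrier)
    have "zr \<boxplus> x n = x n" for n using zr_plus prec_carrier x(1) unfolding chain_def by blast
    then show ?thesis using ideal_of_add(2)[OF z(1) x(1)] z x by simp
  qed
  fix I J assume I: "I \<in> carrier completion" and J: "J \<in> carrier completion"
  \<comment> \<open>For commutativity the elements below the sums are compared directly, which is
    what \<open>plus_commute\<close> provides.\<close>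
  show "I \<oplus>\<^bsub>completion\<^esub> J = J \<oplus>\<^bsub>completion\<^esub> I"
    using plus_commute ideal_subset[OF I] ideal_subset[OF J] unfolding completion_add by blast
  fix K assume K: "K \<in> carrier completion"
  obtain x y z where xyz: "chain x" "I = ideal_of x" "chain y" "J = ideal_of y"
      "chain z" "K = ideal_of z"
    using I J K completion_cases by metis
  have "x n \<boxplus> y n \<boxplus> z n = x n \<boxplus> (y n \<boxplus> z n)" for n
    using plus_assoc prec_carrier xyz unfolding chain_def by blast
  then show "I \<oplus>\<^bsub>completion\<^esub> J \<oplus>\<^bsub>completion\<^esub> K = I \<oplus>\<^bsub>completion\<^esub> (J \<oplus>\<^bsub>completion\<^esub> K)"
    using xyz ideal_of_add by simp
qed

lemma positively_ordered_completion: "positively_ordered_semigroup completion"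
proof -
  interpret C: comm_monoid completion by (rule comm_monoid_completion)
  show ?thesis
  proof
    show "\<zero>\<^bsub>completion\<^esub> \<preceq>\<^bsub>completion\<^esub> I" if "I \<in> carrier completion" for I
      using that zr_in_ideal ideal_down by (auto simp: completion_leq completion_zero)
  qed (auto simp: completion_leq completion_add)
qed

lemma is_supremum_Union:
  assumes "increasing_seq completion I"
  shows "is_supremum completion (range I) (\<Union>k. I k)"
  using Union_ideal[of I] assms by (auto simp: is_supremum_def completion_leq increasing_seq_def)

lemma is_supremum_iff:
  assumes "increasing_seq completion I"
  shows "is_supremum completion (range I) J \<longleftrightarrow> J = (\<Union>k. I k)"
  using is_supremum_Union[OF assms]
    positively_ordered_semigroup.is_supremum_unique[OF positively_ordered_completion] by blast

text \<open>Interpolation is repeated towards \<open>h\<close>, which stays a strict upper bound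
  throughout; the starting point \<open>g\<close> keeps the chain above \<open>f\<close>.\<close>

lemma chain_below:
  assumes "f \<sqsubset> h"
  obtains x where "chain x" "f \<sqsubset> x 0" "\<And>n. x n \<sqsubset> h"
proof -
  obtain g where g: "f \<sqsubset> g" "g \<sqsubset> h" using assms prec_interpolation by blast
  have "\<exists>x. \<forall>n. (f \<sqsubset> x n \<and> x n \<sqsubset> h) \<and> x n \<sqsubset> x (Suc n)"
    by (rule dependent_nat_choice) (use g in blast, use prec_interpolation prec_trans in blast)
  then show ?thesis using that by (auto simp: chain_def)
qed

text \<open>A compactness argument: the single element \<open>g\<close> is caught by some member of
  any increasing sequence whose union covers \<open>J\<close>, and that member then contains
  everything below \<open>g\<close>.\<close>

lemma way_below_completionI:
  assumes "J \<in> carrier completion" "g \<in> J" "\<And>f. f \<in> I \<Longrightarrow> f \<sqsubset> g"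
  shows "I \<lless>\<^bsub>completion\<^esub> J"
  unfolding way_below_def
proof (intro allI impI)
  fix c s assume c: "increasing_seq completion c" "is_supremum completion (range c) s"
    "J \<preceq>\<^bsub>completion\<^esub> s"
  then have "g \<in> (\<Union>k. c k)" using is_supremum_iff[OF c(1)] assms(2) by (auto simp: completion_leq)
  then obtain k where "g \<in> c k" by blast
  then show "\<exists>k. I \<preceq>\<^bsub>completion\<^esub> c k"
    using c(1) assms(3) ideal_down unfolding completion_leq increasing_seq_def by blast
qed

text \<open>This is (O2) for the completion. The elements below \<open>x n\<close> are not known to
  form an ideal, so \<open>K n\<close> is generated by a chain squeezed between \<open>x n\<close>
  and \<open>x (Suc n)\<close>.\<close>

lemma completion_approx:
  assumes "chain x"
  obtains K where "\<And>n. K n \<in> carrier completion" "\<And>n. K n \<lless>\<^bsub>completion\<^esub> K (Suc n)"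
    "is_supremum completion (range K) (ideal_of x)" "\<And>n f. f \<in> K n \<Longrightarrow> f \<sqsubset> x (Suc n)"
proof -
  have "\<forall>n. \<exists>y. chain y \<and> x n \<sqsubset> y 0 \<and> (\<forall>k. y k \<sqsubset> x (Suc n))"
    using chain_below assms unfolding chain_def by metis
  then obtain y where y: "\<And>n. chain (y n)" "\<And>n. x n \<sqsubset> y n 0" "\<And>n k. y n k \<sqsubset> x (Suc n)"
    by metis
  define K where "K n = ideal_of (y n)" for n
  have K: "K n \<in> carrier completion" for n using y K_def ideal_of_in by simp
  have up: "f \<sqsubset> x (Suc n)" if "f \<in> K n" for f n
    using that y(3) prec_trans by (auto simp: K_def ideal_of_def)
  have wb: "K n \<lless>\<^bsub>completion\<^esub> K (Suc n)" for n
    by (rule way_below_completionI[OF K, of "y (Suc n) 0"])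
      (use K_def y chain_in_ideal in blast, use up y(2) prec_trans in blast)
  have inc: "increasing_seq completion K"
    unfolding increasing_seq_def
    using K wb positively_ordered_semigroup.way_below_leq[OF positively_ordered_completion] by blast
  have "ideal_of x = (\<Union>n. K n)"
  proof
    show "(\<Union>n. K n) \<subseteq> ideal_of x" using up by (auto simp: ideal_of_def)
    show "ideal_of x \<subseteq> (\<Union>n. K n)"
      using y(2) prec_trans by (fastforce simp: K_def ideal_of_def)
  qed
  then have "is_supremum completion (range K) (ideal_of x)" using is_supremum_iff[OF inc] by simp
  from that[of K, OF K wb this up] show ?thesis .
qed

text \<open>In the forward direction \<open>I\<close> is absorbed by one \<open>K k\<close> of the
  approximation of \<open>J\<close>, and all of \<open>K k\<close> lies below the single element
  \<open>x (Suc k)\<close>.\<close>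

lemma way_below_completion_iff:
  assumes "I \<in> carrier completion" "J \<in> carrier completion"
  shows "I \<lless>\<^bsub>completion\<^esub> J \<longleftrightarrow> (\<exists>g\<in>J. \<forall>f\<in>I. f \<sqsubset> g)"
proof
  assume wb: "I \<lless>\<^bsub>completion\<^esub> J"
  interpret positively_ordered_semigroup completion by (rule positively_ordered_completion)
  obtain x where x: "chain x" "J = ideal_of x" using assms(2) by (rule completion_cases)
  obtain K where K: "\<And>n. K n \<in> carrier completion" "\<And>n. K n \<lless>\<^bsub>completion\<^esub> K (Suc n)"
    "is_supremum completion (range K) (ideal_of x)" "\<And>n f. f \<in> K n \<Longrightarrow> f \<sqsubset> x (Suc n)"
    using completion_approx[OF x(1)] by metis
  have "increasing_seq completion K" using K way_below_leq unfolding increasing_seq_def by blast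
  then obtain k where "I \<subseteq> K k"
    using way_below_supremum[OF wb _ K(3)] x leq_refl[OF assms(2)] completion_leq by blast
  then show "\<exists>g\<in>J. \<forall>f\<in>I. f \<sqsubset> g" using K(4) x chain_in_ideal by blast
qed (use way_below_completionI assms in blast)

theorem cu_semigroup_completion: "cu_semigroup completion"
proof -
  interpret positively_ordered_semigroup completion by (rule positively_ordered_completion)
  show ?thesis
  proof
    show "\<exists>s. is_supremum completion (range c) s" if "increasing_seq completion c" for c
      using is_supremum_Union that by blast
    show "\<exists>c. (\<forall>n. c n \<in> carrier completion) \<and> (\<forall>n. c n \<lless>\<^bsub>completion\<^esub> c (Suc n)) \<and>
        is_supremum completion (range c) a" if "a \<in> carrier completion" for a
      using completion_cases[OF that] completion_approx by metis
    show "a' \<oplus>\<^bsub>completion\<^esub> b' \<lless>\<^bsub>completion\<^esub> a \<oplus>\<^bsub>completion\<^esub> b"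
      if ab: "a \<in> carrier completion" "a' \<in> carrier completion" "b \<in> carrier completion"
        "b' \<in> carrier completion" "a' \<lless>\<^bsub>completion\<^esub> a" "b' \<lless>\<^bsub>completion\<^esub> b" for a a' b b'
    proof -
      obtain g h where gh: "g \<in> a" "\<And>f. f \<in> a' \<Longrightarrow> f \<sqsubset> g" "h \<in> b" "\<And>f. f \<in> b' \<Longrightarrow> f \<sqsubset> h"
        using way_below_completion_iff ab by metis
      \<comment> \<open>The sum ideal consists of elements strictly below sums, so each witness
        moves up once to make \<open>g \<boxplus> h\<close> a member.\<close>
      obtain g' h' where "g' \<in> a" "g \<sqsubset> g'" "h' \<in> b" "h \<sqsubset> h'"
        using ideal_round ab gh by metis
      then have "g \<boxplus> h \<in> a \<oplus>\<^bsub>completion\<^esub> b" using prec_plus unfolding completion_add by blast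
      moreover have "f \<sqsubset> g \<boxplus> h" if "f \<in> a' \<oplus>\<^bsub>completion\<^esub> b'" for f
        using that prec_trans[OF _ prec_plus] gh unfolding completion_add by blast
      moreover have "a \<oplus>\<^bsub>completion\<^esub> b \<in> carrier completion" using ab by simp
      ultimately show ?thesis using way_below_completionI by blast
    qed
    show "supremum completion (range (\<lambda>n. c n \<oplus>\<^bsub>completion\<^esub> d n)) =
        supremum completion (range c) \<oplus>\<^bsub>completion\<^esub> supremum completion (range d)"
      if cd: "increasing_seq completion c" "increasing_seq completion d" for c d
    proof -
      have "(\<Union>n. c n \<oplus>\<^bsub>completion\<^esub> d n) = (\<Union>n. c n) \<oplus>\<^bsub>completion\<^esub> (\<Union>n. d n)" (is "?L = ?R")
      proof
        show "?L \<subseteq> ?R" by (auto simp: completion_add)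
        show "?R \<subseteq> ?L"
        proof
          fix f assume "f \<in> ?R"
          then obtain m n g h where *: "g \<in> c m" "h \<in> d n" "f \<sqsubset> g \<boxplus> h"
            by (auto simp: completion_add)
          then have "g \<in> c (max m n)" "h \<in> d (max m n)"
            using increasing_seq_le[OF cd(1), of m "max m n"]
              increasing_seq_le[OF cd(2), of n "max m n"] by (auto simp: completion_leq)
          then show "f \<in> ?L" using * by (auto simp: completion_add)
        qed
      qed
      then show ?thesis
        unfolding supremum_eq[OF is_supremum_Union[OF cd(1)]] supremum_eq[OF is_supremum_Union[OF cd(2)]]
          supremum_eq[OF is_supremum_Union[OF increasing_seq_add[OF cd]]] .
    qed
  qed
qed

text \<open>The target type is independent of the basis; this is what later frees the universal
  property from a fixed carrier type. For monotone \<open>\<phi>\<close> the supremum exists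
  although an ideal may be uncountable, since a generating chain has cofinal image.\<close>

definition ext :: "('p, 'm) posemigroup_scheme \<Rightarrow> ('b \<Rightarrow> 'p) \<Rightarrow> 'b set \<Rightarrow> 'p"
  where "ext P \<phi> = (\<lambda>I\<in>carrier completion. supremum P (\<phi> ` I))"

context
  fixes P :: "('p, 'm) posemigroup_scheme" and \<phi> :: "'b \<Rightarrow> 'p"
  assumes P: "cu_semigroup P"
    and closed: "\<And>f. f \<in> B \<Longrightarrow> \<phi> f \<in> carrier P"
    and mono: "\<And>f g. f \<sqsubset> g \<Longrightarrow> \<phi> f \<preceq>\<^bsub>P\<^esub> \<phi> g"
    and add: "\<And>f g. f \<in> B \<Longrightarrow> g \<in> B \<Longrightarrow> \<phi> (f \<boxplus> g) = \<phi> f \<oplus>\<^bsub>P\<^esub> \<phi> g"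
    and zero: "\<phi> zr = \<zero>\<^bsub>P\<^esub>"
begin

interpretation P: cu_semigroup P by (rule P)

lemma ext_chain:
  assumes "chain x"
  shows "increasing_seq P (\<lambda>n. \<phi> (x n))"
    "is_supremum P (\<phi> ` ideal_of x) s \<longleftrightarrow> is_supremum P (range (\<lambda>n. \<phi> (x n))) s"
proof -
  have x: "x n \<in> B" for n using assms prec_carrier unfolding chain_def by blast
  show inc: "increasing_seq P (\<lambda>n. \<phi> (x n))"
    using assms x closed mono by (auto simp: increasing_seq_def chain_def)
  have sub: "\<phi> ` ideal_of x \<subseteq> carrier P" "range (\<lambda>n. \<phi> (x n)) \<subseteq> carrier P"
    using ideal_subset ideal_of_in assms closed x by blast+
  have c1: "\<exists>b\<in>range (\<lambda>n. \<phi> (x n)). a \<preceq>\<^bsub>P\<^esub> b" if "a \<in> \<phi> ` ideal_of x" for a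
    using that mono by (auto simp: ideal_of_def)
  have c2: "\<exists>b\<in>\<phi> ` ideal_of x. a \<preceq>\<^bsub>P\<^esub> b" if "a \<in> range (\<lambda>n. \<phi> (x n))" for a
    using that chain_in_ideal[OF assms] P.leq_refl closed x by blast
  show "is_supremum P (\<phi> ` ideal_of x) s \<longleftrightarrow> is_supremum P (range (\<lambda>n. \<phi> (x n))) s"
    using P.is_supremum_cofinal sub c1 c2 by metis
qed

lemma is_supremum_ext:
  assumes "I \<in> carrier completion" shows "is_supremum P (\<phi> ` I) (ext P \<phi> I)"
proof -
  obtain x where x: "chain x" "I = ideal_of x" using assms by (rule completion_cases)
  have "is_supremum P (\<phi> ` I) (supremum P (range (\<lambda>n. \<phi> (x n))))"
    using ext_chain[OF x(1)] P.is_supremum_supremum x(2) by blast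
  then show ?thesis using P.supremum_eq assms by (auto simp: ext_def)
qed

lemma ext_gen_cu_mor: "ext P \<phi> \<in> gen_cu_mor completion P"
proof (rule gen_cu_morI[OF cu_semigroup_completion P])
  show "ext P \<phi> \<in> carrier completion \<rightarrow>\<^sub>E carrier P"
    using is_supremum_ext P.is_supremum_carrier by (auto simp: ext_def)
  show "ext P \<phi> (I \<oplus>\<^bsub>completion\<^esub> J) = ext P \<phi> I \<oplus>\<^bsub>P\<^esub> ext P \<phi> J"
    if IJ: "I \<in> carrier completion" "J \<in> carrier completion" for I J
  proof -
    obtain x y where xy: "chain x" "I = ideal_of x" "chain y" "J = ideal_of y"
      using IJ completion_cases by metis
    have "is_supremum P (range (\<lambda>n. \<phi> (x n))) (ext P \<phi> I)"
      "is_supremum P (range (\<lambda>n. \<phi> (y n))) (ext P \<phi> J)"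
      using ext_chain is_supremum_ext IJ xy by blast+
    then have "is_supremum P (range (\<lambda>n. \<phi> (x n) \<oplus>\<^bsub>P\<^esub> \<phi> (y n))) (ext P \<phi> I \<oplus>\<^bsub>P\<^esub> ext P \<phi> J)"
      using P.is_supremum_add ext_chain xy by blast
    moreover have "\<phi> (x n) \<oplus>\<^bsub>P\<^esub> \<phi> (y n) = \<phi> (x n \<boxplus> y n)" for n
      using add prec_carrier xy unfolding chain_def by metis
    ultimately have "is_supremum P (\<phi> ` (I \<oplus>\<^bsub>completion\<^esub> J)) (ext P \<phi> I \<oplus>\<^bsub>P\<^esub> ext P \<phi> J)"
      using ext_chain(2) ideal_of_add xy by simp
    then show ?thesis
      using is_supremum_ext P.is_supremum_unique comm_monoid_completion IJ
        monoid.m_closed[OF comm_monoid.axioms(1)] by metis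
  qed
  show "ext P \<phi> \<zero>\<^bsub>completion\<^esub> = \<zero>\<^bsub>P\<^esub>"
  proof -
    have z: "chain (\<lambda>n. zr)" "\<zero>\<^bsub>completion\<^esub> = ideal_of (\<lambda>n. zr)"
      by (auto simp: chain_def completion_zero ideal_of_def zr_prec zr_carrier)
    have "is_supremum P (\<phi> ` \<zero>\<^bsub>completion\<^esub>) \<zero>\<^bsub>P\<^esub>"
      using ext_chain(2)[OF z(1)] P.is_supremum_const[of "\<zero>\<^bsub>P\<^esub>"] zero z(2) by simp
    then show ?thesis
      using is_supremum_ext P.is_supremum_unique ideal_of_in z by metis
  qed
  show "ext P \<phi> I \<preceq>\<^bsub>P\<^esub> ext P \<phi> J"
    if "I \<in> carrier completion" "J \<in> carrier completion" "I \<preceq>\<^bsub>completion\<^esub> J" for I J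
  proof -
    have "ext P \<phi> J \<in> carrier P" "\<And>f. f \<in> I \<Longrightarrow> \<phi> f \<preceq>\<^bsub>P\<^esub> ext P \<phi> J"
      using is_supremum_ext[OF that(2)] that(3) by (auto simp: is_supremum_def completion_leq)
    then show ?thesis using is_supremum_ext[OF that(1)] by (simp add: is_supremum_def)
  qed
  show "ext P \<phi> s \<preceq>\<^bsub>P\<^esub> u"
    if c: "increasing_seq completion c" "is_supremum completion (range c) s" "u \<in> carrier P"
      "\<And>n. ext P \<phi> (c n) \<preceq>\<^bsub>P\<^esub> u" for c s u
  proof -
    have s: "s = (\<Union>n. c n)" "s \<in> carrier completion"
      using c is_supremum_iff by (auto simp: is_supremum_def)
    have "\<phi> f \<preceq>\<^bsub>P\<^esub> u" if "f \<in> s" for f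
    proof -
      obtain n where n: "f \<in> c n" using \<open>f \<in> s\<close> s by blast
      have cn: "c n \<in> carrier completion" using c(1) by (simp add: increasing_seq_def)
      have "\<phi> f \<preceq>\<^bsub>P\<^esub> ext P \<phi> (c n)" "ext P \<phi> (c n) \<in> carrier P" "\<phi> f \<in> carrier P"
        using is_supremum_ext[OF cn] n closed ideal_subset[OF cn] by (auto simp: is_supremum_def)
      then show ?thesis using P.leq_trans c(3,4) by blast
    qed
    then show ?thesis using is_supremum_ext[OF s(2)] c(3) by (auto simp: is_supremum_def)
  qed
qed

end

end

section \<open>Generalized bimorphisms\<close>

text \<open>The \<open>\<lless>\<close>-condition is left out on purpose: fixing one variable of a
  trimorphism leaves a bimorphism of this weaker kind. The restrictions make the partial maps
  extensional, as \<open>gen_cu_mor\<close> demands.\<close>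

definition gen_cu_bimorphism ::
    "('a, 'm) posemigroup_scheme \<Rightarrow> ('b, 'n) posemigroup_scheme \<Rightarrow> ('c, 'k) posemigroup_scheme
      \<Rightarrow> ('a \<Rightarrow> 'b \<Rightarrow> 'c) \<Rightarrow> bool"
  where "gen_cu_bimorphism S T P \<phi> \<longleftrightarrow>
    (\<forall>b\<in>carrier T. (\<lambda>a\<in>carrier S. \<phi> a b) \<in> gen_cu_mor S P) \<and>
    (\<forall>a\<in>carrier S. (\<lambda>b\<in>carrier T. \<phi> a b) \<in> gen_cu_mor T P)"

lemma restrict_gen_cu_morD:
  assumes "cu_semigroup S" "(\<lambda>a\<in>carrier S. f a) \<in> gen_cu_mor S T"
  shows "a \<in> carrier S \<Longrightarrow> f a \<in> carrier T"
    "a \<in> carrier S \<Longrightarrow> b \<in> carrier S \<Longrightarrow> f (a \<oplus>\<^bsub>S\<^esub> b) = f a \<oplus>\<^bsub>T\<^esub> f b"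
    "f \<zero>\<^bsub>S\<^esub> = \<zero>\<^bsub>T\<^esub>"
    "a \<in> carrier S \<Longrightarrow> b \<in> carrier S \<Longrightarrow> a \<preceq>\<^bsub>S\<^esub> b \<Longrightarrow> f a \<preceq>\<^bsub>T\<^esub> f b"
proof -
  interpret S: cu_semigroup S by fact
  show "a \<in> carrier S \<Longrightarrow> f a \<in> carrier T"
    using gen_cu_mor_closed[OF assms(2)] by auto
  show "a \<in> carrier S \<Longrightarrow> b \<in> carrier S \<Longrightarrow> f (a \<oplus>\<^bsub>S\<^esub> b) = f a \<oplus>\<^bsub>T\<^esub> f b"
    using gen_cu_mor_add[OF assms(2)] by auto
  show "f \<zero>\<^bsub>S\<^esub> = \<zero>\<^bsub>T\<^esub>"
    using gen_cu_mor_zero[OF assms(2)] by auto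
  show "a \<in> carrier S \<Longrightarrow> b \<in> carrier S \<Longrightarrow> a \<preceq>\<^bsub>S\<^esub> b \<Longrightarrow> f a \<preceq>\<^bsub>T\<^esub> f b"
    using gen_cu_mor_mono[OF assms(2)] by auto
qed

lemma restrict_gen_cu_mor_supremum:
  assumes "cu_semigroup S" "cu_semigroup T" "(\<lambda>a\<in>carrier S. f a) \<in> gen_cu_mor S T"
    "increasing_seq S c" "is_supremum S (range c) s"
  shows "is_supremum T (range (\<lambda>n. f (c n))) (f s)"
  using gen_cu_mor_supremum[OF assms] assms(4,5)
  by (simp add: is_supremum_def increasing_seq_def)

lemma gen_cu_bimorphism_compose:
  assumes "cu_semigroup S" "cu_semigroup T" "cu_semigroup P" "cu_semigroup Q"
    "gen_cu_bimorphism S T P \<phi>" "f \<in> gen_cu_mor P Q"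
  shows "gen_cu_bimorphism S T Q (\<lambda>a b. f (\<phi> a b))"
proof -
  have "(\<lambda>a\<in>carrier S. f (\<phi> a b)) = compose (carrier S) f (\<lambda>a\<in>carrier S. \<phi> a b)" for b
    by (auto simp: compose_def)
  moreover have "(\<lambda>b\<in>carrier T. f (\<phi> a b)) = compose (carrier T) f (\<lambda>b\<in>carrier T. \<phi> a b)" for a
    by (auto simp: compose_def)
  ultimately show ?thesis
    using assms gen_cu_mor_compose[OF assms(1,3,4)] gen_cu_mor_compose[OF assms(2,3,4)]
    unfolding gen_cu_bimorphism_def by auto
qed

lemma gen_cu_bimorphism_leq:
  assumes "cu_semigroup S" "cu_semigroup T" "cu_semigroup P" "gen_cu_bimorphism S T P \<phi>"
    "a \<in> carrier S" "a' \<in> carrier S" "b \<in> carrier T" "b' \<in> carrier T" "a \<preceq>\<^bsub>S\<^esub> a'" "b \<preceq>\<^bsub>T\<^esub> b'"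
  shows "\<phi> a b \<preceq>\<^bsub>P\<^esub> \<phi> a' b'"
proof -
  interpret P: cu_semigroup P by fact
  have l: "(\<lambda>a\<in>carrier S. \<phi> a b) \<in> gen_cu_mor S P" if "b \<in> carrier T" for b
    using assms that by (auto simp: gen_cu_bimorphism_def)
  have r: "(\<lambda>b\<in>carrier T. \<phi> a' b) \<in> gen_cu_mor T P"
    using assms by (auto simp: gen_cu_bimorphism_def)
  show ?thesis
  proof (rule P.leq_trans)
    show "\<phi> a b \<preceq>\<^bsub>P\<^esub> \<phi> a' b" using restrict_gen_cu_morD(4)[OF assms(1) l] assms by simp
    show "\<phi> a' b \<preceq>\<^bsub>P\<^esub> \<phi> a' b'" using restrict_gen_cu_morD(4)[OF assms(2) r] assms by simp
  qed (use restrict_gen_cu_morD(1)[OF assms(1) l] assms in simp_all)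
qed

text \<open>Continuity in each variable gives a double supremum over \<open>m\<close> and
  \<open>n\<close>; the diagonal entry at \<open>max m n\<close> dominates each term, so the
  diagonal has the same supremum.\<close>

lemma gen_cu_bimorphism_supremum:
  assumes "cu_semigroup S" "cu_semigroup T" "cu_semigroup P" "gen_cu_bimorphism S T P \<phi>"
    and a: "increasing_seq S a" "is_supremum S (range a) s"
    and b: "increasing_seq T b" "is_supremum T (range b) t"
  shows "increasing_seq P (\<lambda>k. \<phi> (a k) (b k))"
    "is_supremum P (range (\<lambda>k. \<phi> (a k) (b k))) (\<phi> s t)"
proof -
  interpret S: cu_semigroup S by fact
  interpret T: cu_semigroup T by fact
  interpret P: cu_semigroup P by fact
  have l: "(\<lambda>a\<in>carrier S. \<phi> a b) \<in> gen_cu_mor S P" if "b \<in> carrier T" for b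
    using assms that by (auto simp: gen_cu_bimorphism_def)
  have r: "(\<lambda>b\<in>carrier T. \<phi> a b) \<in> gen_cu_mor T P" if "a \<in> carrier S" for a
    using assms that by (auto simp: gen_cu_bimorphism_def)
  note [simp] = S.increasing_seq_carrier[OF a(1)] T.increasing_seq_carrier[OF b(1)]
    S.is_supremum_carrier[OF a(2)] T.is_supremum_carrier[OF b(2)]
  have [simp]: "\<phi> x y \<in> carrier P" if "x \<in> carrier S" "y \<in> carrier T" for x y
    using restrict_gen_cu_morD(1)[OF assms(1) l] that by blast
  note leq = gen_cu_bimorphism_leq[OF assms(1-4)]
  show "increasing_seq P (\<lambda>k. \<phi> (a k) (b k))"
    using leq a b by (simp add: increasing_seq_def)
  show "is_supremum P (range (\<lambda>k. \<phi> (a k) (b k))) (\<phi> s t)"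
    unfolding is_supremum_def
  proof (intro conjI ballI impI)
    show "p \<preceq>\<^bsub>P\<^esub> \<phi> s t" if "p \<in> range (\<lambda>k. \<phi> (a k) (b k))" for p
      using that leq S.is_supremum_upper[OF a(2)] T.is_supremum_upper[OF b(2)] by auto
    fix u assume u: "u \<in> carrier P" "\<forall>p\<in>range (\<lambda>k. \<phi> (a k) (b k)). p \<preceq>\<^bsub>P\<^esub> u"
    show "\<phi> s t \<preceq>\<^bsub>P\<^esub> u"
    proof (rule P.is_supremum_least[OF restrict_gen_cu_mor_supremum[OF assms(1,3) l a] u(1)])
      fix m
      show "\<phi> (a m) t \<preceq>\<^bsub>P\<^esub> u"
      proof (rule P.is_supremum_least[OF restrict_gen_cu_mor_supremum[OF assms(2,3) r b] u(1)])
        fix n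
        have le: "\<phi> (a m) (b n) \<preceq>\<^bsub>P\<^esub> \<phi> (a (max m n)) (b (max m n))"
          using leq S.increasing_seq_le[OF a(1)] T.increasing_seq_le[OF b(1)] by simp
        have "\<phi> (a (max m n)) (b (max m n)) \<preceq>\<^bsub>P\<^esub> u" using u by blast
        then show "\<phi> (a m) (b n) \<preceq>\<^bsub>P\<^esub> u" using P.leq_trans[OF _ _ u(1) le] by simp
      qed simp
    qed simp
  qed simp
qed

text \<open>Joint continuity, applied with a constant sequence in one variable, gives continuity in
  the other.\<close>

lemma cu_bimorphism_gen:
  assumes "cu_semigroup S" "cu_semigroup T" "cu_semigroup P" "cu_bimorphism S T P \<phi>"
  shows "gen_cu_bimorphism S T P \<phi>"
proof -
  interpret S: cu_semigroup S by fact
  interpret T: cu_semigroup T by fact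
  interpret P: cu_semigroup P by fact
  have sup: "is_supremum P (range (\<lambda>k. \<phi> (a k) (b k))) (\<phi> s t)"
    if a: "increasing_seq S a" "is_supremum S (range a) s"
      and b: "increasing_seq T b" "is_supremum T (range b) t" for a s b t
  proof -
    have "increasing_seq P (\<lambda>k. \<phi> (a k) (b k))"
      unfolding increasing_seq_def
    proof (intro conjI allI)
      fix n
      have [simp]: "a k \<in> carrier S" "b k \<in> carrier T" for k
        using a b by (auto simp: increasing_seq_def)
      show cl: "\<phi> (a n) (b n) \<in> carrier P" for n
        using assms(4) by (auto simp: cu_bimorphism_def)
      have "\<phi> (a n) (b n) \<preceq>\<^bsub>P\<^esub> \<phi> (a (Suc n)) (b n)"
        "\<phi> (a (Suc n)) (b n) \<preceq>\<^bsub>P\<^esub> \<phi> (a (Suc n)) (b (Suc n))"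
        "\<phi> (a (Suc n)) (b n) \<in> carrier P"
        using assms(4) a b unfolding cu_bimorphism_def increasing_seq_def by auto
      then show "\<phi> (a n) (b n) \<preceq>\<^bsub>P\<^esub> \<phi> (a (Suc n)) (b (Suc n))"
        using P.leq_trans cl by blast
    qed
    moreover have "supremum P (range (\<lambda>k. \<phi> (a k) (b k))) = \<phi> s t"
      using assms(4) a(1) b(1) S.supremum_eq[OF a(2)] T.supremum_eq[OF b(2)]
      by (simp add: cu_bimorphism_def)
    ultimately show ?thesis using P.is_supremum_supremum by metis
  qed
  show ?thesis
    unfolding gen_cu_bimorphism_def
  proof (intro conjI ballI)
    fix b assume b: "b \<in> carrier T"
    show "(\<lambda>a\<in>carrier S. \<phi> a b) \<in> gen_cu_mor S P"
    proof (rule gen_cu_morI[OF assms(1,3)])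
      fix c s u assume c: "increasing_seq S c" "is_supremum S (range c) s" "u \<in> carrier P"
        "\<And>n. (\<lambda>a\<in>carrier S. \<phi> a b) (c n) \<preceq>\<^bsub>P\<^esub> u"
      show "(\<lambda>a\<in>carrier S. \<phi> a b) s \<preceq>\<^bsub>P\<^esub> u"
        using P.is_supremum_least[OF sup[OF c(1,2) T.increasing_seq_const T.is_supremum_const] c(3)]
          c(4) b S.increasing_seq_carrier[OF c(1)] S.is_supremum_carrier[OF c(2)] by simp
    qed (use assms(4) b in \<open>auto simp: cu_bimorphism_def\<close>)
  next
    fix a assume a: "a \<in> carrier S"
    show "(\<lambda>b\<in>carrier T. \<phi> a b) \<in> gen_cu_mor T P"
    proof (rule gen_cu_morI[OF assms(2,3)])
      fix c s u assume c: "increasing_seq T c" "is_supremum T (range c) s" "u \<in> carrier P"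
        "\<And>n. (\<lambda>b\<in>carrier T. \<phi> a b) (c n) \<preceq>\<^bsub>P\<^esub> u"
      show "(\<lambda>b\<in>carrier T. \<phi> a b) s \<preceq>\<^bsub>P\<^esub> u"
        using P.is_supremum_least[OF sup[OF S.increasing_seq_const S.is_supremum_const c(1,2)] c(3)]
          c(4) a T.increasing_seq_carrier[OF c(1)] T.is_supremum_carrier[OF c(2)] by simp
    qed (use assms(4) a in \<open>auto simp: cu_bimorphism_def\<close>)
  qed
qed

lemma cu_bimorphismI:
  assumes "cu_semigroup S" "cu_semigroup T" "cu_semigroup P" "gen_cu_bimorphism S T P \<phi>"
    and wb: "\<And>a a' b b'. a \<in> carrier S \<Longrightarrow> a' \<in> carrier S \<Longrightarrow> b \<in> carrier T \<Longrightarrow> b' \<in> carrier T \<Longrightarrow>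
      a' \<lless>\<^bsub>S\<^esub> a \<Longrightarrow> b' \<lless>\<^bsub>T\<^esub> b \<Longrightarrow> \<phi> a' b' \<lless>\<^bsub>P\<^esub> \<phi> a b"
  shows "cu_bimorphism S T P \<phi>"
proof -
  interpret S: cu_semigroup S by fact
  interpret T: cu_semigroup T by fact
  interpret P: cu_semigroup P by fact
  have l: "(\<lambda>a\<in>carrier S. \<phi> a b) \<in> gen_cu_mor S P" if "b \<in> carrier T" for b
    using assms that by (auto simp: gen_cu_bimorphism_def)
  have r: "(\<lambda>b\<in>carrier T. \<phi> a b) \<in> gen_cu_mor T P" if "a \<in> carrier S" for a
    using assms that by (auto simp: gen_cu_bimorphism_def)
  have "supremum P (range (\<lambda>k. \<phi> (a k) (b k))) = \<phi> (supremum S (range a)) (supremum T (range b))"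
    if "increasing_seq S a" "increasing_seq T b" for a b
    using gen_cu_bimorphism_supremum(2)[OF assms(1-4)] S.is_supremum_supremum
      T.is_supremum_supremum that P.supremum_eq by metis
  then show ?thesis
    unfolding cu_bimorphism_def
    using restrict_gen_cu_morD[OF assms(1) l] restrict_gen_cu_morD[OF assms(2) r] wb by auto
qed

lemma cu_bimorphism_closed:
  "cu_bimorphism S T P \<phi> \<Longrightarrow> a \<in> carrier S \<Longrightarrow> b \<in> carrier T \<Longrightarrow> \<phi> a b \<in> carrier P"
  by (simp add: cu_bimorphism_def)

lemma cu_bimorphism_way_below:
  "cu_bimorphism S T P \<phi> \<Longrightarrow> a \<in> carrier S \<Longrightarrow> a' \<in> carrier S \<Longrightarrow> b \<in> carrier T \<Longrightarrow>
    b' \<in> carrier T \<Longrightarrow> a' \<lless>\<^bsub>S\<^esub> a \<Longrightarrow> b' \<lless>\<^bsub>T\<^esub> b \<Longrightarrow> \<phi> a' b' \<lless>\<^bsub>P\<^esub> \<phi> a b"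
  unfolding cu_bimorphism_def by blast

lemma cu_bimorphism_compose:
  assumes "cu_semigroup S" "cu_semigroup T" "cu_semigroup P" "cu_semigroup Q"
    "cu_bimorphism S T P \<phi>" "f \<in> cu_mor P Q"
  shows "cu_bimorphism S T Q (\<lambda>a b. f (\<phi> a b))"
proof (rule cu_bimorphismI[OF assms(1,2,4)])
  show "gen_cu_bimorphism S T Q (\<lambda>a b. f (\<phi> a b))"
    using gen_cu_bimorphism_compose assms cu_bimorphism_gen cu_mor_gen by metis
  show "f (\<phi> a' b') \<lless>\<^bsub>Q\<^esub> f (\<phi> a b)"
    if "a \<in> carrier S" "a' \<in> carrier S" "b \<in> carrier T" "b' \<in> carrier T"
      "a' \<lless>\<^bsub>S\<^esub> a" "b' \<lless>\<^bsub>T\<^esub> b" for a a' b b'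
    using that by (intro cu_mor_way_below[OF assms(6)] cu_bimorphism_closed[OF assms(5)]
        cu_bimorphism_way_below[OF assms(5)])
qed

lemma gen_cu_bimorphism_swap:
  "gen_cu_bimorphism S T P \<phi> \<Longrightarrow> gen_cu_bimorphism T S P (\<lambda>b a. \<phi> a b)"
  unfolding gen_cu_bimorphism_def by blast

lemma cu_bimorphism_swap:
  assumes "cu_semigroup S" "cu_semigroup T" "cu_semigroup P" "cu_bimorphism S T P \<phi>"
  shows "cu_bimorphism T S P (\<lambda>b a. \<phi> a b)"
  by (rule cu_bimorphismI[OF assms(2,1,3) gen_cu_bimorphism_swap[OF cu_bimorphism_gen[OF assms]]])
    (rule cu_bimorphism_way_below[OF assms(4)])

definition bisum :: "('p, 'm) posemigroup_scheme \<Rightarrow> ('a \<Rightarrow> 'b \<Rightarrow> 'p) \<Rightarrow> ('a \<times> 'b) list \<Rightarrow> 'p"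
  where "bisum P \<phi> xs = foldr (\<lambda>(a, b) p. \<phi> a b \<oplus>\<^bsub>P\<^esub> p) xs \<zero>\<^bsub>P\<^esub>"

lemma bisum_simps [simp]:
  "bisum P \<phi> [] = \<zero>\<^bsub>P\<^esub>" "bisum P \<phi> ((a, b) # xs) = \<phi> a b \<oplus>\<^bsub>P\<^esub> bisum P \<phi> xs"
  by (simp_all add: bisum_def)

lemma bisum_cong:
  "(\<And>a b. (a, b) \<in> set xs \<Longrightarrow> \<phi> a b = \<psi> a b) \<Longrightarrow> bisum P \<phi> xs = bisum P \<psi> xs"
  by (induction xs) auto

lemma bisum_closed:
  assumes "cu_semigroup P" "\<And>a b. a \<in> A \<Longrightarrow> b \<in> B \<Longrightarrow> \<phi> a b \<in> carrier P"
  shows "set xs \<subseteq> A \<times> B \<Longrightarrow> bisum P \<phi> xs \<in> carrier P"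
proof -
  interpret P: cu_semigroup P by fact
  show "set xs \<subseteq> A \<times> B \<Longrightarrow> bisum P \<phi> xs \<in> carrier P"
    using assms(2) by (induction xs) auto
qed

lemma bisum_append:
  assumes "cu_semigroup P" "\<And>a b. a \<in> A \<Longrightarrow> b \<in> B \<Longrightarrow> \<phi> a b \<in> carrier P" "set ys \<subseteq> A \<times> B"
  shows "set xs \<subseteq> A \<times> B \<Longrightarrow> bisum P \<phi> (xs @ ys) = bisum P \<phi> xs \<oplus>\<^bsub>P\<^esub> bisum P \<phi> ys"
proof -
  interpret P: cu_semigroup P by fact
  have cl: "set xs \<subseteq> A \<times> B \<Longrightarrow> bisum P \<phi> xs \<in> carrier P" for xs
    using bisum_closed[of P A B \<phi>, OF assms(1,2)] .
  show "set xs \<subseteq> A \<times> B \<Longrightarrow> bisum P \<phi> (xs @ ys) = bisum P \<phi> xs \<oplus>\<^bsub>P\<^esub> bisum P \<phi> ys"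
  proof (induction xs)
    case (Cons x xs)
    obtain a b where x: "x = (a, b)" by (cases x)
    show ?case using Cons assms(2)[of a b] cl[of xs] cl[OF assms(3)] x by (simp add: P.m_assoc)
  qed (use cl assms(3) in simp)
qed

lemma gen_cu_mor_bisum:
  assumes "cu_semigroup X" "f \<in> gen_cu_mor X P"
    "\<And>a b. a \<in> A \<Longrightarrow> b \<in> B \<Longrightarrow> \<phi> a b \<in> carrier X"
  shows "set xs \<subseteq> A \<times> B \<Longrightarrow> f (bisum X \<phi> xs) = bisum P (\<lambda>a b. f (\<phi> a b)) xs"
proof (induction xs)
  case Nil then show ?case using gen_cu_mor_zero[OF assms(2)] by simp
next
  case (Cons x xs)
  obtain a b where x: "x = (a, b)" by (cases x)
  have "bisum X \<phi> xs \<in> carrier X" using bisum_closed[of X A B \<phi>, OF assms(1,3)] Cons by simp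
  then show ?case using Cons gen_cu_mor_add[OF assms(2)] assms(3) x by simp
qed

lemma bisum_mono:
  assumes "cu_semigroup P" "\<And>a b. a \<in> A \<Longrightarrow> b \<in> B \<Longrightarrow> \<phi> a b \<in> carrier P"
    "\<And>a b. a \<in> A \<Longrightarrow> b \<in> B \<Longrightarrow> \<psi> a b \<in> carrier P"
    "\<And>a b. a \<in> A \<Longrightarrow> b \<in> B \<Longrightarrow> \<phi> a b \<preceq>\<^bsub>P\<^esub> \<psi> a b"
  shows "set xs \<subseteq> A \<times> B \<Longrightarrow> bisum P \<phi> xs \<preceq>\<^bsub>P\<^esub> bisum P \<psi> xs"
proof -
  interpret P: cu_semigroup P by fact
  have cl: "set xs \<subseteq> A \<times> B \<Longrightarrow> bisum P \<phi> xs \<in> carrier P \<and> bisum P \<psi> xs \<in> carrier P" for xs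
    using bisum_closed[of P A B \<phi>, OF assms(1,2)] bisum_closed[of P A B \<psi>, OF assms(1,3)] by simp
  show "set xs \<subseteq> A \<times> B \<Longrightarrow> bisum P \<phi> xs \<preceq>\<^bsub>P\<^esub> bisum P \<psi> xs"
  proof (induction xs)
    case (Cons x xs)
    obtain a b where x: "x = (a, b)" by (cases x)
    have "bisum P \<phi> xs \<preceq>\<^bsub>P\<^esub> bisum P \<psi> xs" "a \<in> A" "b \<in> B" "set xs \<subseteq> A \<times> B"
      using Cons x by auto
    then show ?case using assms(2-4)[of a b] cl[of xs] unfolding x bisum_simps
      by (intro P.add_mono) simp_all
  qed (simp add: P.leq_refl)
qed

section \<open>Tensor products\<close>

text \<open>One fixed choice of sequences for all elements at once, so that the terms of a formal
  sum can be approximated simultaneously with a common index.\<close>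

definition approximation :: "('a, 'm) posemigroup_scheme \<Rightarrow> ('a \<Rightarrow> nat \<Rightarrow> 'a) \<Rightarrow> bool"
  where "approximation S ca \<longleftrightarrow>
    (\<forall>a\<in>carrier S. way_below_seq S (ca a) \<and> is_supremum S (range (ca a)) a)"

lemma (in cu_semigroup) approximation_exists: "\<exists>ca. approximation S ca"
  unfolding approximation_def
proof (rule bchoice, rule ballI)
  fix a assume "a \<in> carrier S"
  then obtain c where "way_below_seq S c" "is_supremum S (range c) a" by (rule way_below_approx)
  then show "\<exists>c. way_below_seq S c \<and> is_supremum S (range c) a" by blast
qed

locale cu_pair = S: cu_semigroup S + T: cu_semigroup T
  for S :: "'a posemigroup" and T :: "'b posemigroup"
begin

section \<open>Formal sums of pairs and the relations on them\<close>

definition formal :: "('a \<times> 'b) list set"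
  where "formal = {xs. set xs \<subseteq> carrier S \<times> carrier T}"

text \<open>The preorder of the algebraic tensor product of positively ordered monoids, on
  representatives: the least preorder compatible with concatenation for which pairs are positive,
  biadditive, monotone and zero-preserving. No quotient is formed, since ideals identify equivalent
  lists by themselves. Suprema are absent from the rules; continuity comes in through
  \<open>formal_wb\<close>.\<close>

inductive formal_le :: "('a \<times> 'b) list \<Rightarrow> ('a \<times> 'b) list \<Rightarrow> bool" where
  refl: "xs \<in> formal \<Longrightarrow> formal_le xs xs"
| trans: "formal_le xs ys \<Longrightarrow> formal_le ys zs \<Longrightarrow> formal_le xs zs"
| append: "formal_le xs ys \<Longrightarrow> formal_le xs' ys' \<Longrightarrow> formal_le (xs @ xs') (ys @ ys')"
| commute: "xs \<in> formal \<Longrightarrow> ys \<in> formal \<Longrightarrow> formal_le (xs @ ys) (ys @ xs)"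
| zero: "a \<in> carrier S \<Longrightarrow> b \<in> carrier T \<Longrightarrow> formal_le [] [(a, b)]"
| mono: "a \<in> carrier S \<Longrightarrow> a' \<in> carrier S \<Longrightarrow> b \<in> carrier T \<Longrightarrow> b' \<in> carrier T \<Longrightarrow>
    a \<preceq>\<^bsub>S\<^esub> a' \<Longrightarrow> b \<preceq>\<^bsub>T\<^esub> b' \<Longrightarrow> formal_le [(a, b)] [(a', b')]"
| split_left: "a \<in> carrier S \<Longrightarrow> a' \<in> carrier S \<Longrightarrow> b \<in> carrier T \<Longrightarrow>
    formal_le [(a \<oplus>\<^bsub>S\<^esub> a', b)] [(a, b), (a', b)]"
| merge_left: "a \<in> carrier S \<Longrightarrow> a' \<in> carrier S \<Longrightarrow> b \<in> carrier T \<Longrightarrow>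
    formal_le [(a, b), (a', b)] [(a \<oplus>\<^bsub>S\<^esub> a', b)]"
| split_right: "a \<in> carrier S \<Longrightarrow> b \<in> carrier T \<Longrightarrow> b' \<in> carrier T \<Longrightarrow>
    formal_le [(a, b \<oplus>\<^bsub>T\<^esub> b')] [(a, b), (a, b')]"
| merge_right: "a \<in> carrier S \<Longrightarrow> b \<in> carrier T \<Longrightarrow> b' \<in> carrier T \<Longrightarrow>
    formal_le [(a, b), (a, b')] [(a, b \<oplus>\<^bsub>T\<^esub> b')]"
| zero_left: "b \<in> carrier T \<Longrightarrow> formal_le [(\<zero>\<^bsub>S\<^esub>, b)] []"
| zero_right: "a \<in> carrier S \<Longrightarrow> formal_le [(a, \<zero>\<^bsub>T\<^esub>)] []"

lemma formal_simps [simp]: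
  "[] \<in> formal" "(a, b) # xs \<in> formal \<longleftrightarrow> a \<in> carrier S \<and> b \<in> carrier T \<and> xs \<in> formal"
  "xs @ ys \<in> formal \<longleftrightarrow> xs \<in> formal \<and> ys \<in> formal"
  by (auto simp: formal_def)

lemma formal_le_formal: "formal_le xs ys \<Longrightarrow> xs \<in> formal \<and> ys \<in> formal"
  by (induction rule: formal_le.induct) auto

lemma formal_le_bisum:
  assumes "formal_le xs ys" "cu_semigroup P" "gen_cu_bimorphism S T P \<phi>"
  shows "bisum P \<phi> xs \<preceq>\<^bsub>P\<^esub> bisum P \<phi> ys"
proof -
  interpret P: cu_semigroup P by fact
  have l: "(\<lambda>a\<in>carrier S. \<phi> a b) \<in> gen_cu_mor S P" if "b \<in> carrier T" for b
    using assms that by (auto simp: gen_cu_bimorphism_def)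
  have r: "(\<lambda>b\<in>carrier T. \<phi> a b) \<in> gen_cu_mor T P" if "a \<in> carrier S" for a
    using assms that by (auto simp: gen_cu_bimorphism_def)
  note L = restrict_gen_cu_morD[OF S.cu_semigroup_axioms l]
  note R = restrict_gen_cu_morD[OF T.cu_semigroup_axioms r]
  note leq = gen_cu_bimorphism_leq[OF S.cu_semigroup_axioms T.cu_semigroup_axioms assms(2,3)]
  have cl: "xs \<in> formal \<Longrightarrow> bisum P \<phi> xs \<in> carrier P" for xs
    using bisum_closed[of P "carrier S" "carrier T" \<phi>, OF assms(2) L(1)] by (simp add: formal_def)
  have app: "xs \<in> formal \<Longrightarrow> ys \<in> formal \<Longrightarrow>
    bisum P \<phi> (xs @ ys) = bisum P \<phi> xs \<oplus>\<^bsub>P\<^esub> bisum P \<phi> ys" for xs ys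
    using bisum_append[of P "carrier S" "carrier T" \<phi>, OF assms(2) L(1)] by (simp add: formal_def)
  show ?thesis
    using assms(1)
  proof (induction rule: formal_le.induct)
    case (trans xs ys zs)
    then show ?case using P.leq_trans[of "bisum P \<phi> xs" "bisum P \<phi> ys"] cl formal_le_formal by blast
  next
    case (append xs ys xs' ys')
    then show ?case using P.add_mono cl app formal_le_formal by simp
  next
    case (commute xs ys)
    then show ?case using P.m_comm P.leq_refl cl app by simp
  qed (auto simp: P.leq_refl cl L R P.zero_leq leq)
qed

definition formal_wb :: "('a \<times> 'b) list \<Rightarrow> ('a \<times> 'b) list \<Rightarrow> bool"
  where "formal_wb f g \<longleftrightarrow> f \<in> formal \<and> g \<in> formal \<and>
    list_all2 (\<lambda>(a', b') (a, b). a' \<lless>\<^bsub>S\<^esub> a \<and> b' \<lless>\<^bsub>T\<^esub> b) f g"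

text \<open>Algebraic rearrangement comes first and termwise shrinking last: whatever lies below
  \<open>g\<close> is controlled by a list of the same shape as \<open>g\<close>, which is what
  makes splitting and approximating \<open>g\<close> possible.\<close>

definition formal_prec :: "('a \<times> 'b) list \<Rightarrow> ('a \<times> 'b) list \<Rightarrow> bool"
  where "formal_prec f g \<longleftrightarrow> (\<exists>g'. formal_le f g' \<and> formal_wb g' g)"

lemma formal_wb_Nil [simp]: "formal_wb [] g \<longleftrightarrow> g = []" "formal_wb f [] \<longleftrightarrow> f = []"
  by (auto simp: formal_wb_def)

lemma formal_wb_Cons:
  "formal_wb f ((a, b) # g) \<longleftrightarrow> (\<exists>a' b' f'. f = (a', b') # f' \<and> a \<in> carrier S \<and> a' \<in> carrier S \<and>
    b \<in> carrier T \<and> b' \<in> carrier T \<and> a' \<lless>\<^bsub>S\<^esub> a \<and> b' \<lless>\<^bsub>T\<^esub> b \<and> formal_wb f' g)"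
  by (auto simp: formal_wb_def list_all2_Cons2)

lemma formal_wb_append: "formal_wb f g \<Longrightarrow> formal_wb f' g' \<Longrightarrow> formal_wb (f @ f') (g @ g')"
  by (auto simp: formal_wb_def intro: list_all2_appendI)

lemma formal_wb_le: "formal_wb f g \<Longrightarrow> formal_le f g"
proof (induction g arbitrary: f)
  case Nil then show ?case by (auto intro: formal_le.refl)
next
  case (Cons x g)
  obtain a b where x: "x = (a, b)" by (cases x)
  obtain a' b' f' where f: "f = (a', b') # f'" "a \<in> carrier S" "a' \<in> carrier S" "b \<in> carrier T"
    "b' \<in> carrier T" "a' \<lless>\<^bsub>S\<^esub> a" "b' \<lless>\<^bsub>T\<^esub> b" "formal_wb f' g"
    using Cons.prems unfolding x formal_wb_Cons by blast
  have "formal_le [(a', b')] [(a, b)]"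
    using f S.way_below_leq T.way_below_leq by (intro formal_le.mono) auto
  then show ?case using formal_le.append[OF _ Cons.IH[OF f(8)]] f(1) x by fastforce
qed

lemma formal_wb_formal: "formal_wb f g \<Longrightarrow> f \<in> formal \<and> g \<in> formal"
  by (simp add: formal_wb_def)

lemma formal_wb_interpolation: "formal_wb f h \<Longrightarrow> \<exists>g. formal_wb f g \<and> formal_wb g h"
proof (induction h arbitrary: f)
  case Nil then show ?case by auto
next
  case (Cons x h)
  obtain a b where x: "x = (a, b)" by (cases x)
  obtain a' b' f' where f: "f = (a', b') # f'" "a \<in> carrier S" "a' \<in> carrier S" "b \<in> carrier T"
    "b' \<in> carrier T" "a' \<lless>\<^bsub>S\<^esub> a" "b' \<lless>\<^bsub>T\<^esub> b" "formal_wb f' h"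
    using Cons.prems unfolding x formal_wb_Cons by blast
  obtain a'' where a: "a'' \<in> carrier S" "a' \<lless>\<^bsub>S\<^esub> a''" "a'' \<lless>\<^bsub>S\<^esub> a"
    using S.way_below_interpolation f by blast
  obtain b'' where b: "b'' \<in> carrier T" "b' \<lless>\<^bsub>T\<^esub> b''" "b'' \<lless>\<^bsub>T\<^esub> b"
    using T.way_below_interpolation f by blast
  obtain g where "formal_wb f' g" "formal_wb g h" using Cons.IH f by blast
  then have "formal_wb f ((a'', b'') # g)" "formal_wb ((a'', b'') # g) (x # h)"
    using a b f x by (auto simp: formal_wb_Cons)
  then show ?case by blast
qed

lemma formal_wb_exists: "g \<in> formal \<Longrightarrow> \<exists>f. formal_wb f g"
proof (induction g)
  case Nil then show ?case by auto
next
  case (Cons x g)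
  then obtain a b f where "x = (a, b)" "formal_wb f g" "a \<in> carrier S" "b \<in> carrier T"
    by (cases x) auto
  then have "formal_wb ((\<zero>\<^bsub>S\<^esub>, \<zero>\<^bsub>T\<^esub>) # f) (x # g)"
    by (auto simp: formal_wb_Cons S.zero_way_below T.zero_way_below)
  then show ?case by blast
qed

lemma Nil_formal_le: "xs \<in> formal \<Longrightarrow> formal_le [] xs"
proof (induction xs)
  case Nil then show ?case by (simp add: formal_le.refl)
next
  case (Cons x xs)
  then show ?case using formal_le.append[OF formal_le.zero, of "fst x" "snd x" "[]" xs]
    by (cases x) auto
qed

lemma formal_prec_formal: "formal_prec f g \<Longrightarrow> f \<in> formal \<and> g \<in> formal"
  unfolding formal_prec_def using formal_le_formal formal_wb_formal by blast

lemma formal_prec_le: "formal_prec f g \<Longrightarrow> formal_le f g"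
  unfolding formal_prec_def using formal_wb_le formal_le.trans by blast

lemma formal_le_prec: "formal_le f g \<Longrightarrow> formal_prec g h \<Longrightarrow> formal_prec f h"
  unfolding formal_prec_def using formal_le.trans by blast

lemma formal_wb_prec: "formal_wb f g \<Longrightarrow> formal_prec f g"
  unfolding formal_prec_def using formal_wb_formal formal_le.refl by blast

sublocale R: round_monoid formal "(@)" "[]" formal_prec
proof
  show "f \<in> formal \<and> g \<in> formal" if "formal_prec f g" for f g
    using formal_prec_formal that .
  show "formal_prec f h" if "formal_prec f g" "formal_prec g h" for f g h
    using that formal_prec_le formal_le_prec by blast
  show "\<exists>g. formal_prec f g \<and> formal_prec g h" if fh: "formal_prec f h" for f h
  proof -
    obtain h' where h: "formal_le f h'" "formal_wb h' h" using fh by (auto simp: formal_prec_def)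
    obtain g where "formal_wb h' g" "formal_wb g h" using formal_wb_interpolation h by blast
    then show ?thesis using h formal_wb_prec formal_le_prec by blast
  qed
  show "formal_prec (f @ f') (g @ g')" if "formal_prec f g" "formal_prec f' g'" for f f' g g'
    using that formal_wb_append formal_le.append unfolding formal_prec_def by metis
  show "formal_prec [] f" if "f \<in> formal" for f
    using formal_wb_exists[OF that] Nil_formal_le formal_wb_formal unfolding formal_prec_def by blast
  show "formal_prec f (h @ g)" if fgh: "formal_prec f (g @ h)" for f g h
  proof -
    obtain k where k: "formal_le f k" "formal_wb k (g @ h)" using fgh by (auto simp: formal_prec_def)
    \<comment> \<open>\<open>formal_wb\<close> preserves the shape, so \<open>k\<close> splits where
      \<open>g @ h\<close> does, and its halves can be swapped by
      \<open>formal_le.commute\<close>.\<close>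
    obtain k1 k2 where kk: "k = k1 @ k2" "formal_wb k1 g" "formal_wb k2 h"
      using k(2) by (auto simp: formal_wb_def list_all2_append2)
    then have "formal_le f (k2 @ k1)"
      using k formal_le.trans formal_le.commute formal_wb_formal by blast
    then show ?thesis using kk formal_wb_append unfolding formal_prec_def by blast
  qed
qed simp_all

section \<open>Principal ideals and the universal bimorphism\<close>

definition down :: "('a \<times> 'b) list \<Rightarrow> ('a \<times> 'b) list set"
  where "down g = {f. formal_prec f g}"

definition tensor0 :: "'a \<Rightarrow> 'b \<Rightarrow> ('a \<times> 'b) list set"
  where "tensor0 a b = down [(a, b)]"

text \<open>Finitely many terms require finitely many indices, and the approximating sequences
  increase, so beyond the largest of these indices all terms are reached.\<close>

lemma formal_wb_approx:
  assumes ca: "approximation S ca"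
    and cb: "approximation T cb"
    and wb: "formal_wb f g"
  shows "\<exists>n. \<forall>m\<ge>n. formal_wb f (map (\<lambda>(a, b). (ca a m, cb b m)) g)"
  using wb
proof (induction g arbitrary: f)
  case Nil then show ?case by auto
next
  case (Cons x g)
  obtain a b where x: "x = (a, b)" by (cases x)
  obtain a' b' f' where f: "f = (a', b') # f'" "a \<in> carrier S" "a' \<in> carrier S" "b \<in> carrier T"
    "b' \<in> carrier T" "a' \<lless>\<^bsub>S\<^esub> a" "b' \<lless>\<^bsub>T\<^esub> b" "formal_wb f' g"
    using Cons.prems unfolding x formal_wb_Cons by blast
  have inc: "increasing_seq S (ca a)" "increasing_seq T (cb b)"
    using ca cb f S.way_below_seq_increasing T.way_below_seq_increasing
    unfolding approximation_def by blast+
  have sup: "is_supremum S (range (ca a)) a" "is_supremum T (range (cb b)) b"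
    using ca cb f unfolding approximation_def by blast+
  obtain i where i: "a' \<lless>\<^bsub>S\<^esub> ca a i" using S.way_below_supremum'[OF f(6,3,2) inc(1) sup(1)] by blast
  obtain j where j: "b' \<lless>\<^bsub>T\<^esub> cb b j" using T.way_below_supremum'[OF f(7,5,4) inc(2) sup(2)] by blast
  obtain n where n: "\<And>m. m \<ge> n \<Longrightarrow> formal_wb f' (map (\<lambda>(a, b). (ca a m, cb b m)) g)"
    using Cons.IH[OF f(8)] by blast
  have "formal_wb f (map (\<lambda>(a, b). (ca a m, cb b m)) (x # g))" if m: "m \<ge> max n (max i j)" for m
  proof -
    have "a' \<lless>\<^bsub>S\<^esub> ca a m"
      using S.way_below_leq_trans[OF i S.increasing_seq_le[OF inc(1), of i m]] m
        S.increasing_seq_carrier[OF inc(1)] by simp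
    moreover have "b' \<lless>\<^bsub>T\<^esub> cb b m"
      using T.way_below_leq_trans[OF j T.increasing_seq_le[OF inc(2), of j m]] m
        T.increasing_seq_carrier[OF inc(2)] by simp
    ultimately show ?thesis
      using n[of m] m f x S.increasing_seq_carrier[OF inc(1)] T.increasing_seq_carrier[OF inc(2)]
      by (simp add: formal_wb_Cons)
  qed
  then show ?case by blast
qed

lemma map_approx_wb:
  assumes ca: "approximation S ca"
    and cb: "approximation T cb"
  shows "g \<in> formal \<Longrightarrow> formal_wb (map (\<lambda>(a, b). (ca a n, cb b n)) g) g"
    "g \<in> formal \<Longrightarrow> formal_wb (map (\<lambda>(a, b). (ca a n, cb b n)) g)
      (map (\<lambda>(a, b). (ca a (Suc n), cb b (Suc n))) g)"
proof -
  have *: "ca a n \<in> carrier S" "ca a n \<lless>\<^bsub>S\<^esub> a" "ca a n \<lless>\<^bsub>S\<^esub> ca a (Suc n)" if "a \<in> carrier S" for a n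
    using ca that S.way_below_seq_supremum unfolding approximation_def way_below_seq_def by blast+
  have **: "cb b n \<in> carrier T" "cb b n \<lless>\<^bsub>T\<^esub> b" "cb b n \<lless>\<^bsub>T\<^esub> cb b (Suc n)" if "b \<in> carrier T" for b n
    using cb that T.way_below_seq_supremum unfolding approximation_def way_below_seq_def by blast+
  show "g \<in> formal \<Longrightarrow> formal_wb (map (\<lambda>(a, b). (ca a n, cb b n)) g) g"
    by (induction g) (auto simp: formal_wb_Cons * **)
  show "g \<in> formal \<Longrightarrow> formal_wb (map (\<lambda>(a, b). (ca a n, cb b n)) g)
      (map (\<lambda>(a, b). (ca a (Suc n), cb b (Suc n))) g)"
    by (induction g) (auto simp: formal_wb_Cons * **)
qed

text \<open>For formal sums the elements below a given \<open>g\<close> do form an ideal: by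
  \<open>formal_wb_approx\<close> the termwise approximations of \<open>g\<close> are cofinal among
  them.\<close>

lemma down_ideal_of:
  assumes ca: "approximation S ca"
    and cb: "approximation T cb"
    and g: "g \<in> formal"
  shows "R.chain (\<lambda>n. map (\<lambda>(a, b). (ca a n, cb b n)) g)"
    "down g = R.ideal_of (\<lambda>n. map (\<lambda>(a, b). (ca a n, cb b n)) g)"
proof -
  note wb = map_approx_wb[OF ca cb g]
  show "R.chain (\<lambda>n. map (\<lambda>(a, b). (ca a n, cb b n)) g)"
    using wb(2) formal_wb_prec by (simp add: R.chain_def)
  show "down g = R.ideal_of (\<lambda>n. map (\<lambda>(a, b). (ca a n, cb b n)) g)"
  proof
    show "R.ideal_of (\<lambda>n. map (\<lambda>(a, b). (ca a n, cb b n)) g) \<subseteq> down g"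
      using R.prec_trans[OF _ formal_wb_prec[OF wb(1)]] by (auto simp: R.ideal_of_def down_def)
    show "down g \<subseteq> R.ideal_of (\<lambda>n. map (\<lambda>(a, b). (ca a n, cb b n)) g)"
    proof
      fix f assume "f \<in> down g"
      then obtain g' where g': "formal_le f g'" "formal_wb g' g"
        by (auto simp: formal_prec_def down_def)
      then show "f \<in> R.ideal_of (\<lambda>n. map (\<lambda>(a, b). (ca a n, cb b n)) g)"
        using formal_wb_approx[OF ca cb g'(2)] unfolding R.ideal_of_def formal_prec_def
        by blast
    qed
  qed
qed

lemma down_carrier:
  assumes "g \<in> formal" shows "down g \<in> carrier R.completion"
proof -
  obtain ca cb where c: "approximation S ca" "approximation T cb"
    using S.approximation_exists T.approximation_exists by blast
  show ?thesis
    using R.ideal_of_in[OF down_ideal_of(1)[OF c assms]]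
    unfolding down_ideal_of(2)[OF c assms] .
qed

lemma down_append:
  assumes "g \<in> formal" "h \<in> formal"
  shows "down (g @ h) = down g \<oplus>\<^bsub>R.completion\<^esub> down h"
proof
  show "down g \<oplus>\<^bsub>R.completion\<^esub> down h \<subseteq> down (g @ h)"
    using R.prec_trans R.prec_plus unfolding down_def R.completion_add by blast
  show "down (g @ h) \<subseteq> down g \<oplus>\<^bsub>R.completion\<^esub> down h"
  proof
    fix f assume "f \<in> down (g @ h)"
    then obtain k where k: "formal_le f k" "formal_wb k (g @ h)"
      by (auto simp: down_def formal_prec_def)
    \<comment> \<open>The interpolant \<open>l\<close> splits along \<open>g @ h\<close>, and the
      gap between \<open>k\<close> and \<open>l\<close> gives the strict relation required for
      membership in the sum ideal.\<close>
    obtain l where l: "formal_wb k l" "formal_wb l (g @ h)" using formal_wb_interpolation k by blast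
    obtain l1 l2 where ll: "l = l1 @ l2" "formal_wb l1 g" "formal_wb l2 h"
      using l(2) by (auto simp: formal_wb_def list_all2_append2)
    have "formal_prec f (l1 @ l2)" using k l ll formal_wb_prec formal_le_prec by blast
    then show "f \<in> down g \<oplus>\<^bsub>R.completion\<^esub> down h"
      using ll formal_wb_prec unfolding R.completion_add down_def by blast
  qed
qed

lemma bisum_tensor0: "g \<in> formal \<Longrightarrow> bisum R.completion tensor0 g = down g"
proof (induction g)
  case Nil then show ?case by (simp add: R.completion_zero down_def)
next
  case (Cons x g)
  obtain a b where x: "x = (a, b)" by (cases x)
  then have "down ([x] @ g) = down [x] \<oplus>\<^bsub>R.completion\<^esub> down g"
    using Cons by (intro down_append) auto
  then show ?case using Cons x by (simp add: tensor0_def)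
qed

lemma tensor0_iff:
  "f \<in> tensor0 a b \<longleftrightarrow> (\<exists>a' b'. a \<in> carrier S \<and> b \<in> carrier T \<and> a' \<in> carrier S \<and> b' \<in> carrier T \<and>
    a' \<lless>\<^bsub>S\<^esub> a \<and> b' \<lless>\<^bsub>T\<^esub> b \<and> formal_le f [(a', b')])"
  by (auto simp: tensor0_def down_def formal_prec_def formal_wb_Cons)


lemma tensor0_carrier: "a \<in> carrier S \<Longrightarrow> b \<in> carrier T \<Longrightarrow> tensor0 a b \<in> carrier R.completion"
  unfolding tensor0_def by (rule down_carrier) simp

text \<open>Both inclusions pass through approximants. An element way below
  \<open>a \<oplus> a'\<close> is dominated by a sum of approximants of \<open>a\<close> and
  \<open>a'\<close>, which can be split; conversely, two pairs can be merged only after their second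
  entries are raised to a common element way below \<open>b\<close>.\<close>

lemma tensor0_add_left:
  assumes "a \<in> carrier S" "a' \<in> carrier S" "b \<in> carrier T"
  shows "tensor0 (a \<oplus>\<^bsub>S\<^esub> a') b = tensor0 a b \<oplus>\<^bsub>R.completion\<^esub> tensor0 a' b"
proof -
  have "tensor0 (a \<oplus>\<^bsub>S\<^esub> a') b = down ([(a, b)] @ [(a', b)])"
  proof
    show "tensor0 (a \<oplus>\<^bsub>S\<^esub> a') b \<subseteq> down ([(a, b)] @ [(a', b)])"
    proof
      fix f assume "f \<in> tensor0 (a \<oplus>\<^bsub>S\<^esub> a') b"
      then obtain c d where cd: "c \<in> carrier S" "d \<in> carrier T" "c \<lless>\<^bsub>S\<^esub> a \<oplus>\<^bsub>S\<^esub> a'" "d \<lless>\<^bsub>T\<^esub> b"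
        "formal_le f [(c, d)]" unfolding tensor0_iff by blast
      obtain u where u: "way_below_seq S u" "is_supremum S (range u) a"
        using S.way_below_approx assms by blast
      obtain v where v: "way_below_seq S v" "is_supremum S (range v) a'"
        using S.way_below_approx assms by blast
      note inc = S.way_below_seq_increasing[OF u(1)] S.way_below_seq_increasing[OF v(1)]
      have uv: "u n \<in> carrier S" "v n \<in> carrier S" "u n \<lless>\<^bsub>S\<^esub> a" "v n \<lless>\<^bsub>S\<^esub> a'" for n
        using S.way_below_seq_supremum u v unfolding way_below_seq_def by blast+
      obtain n where n: "c \<preceq>\<^bsub>S\<^esub> u n \<oplus>\<^bsub>S\<^esub> v n"
        using S.way_below_supremum[OF cd(3) S.increasing_seq_add[OF inc]
            S.is_supremum_add[OF inc u(2) v(2)] S.leq_refl] assms by auto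
      have "formal_le [(c, d)] [(u n \<oplus>\<^bsub>S\<^esub> v n, d)]"
        using n cd uv by (intro formal_le.mono) (auto simp: T.leq_refl)
      then have "formal_le f [(u n, d), (v n, d)]"
        using formal_le.trans cd(5) formal_le.split_left[OF uv(1,2) cd(2)] by blast
      moreover have "formal_wb [(u n, d), (v n, d)] [(a, b), (a', b)]"
        using assms uv cd by (simp add: formal_wb_Cons)
      ultimately show "f \<in> down ([(a, b)] @ [(a', b)])"
        unfolding down_def formal_prec_def by auto
    qed
    show "down ([(a, b)] @ [(a', b)]) \<subseteq> tensor0 (a \<oplus>\<^bsub>S\<^esub> a') b"
    proof
      fix f assume "f \<in> down ([(a, b)] @ [(a', b)])"
      then obtain c d c' d' where cd: "c \<in> carrier S" "c' \<in> carrier S" "d \<in> carrier T" "d' \<in> carrier T"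
        "c \<lless>\<^bsub>S\<^esub> a" "c' \<lless>\<^bsub>S\<^esub> a'" "d \<lless>\<^bsub>T\<^esub> b" "d' \<lless>\<^bsub>T\<^esub> b" "formal_le f [(c, d), (c', d')]"
        unfolding down_def formal_prec_def by (auto simp: formal_wb_Cons)
      obtain u where u: "way_below_seq T u" "is_supremum T (range u) b"
        using T.way_below_approx assms by blast
      note inc = T.way_below_seq_increasing[OF u(1)]
      have uc: "u n \<in> carrier T" "u n \<lless>\<^bsub>T\<^esub> b" for n
        using T.way_below_seq_supremum u unfolding way_below_seq_def by blast+
      obtain i where i: "d \<preceq>\<^bsub>T\<^esub> u i"
        using T.way_below_supremum[OF cd(7) inc u(2) T.leq_refl] assms by auto
      obtain j where j: "d' \<preceq>\<^bsub>T\<^esub> u j"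
        using T.way_below_supremum[OF cd(8) inc u(2) T.leq_refl] assms by auto
      define e where "e = u (max i j)"
      have e: "e \<in> carrier T" "e \<lless>\<^bsub>T\<^esub> b" "d \<preceq>\<^bsub>T\<^esub> e" "d' \<preceq>\<^bsub>T\<^esub> e"
        using uc T.leq_trans[OF _ _ _ i T.increasing_seq_le[OF inc, of i "max i j"]]
          T.leq_trans[OF _ _ _ j T.increasing_seq_le[OF inc, of j "max i j"]] cd
        unfolding e_def by auto
      have "formal_le ([(c, d)] @ [(c', d')]) ([(c, e)] @ [(c', e)])"
        using cd e S.leq_refl by (intro formal_le.append formal_le.mono)
      then have "formal_le f [(c \<oplus>\<^bsub>S\<^esub> c', e)]"
        using formal_le.trans cd(9) formal_le.merge_left[OF cd(1,2) e(1)] by (metis append.simps)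
      then show "f \<in> tensor0 (a \<oplus>\<^bsub>S\<^esub> a') b"
        using assms cd e S.O3[of a c a' c'] unfolding tensor0_iff by auto
    qed
  qed
  then show ?thesis using assms by (simp add: down_append tensor0_def flip: append.simps)
qed

lemma tensor0_add_right:
  assumes "a \<in> carrier S" "b \<in> carrier T" "b' \<in> carrier T"
  shows "tensor0 a (b \<oplus>\<^bsub>T\<^esub> b') = tensor0 a b \<oplus>\<^bsub>R.completion\<^esub> tensor0 a b'"
proof -
  have "tensor0 a (b \<oplus>\<^bsub>T\<^esub> b') = down ([(a, b)] @ [(a, b')])"
  proof
    show "tensor0 a (b \<oplus>\<^bsub>T\<^esub> b') \<subseteq> down ([(a, b)] @ [(a, b')])"
    proof
      fix f assume "f \<in> tensor0 a (b \<oplus>\<^bsub>T\<^esub> b')"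
      then obtain d c where cd: "c \<in> carrier T" "d \<in> carrier S" "c \<lless>\<^bsub>T\<^esub> b \<oplus>\<^bsub>T\<^esub> b'" "d \<lless>\<^bsub>S\<^esub> a"
        "formal_le f [(d, c)]" unfolding tensor0_iff by blast
      obtain u where u: "way_below_seq T u" "is_supremum T (range u) b"
        using T.way_below_approx assms by blast
      obtain v where v: "way_below_seq T v" "is_supremum T (range v) b'"
        using T.way_below_approx assms by blast
      note inc = T.way_below_seq_increasing[OF u(1)] T.way_below_seq_increasing[OF v(1)]
      have uv: "u n \<in> carrier T" "v n \<in> carrier T" "u n \<lless>\<^bsub>T\<^esub> b" "v n \<lless>\<^bsub>T\<^esub> b'" for n
        using T.way_below_seq_supremum u v unfolding way_below_seq_def by blast+
      obtain n where n: "c \<preceq>\<^bsub>T\<^esub> u n \<oplus>\<^bsub>T\<^esub> v n"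
        using T.way_below_supremum[OF cd(3) T.increasing_seq_add[OF inc]
            T.is_supremum_add[OF inc u(2) v(2)] T.leq_refl] assms by auto
      have "formal_le [(d, c)] [(d, u n \<oplus>\<^bsub>T\<^esub> v n)]"
        using n cd uv by (intro formal_le.mono) (auto simp: S.leq_refl)
      then have "formal_le f [(d, u n), (d, v n)]"
        using formal_le.trans cd(5) formal_le.split_right[OF cd(2) uv(1,2)] by blast
      moreover have "formal_wb [(d, u n), (d, v n)] [(a, b), (a, b')]"
        using assms uv cd by (simp add: formal_wb_Cons)
      ultimately show "f \<in> down ([(a, b)] @ [(a, b')])"
        unfolding down_def formal_prec_def by auto
    qed
    show "down ([(a, b)] @ [(a, b')]) \<subseteq> tensor0 a (b \<oplus>\<^bsub>T\<^esub> b')"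
    proof
      fix f assume "f \<in> down ([(a, b)] @ [(a, b')])"
      then obtain c d c' d' where cd: "c \<in> carrier T" "c' \<in> carrier T" "d \<in> carrier S" "d' \<in> carrier S"
        "c \<lless>\<^bsub>T\<^esub> b" "c' \<lless>\<^bsub>T\<^esub> b'" "d \<lless>\<^bsub>S\<^esub> a" "d' \<lless>\<^bsub>S\<^esub> a" "formal_le f [(d, c), (d', c')]"
        unfolding down_def formal_prec_def by (auto simp: formal_wb_Cons)
      obtain u where u: "way_below_seq S u" "is_supremum S (range u) a"
        using S.way_below_approx assms by blast
      note inc = S.way_below_seq_increasing[OF u(1)]
      have uc: "u n \<in> carrier S" "u n \<lless>\<^bsub>S\<^esub> a" for n
        using S.way_below_seq_supremum u unfolding way_below_seq_def by blast+
      obtain i where i: "d \<preceq>\<^bsub>S\<^esub> u i"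
        using S.way_below_supremum[OF cd(7) inc u(2) S.leq_refl] assms by auto
      obtain j where j: "d' \<preceq>\<^bsub>S\<^esub> u j"
        using S.way_below_supremum[OF cd(8) inc u(2) S.leq_refl] assms by auto
      define e where "e = u (max i j)"
      have e: "e \<in> carrier S" "e \<lless>\<^bsub>S\<^esub> a" "d \<preceq>\<^bsub>S\<^esub> e" "d' \<preceq>\<^bsub>S\<^esub> e"
        using uc S.leq_trans[OF _ _ _ i S.increasing_seq_le[OF inc, of i "max i j"]]
          S.leq_trans[OF _ _ _ j S.increasing_seq_le[OF inc, of j "max i j"]] cd
        unfolding e_def by auto
      have "formal_le ([(d, c)] @ [(d', c')]) ([(e, c)] @ [(e, c')])"
        using cd e T.leq_refl by (intro formal_le.append formal_le.mono)
      then have "formal_le f [(e, c \<oplus>\<^bsub>T\<^esub> c')]"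
        using formal_le.trans cd(9) formal_le.merge_right[OF e(1) cd(1,2)] by (metis append.simps)
      then show "f \<in> tensor0 a (b \<oplus>\<^bsub>T\<^esub> b')"
        using assms cd e T.O3[of b c b' c'] unfolding tensor0_iff by auto
    qed
  qed
  then show ?thesis using assms by (simp add: down_append tensor0_def flip: append.simps)
qed

lemma tensor0_mono:
  assumes "a \<in> carrier S" "a' \<in> carrier S" "b \<in> carrier T" "b' \<in> carrier T"
    "a \<preceq>\<^bsub>S\<^esub> a'" "b \<preceq>\<^bsub>T\<^esub> b'"
  shows "tensor0 a b \<subseteq> tensor0 a' b'"
  unfolding subset_iff tensor0_iff using assms S.way_below_leq_trans T.way_below_leq_trans by metis

lemma tensor0_zero:
  shows "b \<in> carrier T \<Longrightarrow> tensor0 \<zero>\<^bsub>S\<^esub> b = \<zero>\<^bsub>R.completion\<^esub>"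
    and "a \<in> carrier S \<Longrightarrow> tensor0 a \<zero>\<^bsub>T\<^esub> = \<zero>\<^bsub>R.completion\<^esub>"
proof -
  have Nil: "f \<in> \<zero>\<^bsub>R.completion\<^esub> \<longleftrightarrow> formal_le f []" for f
    by (auto simp: R.completion_zero formal_prec_def)
  show "tensor0 \<zero>\<^bsub>S\<^esub> b = \<zero>\<^bsub>R.completion\<^esub>" if b: "b \<in> carrier T"
  proof (intro Set.set_eqI iffI)
    fix f assume "f \<in> tensor0 \<zero>\<^bsub>S\<^esub> b"
    then obtain c d where "c \<in> carrier S" "d \<in> carrier T" "c \<lless>\<^bsub>S\<^esub> \<zero>\<^bsub>S\<^esub>" "formal_le f [(c, d)]"
      unfolding tensor0_iff by blast
    \<comment> \<open>Only zero is way below zero, so the pair collapses by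
      \<open>formal_le.zero_left\<close>.\<close>
    then show "f \<in> \<zero>\<^bsub>R.completion\<^esub>"
      using S.leq_zero_eq S.way_below_leq[of c] formal_le.zero_left formal_le.trans Nil by blast
  next
    fix f assume "f \<in> \<zero>\<^bsub>R.completion\<^esub>"
    then have "formal_le f [(\<zero>\<^bsub>S\<^esub>, \<zero>\<^bsub>T\<^esub>)]"
      using Nil formal_le.trans formal_le.zero by blast
    then show "f \<in> tensor0 \<zero>\<^bsub>S\<^esub> b"
      using b S.zero_way_below T.zero_way_below unfolding tensor0_iff by blast
  qed
  show "tensor0 a \<zero>\<^bsub>T\<^esub> = \<zero>\<^bsub>R.completion\<^esub>" if a: "a \<in> carrier S"
  proof (intro Set.set_eqI iffI)
    fix f assume "f \<in> tensor0 a \<zero>\<^bsub>T\<^esub>"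
    then obtain c d where "c \<in> carrier S" "d \<in> carrier T" "d \<lless>\<^bsub>T\<^esub> \<zero>\<^bsub>T\<^esub>" "formal_le f [(c, d)]"
      unfolding tensor0_iff by blast
    then show "f \<in> \<zero>\<^bsub>R.completion\<^esub>"
      using T.leq_zero_eq T.way_below_leq[of d] formal_le.zero_right formal_le.trans Nil by blast
  next
    fix f assume "f \<in> \<zero>\<^bsub>R.completion\<^esub>"
    then have "formal_le f [(\<zero>\<^bsub>S\<^esub>, \<zero>\<^bsub>T\<^esub>)]"
      using Nil formal_le.trans formal_le.zero by blast
    then show "f \<in> tensor0 a \<zero>\<^bsub>T\<^esub>"
      using a S.zero_way_below T.zero_way_below unfolding tensor0_iff by blast
  qed
qed

text \<open>Continuity holds because membership in \<open>tensor0 s b\<close> is witnessed by some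
  \<open>a'\<close> way below \<open>s\<close>, and \<open>way_below_supremum'\<close> moves this
  witness to some \<open>c k\<close>.\<close>

lemma cu_bimorphism_tensor0: "cu_bimorphism S T R.completion tensor0"
proof (rule cu_bimorphismI[OF S.cu_semigroup_axioms T.cu_semigroup_axioms R.cu_semigroup_completion])
  interpret C: cu_semigroup R.completion by (rule R.cu_semigroup_completion)
  show "gen_cu_bimorphism S T R.completion tensor0"
    unfolding gen_cu_bimorphism_def
  proof (intro conjI ballI)
    fix b assume b: "b \<in> carrier T"
    show "(\<lambda>a\<in>carrier S. tensor0 a b) \<in> gen_cu_mor S R.completion"
    proof (rule gen_cu_morI[OF S.cu_semigroup_axioms R.cu_semigroup_completion])
      fix c s u assume c: "increasing_seq S c" "is_supremum S (range c) s"
        "u \<in> carrier R.completion" "\<And>n. (\<lambda>a\<in>carrier S. tensor0 a b) (c n) \<preceq>\<^bsub>R.completion\<^esub> u"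
      have cc: "c n \<in> carrier S" for n using S.increasing_seq_carrier[OF c(1)] .
      have s: "s \<in> carrier S" using S.is_supremum_carrier[OF c(2)] .
      have "tensor0 s b \<subseteq> (\<Union>n. tensor0 (c n) b)"
      proof
        fix f assume "f \<in> tensor0 s b"
        then obtain a' b' where f: "a' \<in> carrier S" "b' \<in> carrier T" "a' \<lless>\<^bsub>S\<^esub> s" "b' \<lless>\<^bsub>T\<^esub> b"
          "formal_le f [(a', b')]" unfolding tensor0_iff by blast
        obtain k where "a' \<lless>\<^bsub>S\<^esub> c k" using S.way_below_supremum'[OF f(3,1) s c(1,2)] by blast
        then show "f \<in> (\<Union>n. tensor0 (c n) b)" using f b cc unfolding UN_iff tensor0_iff by blast
      qed
      then show "(\<lambda>a\<in>carrier S. tensor0 a b) s \<preceq>\<^bsub>R.completion\<^esub> u"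
        using c(4) cc s by (auto simp: R.completion_leq)
    qed (use b in \<open>auto simp: tensor0_carrier tensor0_add_left tensor0_zero R.completion_leq
          intro: subsetD[OF tensor0_mono[of _ _ b b]] T.leq_refl\<close>)
  next
    fix a assume a: "a \<in> carrier S"
    show "(\<lambda>b\<in>carrier T. tensor0 a b) \<in> gen_cu_mor T R.completion"
    proof (rule gen_cu_morI[OF T.cu_semigroup_axioms R.cu_semigroup_completion])
      fix c s u assume c: "increasing_seq T c" "is_supremum T (range c) s"
        "u \<in> carrier R.completion" "\<And>n. (\<lambda>b\<in>carrier T. tensor0 a b) (c n) \<preceq>\<^bsub>R.completion\<^esub> u"
      have cc: "c n \<in> carrier T" for n using T.increasing_seq_carrier[OF c(1)] .
      have s: "s \<in> carrier T" using T.is_supremum_carrier[OF c(2)] .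
      have "tensor0 a s \<subseteq> (\<Union>n. tensor0 a (c n))"
      proof
        fix f assume "f \<in> tensor0 a s"
        then obtain a' b' where f: "a' \<in> carrier S" "b' \<in> carrier T" "a' \<lless>\<^bsub>S\<^esub> a" "b' \<lless>\<^bsub>T\<^esub> s"
          "formal_le f [(a', b')]" unfolding tensor0_iff by blast
        obtain k where "b' \<lless>\<^bsub>T\<^esub> c k" using T.way_below_supremum'[OF f(4,2) s c(1,2)] by blast
        then show "f \<in> (\<Union>n. tensor0 a (c n))" using f a cc unfolding UN_iff tensor0_iff by blast
      qed
      then show "(\<lambda>b\<in>carrier T. tensor0 a b) s \<preceq>\<^bsub>R.completion\<^esub> u"
        using c(4) cc s by (auto simp: R.completion_leq)
    qed (use a in \<open>auto simp: tensor0_carrier tensor0_add_right tensor0_zero R.completion_leq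
          intro: subsetD[OF tensor0_mono[of a a]] S.leq_refl\<close>)
  qed
  show "tensor0 a' b' \<lless>\<^bsub>R.completion\<^esub> tensor0 a b"
    if ab: "a \<in> carrier S" "a' \<in> carrier S" "b \<in> carrier T" "b' \<in> carrier T"
      "a' \<lless>\<^bsub>S\<^esub> a" "b' \<lless>\<^bsub>T\<^esub> b" for a a' b b'
  proof (rule R.way_below_completionI[OF tensor0_carrier])
    \<comment> \<open>The one-term sum \<open>[(a', b')]\<close> is the member of the larger ideal
      that bounds the whole smaller one.\<close>
    show "[(a', b')] \<in> tensor0 a b" using ab formal_le.refl[of "[(a', b')]"] unfolding tensor0_iff by auto
    show "formal_prec f [(a', b')]" if "f \<in> tensor0 a' b'" for f
      using that by (simp add: tensor0_def down_def)
  qed (use ab in simp_all)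
qed

text \<open>Two maps instead of one, because for trimorphisms the two sums are formed with different
  third arguments \<open>c'\<close> and \<open>c\<close>.\<close>

lemma formal_wb_bisum:
  assumes "cu_semigroup P"
    and wb: "\<And>a a' b b'. a \<in> carrier S \<Longrightarrow> a' \<in> carrier S \<Longrightarrow> b \<in> carrier T \<Longrightarrow> b' \<in> carrier T \<Longrightarrow>
      a' \<lless>\<^bsub>S\<^esub> a \<Longrightarrow> b' \<lless>\<^bsub>T\<^esub> b \<Longrightarrow> \<psi> a' b' \<lless>\<^bsub>P\<^esub> \<phi> a b"
    and \<phi>: "\<And>a b. a \<in> carrier S \<Longrightarrow> b \<in> carrier T \<Longrightarrow> \<phi> a b \<in> carrier P"
    and \<psi>: "\<And>a b. a \<in> carrier S \<Longrightarrow> b \<in> carrier T \<Longrightarrow> \<psi> a b \<in> carrier P"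
  shows "formal_wb f g \<Longrightarrow> bisum P \<psi> f \<lless>\<^bsub>P\<^esub> bisum P \<phi> g"
proof (induction g arbitrary: f)
  interpret P: cu_semigroup P by fact
  {
    case Nil then show ?case by (simp add: P.zero_way_below)
  next
    case (Cons x g)
    obtain a b where x: "x = (a, b)" by (cases x)
    obtain a' b' f' where f: "f = (a', b') # f'" "a \<in> carrier S" "a' \<in> carrier S" "b \<in> carrier T"
      "b' \<in> carrier T" "a' \<lless>\<^bsub>S\<^esub> a" "b' \<lless>\<^bsub>T\<^esub> b" "formal_wb f' g"
      using Cons.prems unfolding x formal_wb_Cons by blast
    have "bisum P \<psi> f' \<in> carrier P" "bisum P \<phi> g \<in> carrier P"
      using bisum_closed[of P "carrier S" "carrier T" \<psi> f', OF assms(1) \<psi>]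
        bisum_closed[of P "carrier S" "carrier T" \<phi> g, OF assms(1) \<phi>] formal_wb_formal[OF f(8)]
      by (auto simp: formal_def)
    then have "\<psi> a' b' \<oplus>\<^bsub>P\<^esub> bisum P \<psi> f' \<lless>\<^bsub>P\<^esub> \<phi> a b \<oplus>\<^bsub>P\<^esub> bisum P \<phi> g"
      using f Cons.IH[OF f(8)] by (intro P.O3 wb \<phi> \<psi>) auto
    then show ?case using f x by simp
  }
qed

lemma is_supremum_bisum_approx:
  assumes c: "approximation S ca" "approximation T cb" and P: "cu_semigroup P"
    and \<phi>: "gen_cu_bimorphism S T P \<phi>"
  shows "g \<in> formal \<Longrightarrow> increasing_seq P (\<lambda>n. bisum P \<phi> (map (\<lambda>(a, b). (ca a n, cb b n)) g)) \<and>
    is_supremum P (range (\<lambda>n. bisum P \<phi> (map (\<lambda>(a, b). (ca a n, cb b n)) g))) (bisum P \<phi> g)"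
proof -
  interpret P: cu_semigroup P by fact
  show "g \<in> formal \<Longrightarrow> increasing_seq P (\<lambda>n. bisum P \<phi> (map (\<lambda>(a, b). (ca a n, cb b n)) g)) \<and>
    is_supremum P (range (\<lambda>n. bisum P \<phi> (map (\<lambda>(a, b). (ca a n, cb b n)) g))) (bisum P \<phi> g)"
  proof (induction g)
    case Nil
    then show ?case using P.increasing_seq_const P.is_supremum_const by simp
  next
    case (Cons x g)
    obtain a b where x: "x = (a, b)" by (cases x)
    have ab: "way_below_seq S (ca a)" "is_supremum S (range (ca a)) a"
      "way_below_seq T (cb b)" "is_supremum T (range (cb b)) b"
      using c Cons.prems x unfolding approximation_def by auto
    note sup = gen_cu_bimorphism_supremum[OF S.cu_semigroup_axioms T.cu_semigroup_axioms P \<phi>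
        S.way_below_seq_increasing[OF ab(1)] ab(2) T.way_below_seq_increasing[OF ab(3)] ab(4)]
    have IH: "increasing_seq P (\<lambda>n. bisum P \<phi> (map (\<lambda>(a, b). (ca a n, cb b n)) g))"
      "is_supremum P (range (\<lambda>n. bisum P \<phi> (map (\<lambda>(a, b). (ca a n, cb b n)) g))) (bisum P \<phi> g)"
      using Cons x by simp_all
    show ?case
      using P.increasing_seq_add[OF sup(1) IH(1)] P.is_supremum_add[OF sup(1) IH(1) sup(2) IH(2)]
      by (simp add: x)
  qed
qed

section \<open>Extending bimorphisms to the completion\<close>

context
  fixes P :: "('p, 'm) posemigroup_scheme" and \<phi> :: "'a \<Rightarrow> 'b \<Rightarrow> 'p"
  assumes P: "cu_semigroup P" and \<phi>: "gen_cu_bimorphism S T P \<phi>"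
begin

interpretation P: cu_semigroup P by (rule P)

lemma gen_cu_bimorphism_closed: "a \<in> carrier S \<Longrightarrow> b \<in> carrier T \<Longrightarrow> \<phi> a b \<in> carrier P"
  using \<phi> restrict_gen_cu_morD(1)[OF S.cu_semigroup_axioms] unfolding gen_cu_bimorphism_def by blast

lemma bisum_formal_closed: "f \<in> formal \<Longrightarrow> bisum P \<phi> f \<in> carrier P"
  using bisum_closed[of P "carrier S" "carrier T" \<phi>, OF P gen_cu_bimorphism_closed]
  by (simp add: formal_def)

lemma bisum_prec: "formal_prec f g \<Longrightarrow> bisum P \<phi> f \<preceq>\<^bsub>P\<^esub> bisum P \<phi> g"
  using formal_le_bisum[OF formal_prec_le P \<phi>] .

lemma bisum_formal_append:
  "f \<in> formal \<Longrightarrow> g \<in> formal \<Longrightarrow> bisum P \<phi> (f @ g) = bisum P \<phi> f \<oplus>\<^bsub>P\<^esub> bisum P \<phi> g"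
  using bisum_append[of P "carrier S" "carrier T" \<phi>, OF P gen_cu_bimorphism_closed]
  by (simp add: formal_def)

lemmas bisum_ext_axioms = P bisum_formal_closed bisum_prec bisum_formal_append bisum_simps(1)

lemma tensor0_ext_gen: "R.ext P (bisum P \<phi>) \<in> gen_cu_mor R.completion P"
  by (rule R.ext_gen_cu_mor[OF bisum_ext_axioms])

text \<open>The ideal \<open>tensor0 a b\<close> is generated by the one-term sums of approximants
  of \<open>a\<close> and \<open>b\<close>, whose values have supremum \<open>\<phi> a b\<close> by
  continuity.\<close>

lemma tensor0_ext_pure:
  assumes "a \<in> carrier S" "b \<in> carrier T"
  shows "R.ext P (bisum P \<phi>) (tensor0 a b) = \<phi> a b"
proof -
  obtain ca cb where c: "approximation S ca" "approximation T cb"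
    using S.approximation_exists T.approximation_exists by blast
  note d = down_ideal_of[OF c, of "[(a, b)]"]
  have "is_supremum P (bisum P \<phi> ` tensor0 a b) (\<phi> a b)"
    using is_supremum_bisum_approx[OF c P \<phi>, of "[(a, b)]"] R.ext_chain(2)[OF bisum_ext_axioms d(1)]
      d(2) assms gen_cu_bimorphism_closed by (simp add: tensor0_def)
  then show ?thesis
    using P.is_supremum_unique R.is_supremum_ext[OF bisum_ext_axioms tensor0_carrier[OF assms]] by blast
qed

text \<open>The relation \<open>\<lless>\<close> between ideals gives one bound \<open>g\<close> in
  \<open>J\<close> for all of \<open>I\<close>. Going up once more inside \<open>J\<close>, to
  \<open>h\<close>, makes room for a termwise \<open>\<lless>\<close> step, which the bimorphism
  turns into \<open>\<lless>\<close> in \<open>P\<close>.\<close>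

lemma tensor0_ext_cu:
  assumes "cu_bimorphism S T P \<phi>"
  shows "R.ext P (bisum P \<phi>) \<in> cu_mor R.completion P"
proof -
  have wb: "formal_wb f g \<Longrightarrow> bisum P \<phi> f \<lless>\<^bsub>P\<^esub> bisum P \<phi> g" for f g
    by (rule formal_wb_bisum[OF P _ gen_cu_bimorphism_closed gen_cu_bimorphism_closed])
      (rule cu_bimorphism_way_below[OF assms])
  have "R.ext P (bisum P \<phi>) I \<lless>\<^bsub>P\<^esub> R.ext P (bisum P \<phi>) J"
    if IJ: "I \<in> carrier R.completion" "J \<in> carrier R.completion" "I \<lless>\<^bsub>R.completion\<^esub> J" for I J
  proof -
    obtain g where g: "g \<in> J" "\<And>f. f \<in> I \<Longrightarrow> formal_prec f g"
      using R.way_below_completion_iff[OF IJ(1,2)] IJ(3) by blast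
    obtain h where h: "h \<in> J" "formal_prec g h" using R.ideal_round[OF IJ(2) g(1)] by blast
    obtain h' where h': "formal_le g h'" "formal_wb h' h" using h(2) by (auto simp: formal_prec_def)
    note sI = R.is_supremum_ext[OF bisum_ext_axioms IJ(1)]
      and sJ = R.is_supremum_ext[OF bisum_ext_axioms IJ(2)]
    have fm: "g \<in> formal" "h' \<in> formal" "h \<in> formal"
      using h' formal_le_formal formal_wb_formal by blast+
    note cl = bisum_formal_closed[OF fm(1)] bisum_formal_closed[OF fm(2)] bisum_formal_closed[OF fm(3)]
      P.is_supremum_carrier[OF sI] P.is_supremum_carrier[OF sJ]
    have 1: "R.ext P (bisum P \<phi>) I \<preceq>\<^bsub>P\<^esub> bisum P \<phi> g"
      using sI cl(1) bisum_prec[OF g(2)] by (auto simp: is_supremum_def)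
    have 2: "bisum P \<phi> h \<preceq>\<^bsub>P\<^esub> R.ext P (bisum P \<phi>) J"
      using sJ h(1) by (auto simp: is_supremum_def)
    have "bisum P \<phi> g \<lless>\<^bsub>P\<^esub> bisum P \<phi> h"
      using P.leq_way_below_trans[OF formal_le_bisum[OF h'(1) P \<phi>] wb[OF h'(2)] cl(1,2)] .
    then show ?thesis
      using P.leq_way_below_trans[OF 1 _ cl(4,1)] P.way_below_leq_trans[OF _ 2 cl(3,5)] by blast
  qed
  then show ?thesis using tensor0_ext_gen by (auto simp: cu_mor_def)
qed

end

end

text \<open>Formulated for any pair \<open>X\<close>, \<open>\<tau>\<close>, because it is proved
  for the completion and then carried over to the chosen tensor product.\<close>

definition tensor_generated ::
    "'a posemigroup \<Rightarrow> 'b posemigroup \<Rightarrow> ('c, 'm) posemigroup_scheme \<Rightarrow> ('a \<Rightarrow> 'b \<Rightarrow> 'c) \<Rightarrow> bool"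
  where "tensor_generated S T X \<tau> \<longleftrightarrow> (\<forall>u\<in>carrier X. \<exists>x.
    (\<forall>n. set (x n) \<subseteq> carrier S \<times> carrier T) \<and> increasing_seq X (\<lambda>n. bisum X \<tau> (x n)) \<and>
    is_supremum X (range (\<lambda>n. bisum X \<tau> (x n))) u)"

text \<open>Comparison on finite sums follows by additivity and on their suprema by continuity;
  hence order detection holds for generalized morphisms and for targets of every type.\<close>

lemma tensor_generated_leq:
  assumes "cu_semigroup X" "cu_semigroup P" "tensor_generated S T X \<tau>"
    and \<tau>: "\<And>a b. a \<in> carrier S \<Longrightarrow> b \<in> carrier T \<Longrightarrow> \<tau> a b \<in> carrier X"
    and f: "f \<in> gen_cu_mor X P" and g: "g \<in> gen_cu_mor X P"
    and le: "\<And>a b. a \<in> carrier S \<Longrightarrow> b \<in> carrier T \<Longrightarrow> f (\<tau> a b) \<preceq>\<^bsub>P\<^esub> g (\<tau> a b)"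
    and u: "u \<in> carrier X"
  shows "f u \<preceq>\<^bsub>P\<^esub> g u"
proof -
  interpret X: cu_semigroup X by fact
  interpret P: cu_semigroup P by fact
  obtain x where x: "\<And>n. set (x n) \<subseteq> carrier S \<times> carrier T"
    "increasing_seq X (\<lambda>n. bisum X \<tau> (x n))" "is_supremum X (range (\<lambda>n. bisum X \<tau> (x n))) u"
    using assms(3) u unfolding tensor_generated_def by blast
  note sf = gen_cu_mor_supremum[OF assms(1,2) f x(2,3)]
    and sg = gen_cu_mor_supremum[OF assms(1,2) g x(2,3)]
  note gc = gen_cu_mor_closed[OF g] and fc = gen_cu_mor_closed[OF f]
  note xc = X.increasing_seq_carrier[OF x(2)]
  show ?thesis
  proof (rule P.is_supremum_least[OF sf])
    fix n
    have "bisum P (\<lambda>a b. f (\<tau> a b)) (x n) \<preceq>\<^bsub>P\<^esub> bisum P (\<lambda>a b. g (\<tau> a b)) (x n)"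
      by (rule bisum_mono[OF assms(2) _ _ _ x(1)]) (simp_all add: fc gc le \<tau>)
    then have le': "f (bisum X \<tau> (x n)) \<preceq>\<^bsub>P\<^esub> g (bisum X \<tau> (x n))"
      using gen_cu_mor_bisum[of X _ P "carrier S" "carrier T" \<tau>, OF assms(1) f \<tau> x(1)]
        gen_cu_mor_bisum[of X _ P "carrier S" "carrier T" \<tau>, OF assms(1) g \<tau> x(1)] by simp
    show "f (bisum X \<tau> (x n)) \<preceq>\<^bsub>P\<^esub> g u"
      using P.leq_trans[OF fc[OF xc] gc[OF xc] gc[OF u] le' P.is_supremum_upper[OF sg]] .
  qed (rule gc[OF u])
qed

lemma tensor_generated_eq:
  assumes "cu_semigroup X" "cu_semigroup P" "tensor_generated S T X \<tau>"
    and "\<And>a b. a \<in> carrier S \<Longrightarrow> b \<in> carrier T \<Longrightarrow> \<tau> a b \<in> carrier X"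
    and f: "f \<in> gen_cu_mor X P" and g: "g \<in> gen_cu_mor X P"
    and eq: "\<And>a b. a \<in> carrier S \<Longrightarrow> b \<in> carrier T \<Longrightarrow> f (\<tau> a b) = g (\<tau> a b)"
  shows "f = g"
proof (rule gen_cu_mor_eqI[OF f g])
  interpret P: cu_semigroup P by fact
  fix u assume u: "u \<in> carrier X"
  have refl: "f (\<tau> a b) \<preceq>\<^bsub>P\<^esub> f (\<tau> a b)" if "a \<in> carrier S" "b \<in> carrier T" for a b
    using that assms(4) gen_cu_mor_closed[OF f] P.leq_refl by blast
  have "f u \<preceq>\<^bsub>P\<^esub> g u"
    by (rule tensor_generated_leq[OF assms(1-4) f g _ u]) (simp_all add: refl flip: eq)
  moreover have "g u \<preceq>\<^bsub>P\<^esub> f u"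
    by (rule tensor_generated_leq[OF assms(1-4) g f _ u]) (simp_all add: refl flip: eq)
  ultimately show "f u = g u"
    using P.leq_antisym gen_cu_mor_closed[OF f u] gen_cu_mor_closed[OF g u] by blast
qed

lemma is_cu_tensor_ex1:
  fixes X P :: "'c posemigroup"
  assumes "is_cu_tensor S T X \<tau>" "cu_semigroup P" "cu_bimorphism S T P \<phi>"
  shows "\<exists>!\<alpha>. \<alpha> \<in> cu_mor X P \<and> (\<forall>a\<in>carrier S. \<forall>b\<in>carrier T. \<alpha> (\<tau> a b) = \<phi> a b)"
  using assms by (simp add: is_cu_tensor_def)

context cu_pair
begin

lemma tensor0_generated: "tensor_generated S T R.completion tensor0"
  unfolding tensor_generated_def
proof
  fix u assume u: "u \<in> carrier R.completion"
  obtain x where x: "R.chain x" "u = R.ideal_of x" using R.completion_cases[OF u] .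
  have xf: "x n \<in> formal" for n using x(1) R.prec_carrier unfolding R.chain_def by blast
  have eq: "bisum R.completion tensor0 (x n) = down (x n)" for n using bisum_tensor0[OF xf] .
  have "down (x n) \<subseteq> down (x (Suc n))" for n
    using x(1) R.prec_trans unfolding R.chain_def down_def by blast
  then have inc: "increasing_seq R.completion (\<lambda>n. down (x n))"
    by (simp add: increasing_seq_def R.completion_leq down_carrier xf)
  have "u = (\<Union>n. down (x n))" using x by (auto simp: R.ideal_of_def down_def)
  then show "\<exists>x. (\<forall>n. set (x n) \<subseteq> carrier S \<times> carrier T) \<and>
      increasing_seq R.completion (\<lambda>n. bisum R.completion tensor0 (x n)) \<and>
      is_supremum R.completion (range (\<lambda>n. bisum R.completion tensor0 (x n))) u"
    using inc R.is_supremum_iff[OF inc] xf eq by (intro exI[of _ x]) (auto simp: formal_def)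
qed

lemma is_cu_tensor_completion: "is_cu_tensor S T R.completion tensor0"
  unfolding is_cu_tensor_def
proof (intro conjI allI impI)
  fix P :: "('a \<times> 'b) list set posemigroup" and \<phi>
  assume P: "cu_semigroup P" and \<phi>: "cu_bimorphism S T P \<phi>"
  note g\<phi> = cu_bimorphism_gen[OF S.cu_semigroup_axioms T.cu_semigroup_axioms P \<phi>]
  show "\<exists>!\<alpha>. \<alpha> \<in> cu_mor R.completion P \<and>
      (\<forall>a\<in>carrier S. \<forall>b\<in>carrier T. \<alpha> (tensor0 a b) = \<phi> a b)"
  proof (rule ex1I[of _ "R.ext P (bisum P \<phi>)"])
    show "R.ext P (bisum P \<phi>) \<in> cu_mor R.completion P \<and>
        (\<forall>a\<in>carrier S. \<forall>b\<in>carrier T. R.ext P (bisum P \<phi>) (tensor0 a b) = \<phi> a b)"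
      using tensor0_ext_cu[OF P g\<phi> \<phi>] tensor0_ext_pure[OF P g\<phi>] by blast
    fix \<alpha> assume \<alpha>: "\<alpha> \<in> cu_mor R.completion P \<and>
      (\<forall>a\<in>carrier S. \<forall>b\<in>carrier T. \<alpha> (tensor0 a b) = \<phi> a b)"
    show "\<alpha> = R.ext P (bisum P \<phi>)"
      by (rule tensor_generated_eq[OF R.cu_semigroup_completion P tensor0_generated tensor0_carrier])
        (use \<alpha> cu_mor_gen[of \<alpha>] tensor0_ext_gen[OF P g\<phi>] tensor0_ext_pure[OF P g\<phi>] in auto)
  qed
next
  fix P :: "('a \<times> 'b) list set posemigroup" and \<alpha>1 \<alpha>2
  assume P: "cu_semigroup P" and \<alpha>: "\<alpha>1 \<in> cu_mor R.completion P" "\<alpha>2 \<in> cu_mor R.completion P"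
  show "(\<forall>u\<in>carrier R.completion. \<alpha>1 u \<preceq>\<^bsub>P\<^esub> \<alpha>2 u) \<longleftrightarrow>
    (\<forall>a\<in>carrier S. \<forall>b\<in>carrier T. \<alpha>1 (tensor0 a b) \<preceq>\<^bsub>P\<^esub> \<alpha>2 (tensor0 a b))"
    using tensor_generated_leq[OF R.cu_semigroup_completion P tensor0_generated tensor0_carrier
        cu_mor_gen[OF \<alpha>(1)] cu_mor_gen[OF \<alpha>(2)]] tensor0_carrier by blast
qed (use R.cu_semigroup_completion cu_bimorphism_tensor0 in auto)

text \<open>\<open>tensor_elem\<close> is exactly the type of sets of formal sums, so the completion
  is a legitimate witness for the choice operator.\<close>

lemma is_cu_tensor: "is_cu_tensor S T (S \<otimes>\<^sub>C\<^sub>u T) (pure_tensor S T)"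
  unfolding cu_tensor_def pure_tensor_def cu_tensor_choice_def
  by (rule someI[of "\<lambda>p. is_cu_tensor S T (fst p) (snd p)" "(R.completion, tensor0)"])
    (simp add: is_cu_tensor_completion)

lemma cu_semigroup_tensor: "cu_semigroup (S \<otimes>\<^sub>C\<^sub>u T)"
  and cu_bimorphism_pure_tensor: "cu_bimorphism S T (S \<otimes>\<^sub>C\<^sub>u T) (pure_tensor S T)"
  using is_cu_tensor by (simp_all add: is_cu_tensor_def)

lemma pure_tensor_closed:
  "a \<in> carrier S \<Longrightarrow> b \<in> carrier T \<Longrightarrow> pure_tensor S T a b \<in> carrier (S \<otimes>\<^sub>C\<^sub>u T)"
  using cu_bimorphism_closed[OF cu_bimorphism_pure_tensor] .

text \<open>Completion and chosen product live on the same type, so each is a test object for the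
  other. The composite \<open>i (j u)\<close> fixes pure tensors, and uniqueness makes it the
  identity.\<close>

lemma tensor_comparison:
  obtains i j where "i \<in> cu_mor R.completion (S \<otimes>\<^sub>C\<^sub>u T)" "j \<in> cu_mor (S \<otimes>\<^sub>C\<^sub>u T) R.completion"
    "\<And>a b. a \<in> carrier S \<Longrightarrow> b \<in> carrier T \<Longrightarrow> i (tensor0 a b) = pure_tensor S T a b"
    "\<And>a b. a \<in> carrier S \<Longrightarrow> b \<in> carrier T \<Longrightarrow> j (pure_tensor S T a b) = tensor0 a b"
    "\<And>u. u \<in> carrier (S \<otimes>\<^sub>C\<^sub>u T) \<Longrightarrow> i (j u) = u"
proof -
  let ?X = "S \<otimes>\<^sub>C\<^sub>u T" and ?\<tau> = "pure_tensor S T"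
  note C = R.cu_semigroup_completion and X = cu_semigroup_tensor
  obtain i where i: "i \<in> cu_mor R.completion ?X"
    "\<And>a b. a \<in> carrier S \<Longrightarrow> b \<in> carrier T \<Longrightarrow> i (tensor0 a b) = ?\<tau> a b"
    using is_cu_tensor_ex1[OF is_cu_tensor_completion X cu_bimorphism_pure_tensor] by blast
  obtain j where j: "j \<in> cu_mor ?X R.completion"
    "\<And>a b. a \<in> carrier S \<Longrightarrow> b \<in> carrier T \<Longrightarrow> j (?\<tau> a b) = tensor0 a b"
    using is_cu_tensor_ex1[OF is_cu_tensor C cu_bimorphism_tensor0] by blast
  have "\<exists>!\<alpha>. \<alpha> \<in> cu_mor ?X ?X \<and> (\<forall>a\<in>carrier S. \<forall>b\<in>carrier T. \<alpha> (?\<tau> a b) = ?\<tau> a b)"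
    by (rule is_cu_tensor_ex1[OF is_cu_tensor X cu_bimorphism_pure_tensor])
  moreover have "compose (carrier ?X) i j \<in> cu_mor ?X ?X" "cu_id ?X \<in> cu_mor ?X ?X"
    using cu_mor_compose[OF X C X j(1) i(1)] cu_id_mor[OF X] by auto
  moreover have "\<forall>a\<in>carrier S. \<forall>b\<in>carrier T. compose (carrier ?X) i j (?\<tau> a b) = ?\<tau> a b"
    "\<forall>a\<in>carrier S. \<forall>b\<in>carrier T. cu_id ?X (?\<tau> a b) = ?\<tau> a b"
    using i j pure_tensor_closed by (auto simp: compose_def cu_id_def)
  ultimately have eq: "compose (carrier ?X) i j = cu_id ?X" by blast
  have "i (j u) = u" if "u \<in> carrier ?X" for u
    using fun_cong[OF eq, of u] that by (simp add: compose_def cu_id_def)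
  then show ?thesis using that i j by blast
qed

text \<open>Routing through the completion gives extensions into targets of every type, and of
  generalized bimorphisms as well; \<open>is_cu_tensor\<close> states neither directly.\<close>

lemma tensor_extend:
  assumes "cu_semigroup P" "gen_cu_bimorphism S T P \<phi>"
  obtains \<alpha> where "\<alpha> \<in> gen_cu_mor (S \<otimes>\<^sub>C\<^sub>u T) P"
    "\<And>a b. a \<in> carrier S \<Longrightarrow> b \<in> carrier T \<Longrightarrow> \<alpha> (pure_tensor S T a b) = \<phi> a b"
    "cu_bimorphism S T P \<phi> \<Longrightarrow> \<alpha> \<in> cu_mor (S \<otimes>\<^sub>C\<^sub>u T) P"
proof -
  obtain i j where ij: "j \<in> cu_mor (S \<otimes>\<^sub>C\<^sub>u T) R.completion"
    "\<And>a b. a \<in> carrier S \<Longrightarrow> b \<in> carrier T \<Longrightarrow> j (pure_tensor S T a b) = tensor0 a b"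
    using tensor_comparison by metis
  let ?\<alpha> = "compose (carrier (S \<otimes>\<^sub>C\<^sub>u T)) (R.ext P (bisum P \<phi>)) j"
  note C = R.cu_semigroup_completion and X = cu_semigroup_tensor
  show ?thesis
  proof (rule that[of ?\<alpha>])
    show "?\<alpha> \<in> gen_cu_mor (S \<otimes>\<^sub>C\<^sub>u T) P"
      using gen_cu_mor_compose[OF X C assms(1) cu_mor_gen[OF ij(1)] tensor0_ext_gen[OF assms]] .
    show "?\<alpha> (pure_tensor S T a b) = \<phi> a b" if "a \<in> carrier S" "b \<in> carrier T" for a b
      using ij tensor0_ext_pure[OF assms] pure_tensor_closed that by (simp add: compose_def)
    show "?\<alpha> \<in> cu_mor (S \<otimes>\<^sub>C\<^sub>u T) P" if "cu_bimorphism S T P \<phi>"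
      using cu_mor_compose[OF X C assms(1) ij(1) tensor0_ext_cu[OF assms that]] .
  qed
qed

text \<open>Elements are pulled into the completion by \<open>j\<close>, written there as suprema of
  finite sums, and sent back by \<open>i\<close>.\<close>

lemma tensor_generated: "tensor_generated S T (S \<otimes>\<^sub>C\<^sub>u T) (pure_tensor S T)"
  unfolding tensor_generated_def
proof
  let ?X = "S \<otimes>\<^sub>C\<^sub>u T" and ?\<tau> = "pure_tensor S T"
  note C = R.cu_semigroup_completion and X = cu_semigroup_tensor
  obtain i j where ij: "i \<in> cu_mor R.completion ?X" "j \<in> cu_mor ?X R.completion"
    "\<And>a b. a \<in> carrier S \<Longrightarrow> b \<in> carrier T \<Longrightarrow> i (tensor0 a b) = ?\<tau> a b"
    "\<And>u. u \<in> carrier ?X \<Longrightarrow> i (j u) = u"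
    using tensor_comparison by metis
  note i = cu_mor_gen[OF ij(1)]
  fix u assume u: "u \<in> carrier ?X"
  have ju: "j u \<in> carrier R.completion" using gen_cu_mor_closed[OF cu_mor_gen[OF ij(2)] u] .
  obtain x where x: "\<And>n. set (x n) \<subseteq> carrier S \<times> carrier T"
    "increasing_seq R.completion (\<lambda>n. bisum R.completion tensor0 (x n))"
    "is_supremum R.completion (range (\<lambda>n. bisum R.completion tensor0 (x n))) (j u)"
    using tensor0_generated ju unfolding tensor_generated_def by blast
  have eq: "i (bisum R.completion tensor0 (x n)) = bisum ?X ?\<tau> (x n)" for n
  proof -
    have "i (bisum R.completion tensor0 (x n)) = bisum ?X (\<lambda>a b. i (tensor0 a b)) (x n)"
      by (rule gen_cu_mor_bisum[OF C i tensor0_carrier x(1)])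
    also have "\<dots> = bisum ?X ?\<tau> (x n)" using x(1)[of n] ij(3) by (intro bisum_cong) auto
    finally show ?thesis .
  qed
  show "\<exists>x. (\<forall>n. set (x n) \<subseteq> carrier S \<times> carrier T) \<and> increasing_seq ?X (\<lambda>n. bisum ?X ?\<tau> (x n)) \<and>
      is_supremum ?X (range (\<lambda>n. bisum ?X ?\<tau> (x n))) u"
    using gen_cu_mor_increasing[OF i x(2)] gen_cu_mor_supremum[OF C X i x(2,3)] x(1) ij(4)[OF u]
    unfolding eq by (intro exI[of _ x]) simp
qed

lemma tensor_eqI:
  assumes "cu_semigroup P" "f \<in> gen_cu_mor (S \<otimes>\<^sub>C\<^sub>u T) P" "g \<in> gen_cu_mor (S \<otimes>\<^sub>C\<^sub>u T) P"
    and "\<And>a b. a \<in> carrier S \<Longrightarrow> b \<in> carrier T \<Longrightarrow> f (pure_tensor S T a b) = g (pure_tensor S T a b)"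
  shows "f = g"
  using tensor_generated_eq[OF cu_semigroup_tensor assms(1) tensor_generated pure_tensor_closed] assms
  by blast

lemma tensor_leqI:
  assumes "cu_semigroup P" "f \<in> gen_cu_mor (S \<otimes>\<^sub>C\<^sub>u T) P" "g \<in> gen_cu_mor (S \<otimes>\<^sub>C\<^sub>u T) P"
    and "\<And>a b. a \<in> carrier S \<Longrightarrow> b \<in> carrier T \<Longrightarrow>
      f (pure_tensor S T a b) \<preceq>\<^bsub>P\<^esub> g (pure_tensor S T a b)" "u \<in> carrier (S \<otimes>\<^sub>C\<^sub>u T)"
  shows "f u \<preceq>\<^bsub>P\<^esub> g u"
  using tensor_generated_leq[OF cu_semigroup_tensor assms(1) tensor_generated pure_tensor_closed] assms
  by blast

lemma tensor_mor_ex1: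
  assumes "cu_semigroup P" "cu_bimorphism S T P \<phi>"
  shows "\<exists>!\<alpha>. \<alpha> \<in> cu_mor (S \<otimes>\<^sub>C\<^sub>u T) P \<and>
    (\<forall>a\<in>carrier S. \<forall>b\<in>carrier T. \<alpha> (pure_tensor S T a b) = \<phi> a b)"
proof -
  obtain \<alpha> where \<alpha>: "\<alpha> \<in> cu_mor (S \<otimes>\<^sub>C\<^sub>u T) P"
    "\<And>a b. a \<in> carrier S \<Longrightarrow> b \<in> carrier T \<Longrightarrow> \<alpha> (pure_tensor S T a b) = \<phi> a b"
    using tensor_extend[OF assms(1) cu_bimorphism_gen[OF S.cu_semigroup_axioms T.cu_semigroup_axioms
        assms]] assms(2) by metis
  show ?thesis
  proof (rule ex1I[of _ \<alpha>])
    fix \<beta> assume \<beta>: "\<beta> \<in> cu_mor (S \<otimes>\<^sub>C\<^sub>u T) P \<and>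
      (\<forall>a\<in>carrier S. \<forall>b\<in>carrier T. \<beta> (pure_tensor S T a b) = \<phi> a b)"
    show "\<beta> = \<alpha>"
      by (rule tensor_eqI[OF assms(1)]) (use \<alpha> \<beta> cu_mor_gen[of \<alpha>] cu_mor_gen[of \<beta>] in auto)
  qed (use \<alpha> in blast)
qed

text \<open>Two approximations in turn: \<open>u\<close> by finite sums, then one such sum by its
  termwise approximants. This reduces a \<open>\<lless>\<close> relation in the tensor product to
  \<open>\<lless>\<close> relations in the two factors.\<close>

lemma tensor_way_below_split:
  assumes "u' \<in> carrier (S \<otimes>\<^sub>C\<^sub>u T)" "u \<in> carrier (S \<otimes>\<^sub>C\<^sub>u T)" "u' \<lless>\<^bsub>S \<otimes>\<^sub>C\<^sub>u T\<^esub> u"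
  obtains g' g where "formal_wb g' g"
    "u' \<preceq>\<^bsub>S \<otimes>\<^sub>C\<^sub>u T\<^esub> bisum (S \<otimes>\<^sub>C\<^sub>u T) (pure_tensor S T) g'"
    "bisum (S \<otimes>\<^sub>C\<^sub>u T) (pure_tensor S T) g \<preceq>\<^bsub>S \<otimes>\<^sub>C\<^sub>u T\<^esub> u"
proof -
  let ?X = "S \<otimes>\<^sub>C\<^sub>u T" and ?\<tau> = "pure_tensor S T"
  interpret X: cu_semigroup ?X by (rule cu_semigroup_tensor)
  obtain x where x: "\<And>n. set (x n) \<subseteq> carrier S \<times> carrier T"
    "increasing_seq ?X (\<lambda>n. bisum ?X ?\<tau> (x n))" "is_supremum ?X (range (\<lambda>n. bisum ?X ?\<tau> (x n))) u"
    using tensor_generated assms(2) unfolding tensor_generated_def by blast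
  obtain n where n: "u' \<lless>\<^bsub>?X\<^esub> bisum ?X ?\<tau> (x n)"
    using X.way_below_supremum'[OF assms(3,1,2) x(2,3)] by blast
  obtain ca cb where c: "approximation S ca" "approximation T cb"
    using S.approximation_exists T.approximation_exists by blast
  have xn: "x n \<in> formal" using x by (simp add: formal_def)
  note app = is_supremum_bisum_approx[OF c cu_semigroup_tensor cu_bimorphism_gen[OF
        S.cu_semigroup_axioms T.cu_semigroup_axioms cu_semigroup_tensor cu_bimorphism_pure_tensor] xn]
  obtain k where "u' \<preceq>\<^bsub>?X\<^esub> bisum ?X ?\<tau> (map (\<lambda>(a, b). (ca a k, cb b k)) (x n))"
    using X.way_below_supremum[OF n conjunct1[OF app] conjunct2[OF app]
        X.leq_refl[OF X.increasing_seq_carrier[OF x(2)]]] by blast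
  then show ?thesis using that map_approx_wb(1)[OF c xn] X.is_supremum_upper[OF x(3)] by blast
qed

end

section \<open>Trimorphisms and the associator\<close>

lemmas cu_tensor = cu_pair.cu_semigroup_tensor[OF cu_pair.intro]
lemmas pure_bimorphism = cu_pair.cu_bimorphism_pure_tensor[OF cu_pair.intro]
lemmas pure_closed = cu_pair.pure_tensor_closed[OF cu_pair.intro]

text \<open>Treating the three variables alike lets the same extension argument serve both
  bracketings of a triple tensor product, after a permutation of the variables.\<close>

definition cu_trimorphism ::
    "('a, 'l) posemigroup_scheme \<Rightarrow> ('b, 'm) posemigroup_scheme \<Rightarrow> ('c, 'n) posemigroup_scheme \<Rightarrow>
      ('d, 'k) posemigroup_scheme \<Rightarrow> ('a \<Rightarrow> 'b \<Rightarrow> 'c \<Rightarrow> 'd) \<Rightarrow> bool"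
  where "cu_trimorphism S T P Q \<phi> \<longleftrightarrow>
    (\<forall>b\<in>carrier T. \<forall>c\<in>carrier P. (\<lambda>a\<in>carrier S. \<phi> a b c) \<in> gen_cu_mor S Q) \<and>
    (\<forall>a\<in>carrier S. \<forall>c\<in>carrier P. (\<lambda>b\<in>carrier T. \<phi> a b c) \<in> gen_cu_mor T Q) \<and>
    (\<forall>a\<in>carrier S. \<forall>b\<in>carrier T. (\<lambda>c\<in>carrier P. \<phi> a b c) \<in> gen_cu_mor P Q) \<and>
    (\<forall>a\<in>carrier S. \<forall>a'\<in>carrier S. \<forall>b\<in>carrier T. \<forall>b'\<in>carrier T. \<forall>c\<in>carrier P. \<forall>c'\<in>carrier P.
      a' \<lless>\<^bsub>S\<^esub> a \<longrightarrow> b' \<lless>\<^bsub>T\<^esub> b \<longrightarrow> c' \<lless>\<^bsub>P\<^esub> c \<longrightarrow> \<phi> a' b' c' \<lless>\<^bsub>Q\<^esub> \<phi> a b c)"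

lemma cu_trimorphism_rotate:
  "cu_trimorphism S T P Q \<phi> \<Longrightarrow> cu_trimorphism T P S Q (\<lambda>b c a. \<phi> a b c)"
  unfolding cu_trimorphism_def by simp

lemma gen_cu_bimorphism_right:
  "gen_cu_bimorphism S T P \<phi> \<Longrightarrow> a \<in> carrier S \<Longrightarrow> (\<lambda>b\<in>carrier T. \<phi> a b) \<in> gen_cu_mor T P"
  and gen_cu_bimorphism_left:
  "gen_cu_bimorphism S T P \<phi> \<Longrightarrow> b \<in> carrier T \<Longrightarrow> (\<lambda>a\<in>carrier S. \<phi> a b) \<in> gen_cu_mor S P"
  unfolding gen_cu_bimorphism_def by auto

lemma restrict_compose_gen_cu_mor:
  assumes "cu_semigroup S" "cu_semigroup T" "cu_semigroup P"
    "(\<lambda>a\<in>carrier S. f a) \<in> gen_cu_mor S T" "(\<lambda>b\<in>carrier T. g b) \<in> gen_cu_mor T P"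
  shows "(\<lambda>a\<in>carrier S. g (f a)) \<in> gen_cu_mor S P"
proof -
  have "compose (carrier S) (\<lambda>b\<in>carrier T. g b) (\<lambda>a\<in>carrier S. f a) = (\<lambda>a\<in>carrier S. g (f a))"
    using gen_cu_mor_closed[OF assms(4)] by (auto simp: compose_def)
  then show ?thesis using gen_cu_mor_compose[OF assms] by simp
qed

lemma cu_trimorphism_nested:
  assumes cu: "cu_semigroup S" "cu_semigroup T" "cu_semigroup P" "cu_semigroup Y" "cu_semigroup Q"
    and g: "cu_bimorphism T P Y g" and f: "cu_bimorphism S Y Q f"
  shows "cu_trimorphism S T P Q (\<lambda>a b c. f a (g b c))"
proof -
  note gg = cu_bimorphism_gen[OF cu(2,3,4) g] and gf = cu_bimorphism_gen[OF cu(1,4,5) f]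
  note gcl = cu_bimorphism_closed[OF g]
  show ?thesis
    unfolding cu_trimorphism_def
  proof (intro conjI ballI impI)
    show "(\<lambda>a\<in>carrier S. f a (g b c)) \<in> gen_cu_mor S Q" if "b \<in> carrier T" "c \<in> carrier P" for b c
      using gen_cu_bimorphism_left[OF gf gcl[OF that]] .
    show "(\<lambda>b\<in>carrier T. f a (g b c)) \<in> gen_cu_mor T Q" if "a \<in> carrier S" "c \<in> carrier P" for a c
      using restrict_compose_gen_cu_mor[OF cu(2,4,5) gen_cu_bimorphism_left[OF gg that(2)]
          gen_cu_bimorphism_right[OF gf that(1)]] .
    show "(\<lambda>c\<in>carrier P. f a (g b c)) \<in> gen_cu_mor P Q" if "a \<in> carrier S" "b \<in> carrier T" for a b
      using restrict_compose_gen_cu_mor[OF cu(3,4,5) gen_cu_bimorphism_right[OF gg that(2)]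
          gen_cu_bimorphism_right[OF gf that(1)]] .
  qed (intro cu_bimorphism_way_below[OF f] cu_bimorphism_way_below[OF g] gcl)
qed

text \<open>With \<open>c\<close> fixed, \<open>\<phi>\<close> is a generalized bimorphism in the
  first two variables and extends to \<open>\<alpha> c\<close>. How \<open>\<alpha> c u\<close>
  depends on \<open>c\<close> is known only at pure tensors \<open>u\<close>. Each required identity
  is therefore proved as an equality of generalized morphisms in \<open>u\<close>, using that sums,
  zero and suprema of such morphisms are again of this kind.\<close>

lemma cu_trimorphism_extend:
  assumes cu: "cu_semigroup S" "cu_semigroup T" "cu_semigroup P" "cu_semigroup Q"
    and \<phi>: "cu_trimorphism S T P Q \<phi>"
  obtains \<psi> where "cu_bimorphism (S \<otimes>\<^sub>C\<^sub>u T) P Q \<psi>"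
    "\<And>a b c. a \<in> carrier S \<Longrightarrow> b \<in> carrier T \<Longrightarrow> c \<in> carrier P \<Longrightarrow>
      \<psi> (pure_tensor S T a b) c = \<phi> a b c"
proof -
  interpret ST: cu_pair S T using cu by (simp add: cu_pair.intro)
  interpret P: cu_semigroup P by fact
  interpret Q: cu_semigroup Q by fact
  let ?X = "S \<otimes>\<^sub>C\<^sub>u T" and ?\<tau> = "pure_tensor S T"
  note X = ST.cu_semigroup_tensor and \<tau> = ST.pure_tensor_closed
  interpret X: cu_semigroup ?X by (rule X)
  have bi: "gen_cu_bimorphism S T Q (\<lambda>a b. \<phi> a b c)" if "c \<in> carrier P" for c
    using \<phi> that by (simp add: cu_trimorphism_def gen_cu_bimorphism_def)
  have "\<forall>c\<in>carrier P. \<exists>\<alpha>. \<alpha> \<in> gen_cu_mor ?X Q \<and>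
      (\<forall>a\<in>carrier S. \<forall>b\<in>carrier T. \<alpha> (?\<tau> a b) = \<phi> a b c)"
  proof
    fix c assume "c \<in> carrier P"
    from ST.tensor_extend[OF cu(4) bi[OF this]]
    obtain \<alpha> where "\<alpha> \<in> gen_cu_mor ?X Q"
      "\<And>a b. a \<in> carrier S \<Longrightarrow> b \<in> carrier T \<Longrightarrow> \<alpha> (?\<tau> a b) = \<phi> a b c" by metis
    then show "\<exists>\<alpha>. \<alpha> \<in> gen_cu_mor ?X Q \<and> (\<forall>a\<in>carrier S. \<forall>b\<in>carrier T. \<alpha> (?\<tau> a b) = \<phi> a b c)"
      by blast
  qed
  then obtain \<alpha> where \<alpha>: "\<And>c. c \<in> carrier P \<Longrightarrow> \<alpha> c \<in> gen_cu_mor ?X Q"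
    "\<And>a b c. c \<in> carrier P \<Longrightarrow> a \<in> carrier S \<Longrightarrow> b \<in> carrier T \<Longrightarrow> \<alpha> c (?\<tau> a b) = \<phi> a b c"
    by metis
  have r: "(\<lambda>c\<in>carrier P. \<phi> a b c) \<in> gen_cu_mor P Q" if "a \<in> carrier S" "b \<in> carrier T" for a b
    using \<phi> that by (simp add: cu_trimorphism_def)
  note R = restrict_gen_cu_morD[OF cu(3) r]
  note acl = gen_cu_mor_closed[OF \<alpha>(1)]
  have mono: "\<alpha> c u \<preceq>\<^bsub>Q\<^esub> \<alpha> d u"
    if "c \<in> carrier P" "d \<in> carrier P" "c \<preceq>\<^bsub>P\<^esub> d" "u \<in> carrier ?X" for c d u
    by (rule ST.tensor_leqI[OF cu(4) \<alpha>(1) \<alpha>(1)]) (use that R(4) \<alpha>(2) in simp_all)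
  have bim: "gen_cu_bimorphism ?X P Q (\<lambda>u c. \<alpha> c u)"
    unfolding gen_cu_bimorphism_def
  proof (intro conjI ballI)
    fix c assume c: "c \<in> carrier P"
    have "(\<lambda>u\<in>carrier ?X. \<alpha> c u) = \<alpha> c"
      using gen_cu_mor_extensional[OF \<alpha>(1)[OF c]] by (rule extensional_restrict)
    then show "(\<lambda>u\<in>carrier ?X. \<alpha> c u) \<in> gen_cu_mor ?X Q" using \<alpha>(1)[OF c] by simp
  next
    fix u assume u: "u \<in> carrier ?X"
    show "(\<lambda>c\<in>carrier P. \<alpha> c u) \<in> gen_cu_mor P Q"
    proof (rule gen_cu_morI[OF cu(3,4)])
      show "(\<lambda>c\<in>carrier P. \<alpha> c u) \<in> carrier P \<rightarrow>\<^sub>E carrier Q" using acl u by auto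
      show "(\<lambda>c\<in>carrier P. \<alpha> c u) (c \<oplus>\<^bsub>P\<^esub> d) =
          (\<lambda>c\<in>carrier P. \<alpha> c u) c \<oplus>\<^bsub>Q\<^esub> (\<lambda>c\<in>carrier P. \<alpha> c u) d"
        if cd: "c \<in> carrier P" "d \<in> carrier P" for c d
      proof -
        have "\<alpha> (c \<oplus>\<^bsub>P\<^esub> d) = (\<lambda>u\<in>carrier ?X. \<alpha> c u \<oplus>\<^bsub>Q\<^esub> \<alpha> d u)"
          by (rule ST.tensor_eqI[OF cu(4) \<alpha>(1) gen_cu_mor_plus[OF X cu(4) \<alpha>(1) \<alpha>(1)]])
            (use cd \<alpha>(2) R(2) \<tau> in simp_all)
        then show ?thesis using cd u by simp
      qed
      show "(\<lambda>c\<in>carrier P. \<alpha> c u) \<zero>\<^bsub>P\<^esub> = \<zero>\<^bsub>Q\<^esub>"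
      proof -
        have "\<alpha> \<zero>\<^bsub>P\<^esub> = (\<lambda>u\<in>carrier ?X. \<zero>\<^bsub>Q\<^esub>)"
          by (rule ST.tensor_eqI[OF cu(4) \<alpha>(1) gen_cu_mor_const_zero[OF X cu(4)]])
            (use \<alpha>(2) R(3) \<tau> in simp_all)
        then show ?thesis using u by simp
      qed
      show "(\<lambda>c\<in>carrier P. \<alpha> c u) c \<preceq>\<^bsub>Q\<^esub> (\<lambda>c\<in>carrier P. \<alpha> c u) d"
        if "c \<in> carrier P" "d \<in> carrier P" "c \<preceq>\<^bsub>P\<^esub> d" for c d
        using mono that u by simp
    next
      fix c s w assume c: "increasing_seq P c" "is_supremum P (range c) s" and w: "w \<in> carrier Q"
        and le: "\<And>n. (\<lambda>c\<in>carrier P. \<alpha> c u) (c n) \<preceq>\<^bsub>Q\<^esub> w"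
      have cc: "c n \<in> carrier P" for n using P.increasing_seq_carrier[OF c(1)] .
      have s: "s \<in> carrier P" using P.is_supremum_carrier[OF c(2)] .
      \<comment> \<open>The pointwise supremum of the \<open>\<alpha> (c k)\<close> is the candidate
        for \<open>\<alpha> s\<close>; both are generalized morphisms, so agreement at pure tensors
        is enough.\<close>
      define \<gamma> where "\<gamma> = (\<lambda>u\<in>carrier ?X. supremum Q (range (\<lambda>k. \<alpha> (c k) u)))"
      have inc: "increasing_seq Q (\<lambda>k. \<alpha> (c k) v)" if "v \<in> carrier ?X" for v
        using mono c(1) acl that by (simp add: increasing_seq_def)
      have sup: "is_supremum Q (range (\<lambda>k. \<alpha> (c k) v)) (\<gamma> v)" if "v \<in> carrier ?X" for v
        using Q.is_supremum_supremum[OF inc[OF that]] that by (simp add: \<gamma>_def)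
      have "\<gamma> \<in> gen_cu_mor ?X Q"
        by (rule gen_cu_mor_pointwise_supremum[OF X cu(4) \<alpha>(1)[OF cc] _ _ sup])
          (use inc in \<open>auto simp: increasing_seq_def \<gamma>_def extensional_def\<close>)
      then have "\<alpha> s = \<gamma>"
      proof (rule ST.tensor_eqI[OF cu(4) \<alpha>(1)[OF s]])
        fix a b assume ab: "a \<in> carrier S" "b \<in> carrier T"
        have "is_supremum Q (range (\<lambda>k. \<alpha> (c k) (?\<tau> a b))) (\<alpha> s (?\<tau> a b))"
          using restrict_gen_cu_mor_supremum[OF cu(3,4) r[OF ab] c] \<alpha>(2) cc s ab by simp
        then show "\<alpha> s (?\<tau> a b) = \<gamma> (?\<tau> a b)" using Q.is_supremum_unique sup[OF \<tau>[OF ab]] by blast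
      qed
      then show "(\<lambda>c\<in>carrier P. \<alpha> c u) s \<preceq>\<^bsub>Q\<^esub> w"
        using Q.is_supremum_least[OF sup[OF u] w] le cc s by simp
    qed
  qed
  have "cu_bimorphism ?X P Q (\<lambda>u c. \<alpha> c u)"
  proof (rule cu_bimorphismI[OF X cu(3,4) bim])
    fix u u' c c' assume u: "u \<in> carrier ?X" "u' \<in> carrier ?X" "u' \<lless>\<^bsub>?X\<^esub> u"
      and c: "c \<in> carrier P" "c' \<in> carrier P" "c' \<lless>\<^bsub>P\<^esub> c"
    \<comment> \<open>\<open>u'\<close> and \<open>u\<close> are replaced by finite sums whose terms
      are related by \<open>\<lless>\<close> one by one, where the joint condition of the
      trimorphism applies.\<close>
    obtain g' g where g: "ST.formal_wb g' g" "u' \<preceq>\<^bsub>?X\<^esub> bisum ?X ?\<tau> g'" "bisum ?X ?\<tau> g \<preceq>\<^bsub>?X\<^esub> u"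
      using ST.tensor_way_below_split[OF u(2,1,3)] .
    have gf: "set g' \<subseteq> carrier S \<times> carrier T" "set g \<subseteq> carrier S \<times> carrier T"
      using ST.formal_wb_formal[OF g(1)] by (simp_all add: ST.formal_def)
    have cl: "bisum ?X ?\<tau> g' \<in> carrier ?X" "bisum ?X ?\<tau> g \<in> carrier ?X"
      using bisum_closed[of ?X "carrier S" "carrier T" ?\<tau>, OF X \<tau>] gf by auto
    have eq: "\<alpha> d (bisum ?X ?\<tau> h) = bisum Q (\<lambda>a b. \<phi> a b d) h"
      if "d \<in> carrier P" "set h \<subseteq> carrier S \<times> carrier T" for d h
    proof -
      have "\<alpha> d (bisum ?X ?\<tau> h) = bisum Q (\<lambda>a b. \<alpha> d (?\<tau> a b)) h"
        by (rule gen_cu_mor_bisum[OF X \<alpha>(1)[OF that(1)] \<tau> that(2)])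
      also have "\<dots> = bisum Q (\<lambda>a b. \<phi> a b d) h"
        using that \<alpha>(2)[OF that(1)] by (intro bisum_cong) auto
      finally show ?thesis .
    qed
    have "bisum Q (\<lambda>a b. \<phi> a b c') g' \<lless>\<^bsub>Q\<^esub> bisum Q (\<lambda>a b. \<phi> a b c) g"
      by (rule ST.formal_wb_bisum[OF cu(4) _ _ _ g(1)])
        (use \<phi> c R(1) in \<open>simp_all add: cu_trimorphism_def\<close>)
    then have mid: "\<alpha> c' (bisum ?X ?\<tau> g') \<lless>\<^bsub>Q\<^esub> \<alpha> c (bisum ?X ?\<tau> g)" using eq c gf by simp
    have "\<alpha> c' u' \<lless>\<^bsub>Q\<^esub> \<alpha> c (bisum ?X ?\<tau> g)"
      by (rule Q.leq_way_below_trans[OF gen_cu_mor_mono[OF \<alpha>(1)] mid]) (use c u cl g acl in simp_all)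
    then show "\<alpha> c' u' \<lless>\<^bsub>Q\<^esub> \<alpha> c u"
      by (rule Q.way_below_leq_trans[OF _ gen_cu_mor_mono[OF \<alpha>(1)]]) (use c u cl g acl in simp_all)
  qed
  then show ?thesis by (rule that) (rule \<alpha>(2))
qed

section \<open>Uniqueness of maps out of triple tensor products\<close>

lemma triple_eq_left:
  assumes cu: "cu_semigroup S" "cu_semigroup T" "cu_semigroup P" "cu_semigroup Q"
    and fg: "f \<in> gen_cu_mor ((S \<otimes>\<^sub>C\<^sub>u T) \<otimes>\<^sub>C\<^sub>u P) Q" "g \<in> gen_cu_mor ((S \<otimes>\<^sub>C\<^sub>u T) \<otimes>\<^sub>C\<^sub>u P) Q"
    and eq: "\<And>a b c. a \<in> carrier S \<Longrightarrow> b \<in> carrier T \<Longrightarrow> c \<in> carrier P \<Longrightarrow>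
      f (pure_tensor (S \<otimes>\<^sub>C\<^sub>u T) P (pure_tensor S T a b) c) =
      g (pure_tensor (S \<otimes>\<^sub>C\<^sub>u T) P (pure_tensor S T a b) c)"
  shows "f = g"
proof (rule cu_pair.tensor_eqI[OF cu_pair.intro[OF cu_tensor[OF cu(1,2)] cu(3)] cu(4) fg])
  fix u c assume u: "u \<in> carrier (S \<otimes>\<^sub>C\<^sub>u T)" and c: "c \<in> carrier P"
  let ?\<tau> = "pure_tensor (S \<otimes>\<^sub>C\<^sub>u T) P"
  note X = cu_tensor[OF cu(1,2)]
  note XP = cu_tensor[OF X cu(3)]
  have bi: "gen_cu_bimorphism (S \<otimes>\<^sub>C\<^sub>u T) P Q (\<lambda>u c. h (?\<tau> u c))"
    if "h \<in> gen_cu_mor ((S \<otimes>\<^sub>C\<^sub>u T) \<otimes>\<^sub>C\<^sub>u P) Q" for h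
    using gen_cu_bimorphism_compose[OF X cu(3) XP cu(4)
        cu_bimorphism_gen[OF X cu(3) XP pure_bimorphism[OF X cu(3)]] that] .
  \<comment> \<open>For fixed \<open>c\<close> both sides are generalized morphisms in
    \<open>u\<close>, so pure tensors of the inner product decide.\<close>
  have "(\<lambda>u\<in>carrier (S \<otimes>\<^sub>C\<^sub>u T). f (?\<tau> u c)) = (\<lambda>u\<in>carrier (S \<otimes>\<^sub>C\<^sub>u T). g (?\<tau> u c))"
    by (rule cu_pair.tensor_eqI[OF cu_pair.intro[OF cu(1,2)] cu(4)])
      (use gen_cu_bimorphism_left[OF bi[OF fg(1)] c] gen_cu_bimorphism_left[OF bi[OF fg(2)] c]
        eq c pure_closed[OF cu(1,2)] in simp_all)
  from fun_cong[OF this, of u] u show "f (?\<tau> u c) = g (?\<tau> u c)" by simp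
qed

lemma triple_eq_right:
  assumes cu: "cu_semigroup S" "cu_semigroup T" "cu_semigroup P" "cu_semigroup Q"
    and fg: "f \<in> gen_cu_mor (S \<otimes>\<^sub>C\<^sub>u (T \<otimes>\<^sub>C\<^sub>u P)) Q" "g \<in> gen_cu_mor (S \<otimes>\<^sub>C\<^sub>u (T \<otimes>\<^sub>C\<^sub>u P)) Q"
    and eq: "\<And>a b c. a \<in> carrier S \<Longrightarrow> b \<in> carrier T \<Longrightarrow> c \<in> carrier P \<Longrightarrow>
      f (pure_tensor S (T \<otimes>\<^sub>C\<^sub>u P) a (pure_tensor T P b c)) =
      g (pure_tensor S (T \<otimes>\<^sub>C\<^sub>u P) a (pure_tensor T P b c))"
  shows "f = g"
proof (rule cu_pair.tensor_eqI[OF cu_pair.intro[OF cu(1) cu_tensor[OF cu(2,3)]] cu(4) fg])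
  fix a u assume a: "a \<in> carrier S" and u: "u \<in> carrier (T \<otimes>\<^sub>C\<^sub>u P)"
  let ?\<tau> = "pure_tensor S (T \<otimes>\<^sub>C\<^sub>u P)"
  note X = cu_tensor[OF cu(2,3)]
  note SX = cu_tensor[OF cu(1) X]
  have bi: "gen_cu_bimorphism S (T \<otimes>\<^sub>C\<^sub>u P) Q (\<lambda>a u. h (?\<tau> a u))"
    if "h \<in> gen_cu_mor (S \<otimes>\<^sub>C\<^sub>u (T \<otimes>\<^sub>C\<^sub>u P)) Q" for h
    using gen_cu_bimorphism_compose[OF cu(1) X SX cu(4)
        cu_bimorphism_gen[OF cu(1) X SX pure_bimorphism[OF cu(1) X]] that] .
  have "(\<lambda>u\<in>carrier (T \<otimes>\<^sub>C\<^sub>u P). f (?\<tau> a u)) = (\<lambda>u\<in>carrier (T \<otimes>\<^sub>C\<^sub>u P). g (?\<tau> a u))"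
    by (rule cu_pair.tensor_eqI[OF cu_pair.intro[OF cu(2,3)] cu(4)])
      (use gen_cu_bimorphism_right[OF bi[OF fg(1)] a] gen_cu_bimorphism_right[OF bi[OF fg(2)] a]
        eq a pure_closed[OF cu(2,3)] in simp_all)
  from fun_cong[OF this, of u] u show "f (?\<tau> a u) = g (?\<tau> a u)" by simp
qed

section \<open>Induced maps, flip and associator\<close>

lemma cu_bimorphism_precompose_left:
  assumes cu: "cu_semigroup A" "cu_semigroup S" "cu_semigroup T" "cu_semigroup Q"
    and f: "cu_bimorphism S T Q f" and \<alpha>: "\<alpha> \<in> cu_mor A S"
  shows "cu_bimorphism A T Q (\<lambda>a. f (\<alpha> a))"
proof -
  note cl = gen_cu_mor_closed[OF cu_mor_gen[OF \<alpha>]]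
  note gf = cu_bimorphism_gen[OF cu(2-4) f]
  have r: "(\<lambda>a\<in>carrier A. \<alpha> a) \<in> gen_cu_mor A S"
    using extensional_restrict[OF gen_cu_mor_extensional] cu_mor_gen[OF \<alpha>] by metis
  have "gen_cu_bimorphism A T Q (\<lambda>a. f (\<alpha> a))"
    unfolding gen_cu_bimorphism_def
    using restrict_compose_gen_cu_mor[OF cu(1,2,4) r gen_cu_bimorphism_left[OF gf]]
      gen_cu_bimorphism_right[OF gf cl] by blast
  then show ?thesis
    by (rule cu_bimorphismI[OF cu(1,3,4)])
      (intro cu_bimorphism_way_below[OF f] cu_mor_way_below[OF \<alpha>] cl)
qed

lemma cu_bimorphism_precompose:
  assumes cu: "cu_semigroup S\<^sub>1" "cu_semigroup S\<^sub>2" "cu_semigroup T\<^sub>1" "cu_semigroup T\<^sub>2" "cu_semigroup Q"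
    and f: "cu_bimorphism T\<^sub>1 T\<^sub>2 Q f" and \<phi>: "\<phi>\<^sub>1 \<in> cu_mor S\<^sub>1 T\<^sub>1" "\<phi>\<^sub>2 \<in> cu_mor S\<^sub>2 T\<^sub>2"
  shows "cu_bimorphism S\<^sub>1 S\<^sub>2 Q (\<lambda>a b. f (\<phi>\<^sub>1 a) (\<phi>\<^sub>2 b))"
  using cu_bimorphism_swap[OF cu(2,1,5) cu_bimorphism_precompose_left[OF cu(2,4,1,5)
        cu_bimorphism_swap[OF cu(1,4,5) cu_bimorphism_precompose_left[OF cu(1,3,4,5) f \<phi>(1)]] \<phi>(2)]] .

lemma tensor_mor_spec:
  assumes cu: "cu_semigroup S\<^sub>1" "cu_semigroup S\<^sub>2" "cu_semigroup T\<^sub>1" "cu_semigroup T\<^sub>2"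
    and \<phi>: "\<phi>\<^sub>1 \<in> cu_mor S\<^sub>1 T\<^sub>1" "\<phi>\<^sub>2 \<in> cu_mor S\<^sub>2 T\<^sub>2"
  shows "tensor_mor S\<^sub>1 S\<^sub>2 T\<^sub>1 T\<^sub>2 \<phi>\<^sub>1 \<phi>\<^sub>2 \<in> cu_mor (S\<^sub>1 \<otimes>\<^sub>C\<^sub>u S\<^sub>2) (T\<^sub>1 \<otimes>\<^sub>C\<^sub>u T\<^sub>2)"
    "a \<in> carrier S\<^sub>1 \<Longrightarrow> b \<in> carrier S\<^sub>2 \<Longrightarrow>
      tensor_mor S\<^sub>1 S\<^sub>2 T\<^sub>1 T\<^sub>2 \<phi>\<^sub>1 \<phi>\<^sub>2 (pure_tensor S\<^sub>1 S\<^sub>2 a b) = pure_tensor T\<^sub>1 T\<^sub>2 (\<phi>\<^sub>1 a) (\<phi>\<^sub>2 b)"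
proof -
  note T = cu_tensor[OF cu(3,4)]
  note * = theI'[OF cu_pair.tensor_mor_ex1[OF cu_pair.intro[OF cu(1,2)] T
      cu_bimorphism_precompose[OF cu T pure_bimorphism[OF cu(3,4)] \<phi>]], folded tensor_mor_def]
  show "tensor_mor S\<^sub>1 S\<^sub>2 T\<^sub>1 T\<^sub>2 \<phi>\<^sub>1 \<phi>\<^sub>2 \<in> cu_mor (S\<^sub>1 \<otimes>\<^sub>C\<^sub>u S\<^sub>2) (T\<^sub>1 \<otimes>\<^sub>C\<^sub>u T\<^sub>2)"
    "a \<in> carrier S\<^sub>1 \<Longrightarrow> b \<in> carrier S\<^sub>2 \<Longrightarrow>
      tensor_mor S\<^sub>1 S\<^sub>2 T\<^sub>1 T\<^sub>2 \<phi>\<^sub>1 \<phi>\<^sub>2 (pure_tensor S\<^sub>1 S\<^sub>2 a b) = pure_tensor T\<^sub>1 T\<^sub>2 (\<phi>\<^sub>1 a) (\<phi>\<^sub>2 b)"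
    using * by auto
qed

lemma tensor_flip_spec:
  assumes cu: "cu_semigroup S" "cu_semigroup T"
  shows "tensor_flip S T \<in> cu_mor (S \<otimes>\<^sub>C\<^sub>u T) (T \<otimes>\<^sub>C\<^sub>u S)"
    "a \<in> carrier S \<Longrightarrow> b \<in> carrier T \<Longrightarrow> tensor_flip S T (pure_tensor S T a b) = pure_tensor T S b a"
proof -
  note T = cu_tensor[OF cu(2,1)]
  note * = theI'[OF cu_pair.tensor_mor_ex1[OF cu_pair.intro[OF cu] T
      cu_bimorphism_swap[OF cu(2,1) T pure_bimorphism[OF cu(2,1)]]], folded tensor_flip_def]
  show "tensor_flip S T \<in> cu_mor (S \<otimes>\<^sub>C\<^sub>u T) (T \<otimes>\<^sub>C\<^sub>u S)"
    "a \<in> carrier S \<Longrightarrow> b \<in> carrier T \<Longrightarrow> tensor_flip S T (pure_tensor S T a b) = pure_tensor T S b a"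
    using * by auto
qed

lemma tensor_assoc_spec:
  assumes cu: "cu_semigroup S" "cu_semigroup T" "cu_semigroup P"
  shows "tensor_assoc S T P \<in> cu_mor ((S \<otimes>\<^sub>C\<^sub>u T) \<otimes>\<^sub>C\<^sub>u P) (S \<otimes>\<^sub>C\<^sub>u (T \<otimes>\<^sub>C\<^sub>u P))"
    "a \<in> carrier S \<Longrightarrow> b \<in> carrier T \<Longrightarrow> c \<in> carrier P \<Longrightarrow>
      tensor_assoc S T P (pure_tensor (S \<otimes>\<^sub>C\<^sub>u T) P (pure_tensor S T a b) c)
        = pure_tensor S (T \<otimes>\<^sub>C\<^sub>u P) a (pure_tensor T P b c)"
proof -
  let ?L = "(S \<otimes>\<^sub>C\<^sub>u T) \<otimes>\<^sub>C\<^sub>u P" and ?R = "S \<otimes>\<^sub>C\<^sub>u (T \<otimes>\<^sub>C\<^sub>u P)"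
  let ?l = "\<lambda>a b c. pure_tensor (S \<otimes>\<^sub>C\<^sub>u T) P (pure_tensor S T a b) c"
    and ?r = "\<lambda>a b c. pure_tensor S (T \<otimes>\<^sub>C\<^sub>u P) a (pure_tensor T P b c)"
  note ST = cu_tensor[OF cu(1,2)] and TP = cu_tensor[OF cu(2,3)]
  note R = cu_tensor[OF cu(1) TP]
  obtain \<psi> where \<psi>: "cu_bimorphism (S \<otimes>\<^sub>C\<^sub>u T) P ?R \<psi>"
    "\<And>a b c. a \<in> carrier S \<Longrightarrow> b \<in> carrier T \<Longrightarrow> c \<in> carrier P \<Longrightarrow> \<psi> (pure_tensor S T a b) c = ?r a b c"
    using cu_trimorphism_extend[OF cu R cu_trimorphism_nested[OF cu TP R
          pure_bimorphism[OF cu(2,3)] pure_bimorphism[OF cu(1) TP]]] by metis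
  obtain \<alpha> where \<alpha>: "\<alpha> \<in> cu_mor ?L ?R"
    "\<And>u c. u \<in> carrier (S \<otimes>\<^sub>C\<^sub>u T) \<Longrightarrow> c \<in> carrier P \<Longrightarrow> \<alpha> (pure_tensor (S \<otimes>\<^sub>C\<^sub>u T) P u c) = \<psi> u c"
    using cu_pair.tensor_mor_ex1[OF cu_pair.intro[OF ST cu(3)] R \<psi>(1)] by blast
  have val: "\<alpha> (?l a b c) = ?r a b c" if "a \<in> carrier S" "b \<in> carrier T" "c \<in> carrier P" for a b c
    using \<alpha>(2) \<psi>(2) pure_closed[OF cu(1,2)] that by simp
  have "\<exists>!\<alpha>. \<alpha> \<in> cu_mor ?L ?R \<and>
      (\<forall>a\<in>carrier S. \<forall>b\<in>carrier T. \<forall>c\<in>carrier P. \<alpha> (?l a b c) = ?r a b c)"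
  proof (rule ex1I[of _ \<alpha>])
    fix \<beta> assume \<beta>: "\<beta> \<in> cu_mor ?L ?R \<and>
      (\<forall>a\<in>carrier S. \<forall>b\<in>carrier T. \<forall>c\<in>carrier P. \<beta> (?l a b c) = ?r a b c)"
    show "\<beta> = \<alpha>"
      by (rule triple_eq_left[OF cu R]) (use \<beta> \<alpha> val in \<open>simp_all add: cu_mor_gen\<close>)
  qed (use \<alpha>(1) val in blast)
  note * = theI'[OF this, folded tensor_assoc_def]
  show "tensor_assoc S T P \<in> cu_mor ?L ?R"
    "a \<in> carrier S \<Longrightarrow> b \<in> carrier T \<Longrightarrow> c \<in> carrier P \<Longrightarrow> tensor_assoc S T P (?l a b c) = ?r a b c"
    using * by auto
qed

text \<open>\<open>cu_trimorphism_extend\<close> always joins the first two variables. Rotation puts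
  \<open>b\<close> and \<open>c\<close> in front, and the resulting bimorphism, with the joined
  variable first and \<open>a\<close> second, is swapped at the end.\<close>

lemma tensor_assoc_inverse:
  assumes cu: "cu_semigroup S" "cu_semigroup T" "cu_semigroup P"
  obtains \<beta> where "\<beta> \<in> cu_mor (S \<otimes>\<^sub>C\<^sub>u (T \<otimes>\<^sub>C\<^sub>u P)) ((S \<otimes>\<^sub>C\<^sub>u T) \<otimes>\<^sub>C\<^sub>u P)"
    "\<And>a b c. a \<in> carrier S \<Longrightarrow> b \<in> carrier T \<Longrightarrow> c \<in> carrier P \<Longrightarrow>
      \<beta> (pure_tensor S (T \<otimes>\<^sub>C\<^sub>u P) a (pure_tensor T P b c)) =
      pure_tensor (S \<otimes>\<^sub>C\<^sub>u T) P (pure_tensor S T a b) c"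
proof -
  let ?L = "(S \<otimes>\<^sub>C\<^sub>u T) \<otimes>\<^sub>C\<^sub>u P" and ?R = "S \<otimes>\<^sub>C\<^sub>u (T \<otimes>\<^sub>C\<^sub>u P)"
  let ?l = "\<lambda>a b c. pure_tensor (S \<otimes>\<^sub>C\<^sub>u T) P (pure_tensor S T a b) c"
  note ST = cu_tensor[OF cu(1,2)] and TP = cu_tensor[OF cu(2,3)]
  note L = cu_tensor[OF ST cu(3)]
  have "cu_trimorphism P S T ?L (\<lambda>c a b. ?l a b c)"
    by (rule cu_trimorphism_nested[OF cu(3,1,2) ST L pure_bimorphism[OF cu(1,2)]
          cu_bimorphism_swap[OF ST cu(3) L pure_bimorphism[OF ST cu(3)]]])
  from cu_trimorphism_rotate[OF cu_trimorphism_rotate[OF this]]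
  have "cu_trimorphism T P S ?L (\<lambda>b c a. ?l a b c)" .
  from cu_trimorphism_extend[OF cu(2,3,1) L this]
  obtain \<psi> where \<psi>: "cu_bimorphism (T \<otimes>\<^sub>C\<^sub>u P) S ?L \<psi>"
    "\<And>a b c. a \<in> carrier S \<Longrightarrow> b \<in> carrier T \<Longrightarrow> c \<in> carrier P \<Longrightarrow> \<psi> (pure_tensor T P b c) a = ?l a b c"
    by metis
  obtain \<beta> where \<beta>: "\<beta> \<in> cu_mor ?R ?L"
    "\<And>a u. a \<in> carrier S \<Longrightarrow> u \<in> carrier (T \<otimes>\<^sub>C\<^sub>u P) \<Longrightarrow> \<beta> (pure_tensor S (T \<otimes>\<^sub>C\<^sub>u P) a u) = \<psi> u a"
    using cu_pair.tensor_mor_ex1[OF cu_pair.intro[OF cu(1) TP] L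
        cu_bimorphism_swap[OF TP cu(1) L \<psi>(1)]] by blast
  show ?thesis by (rule that[OF \<beta>(1)]) (simp add: \<beta>(2) \<psi>(2) pure_closed[OF cu(2,3)])
qed

text \<open>Both composites of the associator with \<open>\<beta>\<close> fix triple pure tensors,
  so they are identities. Hence \<open>inv_into\<close> agrees with \<open>\<beta>\<close> on the
  carrier, and extensionality settles the rest.\<close>

lemma tensor_assoc_inv_spec:
  assumes cu: "cu_semigroup S" "cu_semigroup T" "cu_semigroup P"
  shows "tensor_assoc_inv S T P \<in> cu_mor (S \<otimes>\<^sub>C\<^sub>u (T \<otimes>\<^sub>C\<^sub>u P)) ((S \<otimes>\<^sub>C\<^sub>u T) \<otimes>\<^sub>C\<^sub>u P)"
    "a \<in> carrier S \<Longrightarrow> b \<in> carrier T \<Longrightarrow> c \<in> carrier P \<Longrightarrow>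
      tensor_assoc_inv S T P (pure_tensor S (T \<otimes>\<^sub>C\<^sub>u P) a (pure_tensor T P b c))
        = pure_tensor (S \<otimes>\<^sub>C\<^sub>u T) P (pure_tensor S T a b) c"
proof -
  let ?L = "(S \<otimes>\<^sub>C\<^sub>u T) \<otimes>\<^sub>C\<^sub>u P" and ?R = "S \<otimes>\<^sub>C\<^sub>u (T \<otimes>\<^sub>C\<^sub>u P)" and ?\<alpha> = "tensor_assoc S T P"
  note ST = cu_tensor[OF cu(1,2)] and TP = cu_tensor[OF cu(2,3)]
  note L = cu_tensor[OF ST cu(3)] and R = cu_tensor[OF cu(1) TP]
  note \<alpha> = tensor_assoc_spec[OF cu]
  obtain \<beta> where \<beta>: "\<beta> \<in> cu_mor ?R ?L"
    "\<And>a b c. a \<in> carrier S \<Longrightarrow> b \<in> carrier T \<Longrightarrow> c \<in> carrier P \<Longrightarrow>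
      \<beta> (pure_tensor S (T \<otimes>\<^sub>C\<^sub>u P) a (pure_tensor T P b c)) =
      pure_tensor (S \<otimes>\<^sub>C\<^sub>u T) P (pure_tensor S T a b) c"
    using tensor_assoc_inverse[OF cu] by metis
  note cl = pure_closed[OF cu(1,2)] pure_closed[OF ST cu(3)] pure_closed[OF cu(2,3)] pure_closed[OF cu(1) TP]
  have "compose (carrier ?L) \<beta> ?\<alpha> = cu_id ?L"
    by (rule triple_eq_left[OF cu L])
      (use cu_mor_compose[OF L R L \<alpha>(1) \<beta>(1)] cu_id_mor[OF L] cl \<alpha>(2) \<beta>(2) in
        \<open>simp_all add: cu_mor_gen compose_def cu_id_def\<close>)
  then have 1: "\<beta> (?\<alpha> u) = u" if "u \<in> carrier ?L" for u
    using that by (simp add: compose_def cu_id_def fun_eq_iff restrict_def) metis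
  have "compose (carrier ?R) ?\<alpha> \<beta> = cu_id ?R"
    by (rule triple_eq_right[OF cu R])
      (use cu_mor_compose[OF R L R \<beta>(1) \<alpha>(1)] cu_id_mor[OF R] cl \<alpha>(2) \<beta>(2) in
        \<open>simp_all add: cu_mor_gen compose_def cu_id_def\<close>)
  then have 2: "?\<alpha> (\<beta> u) = u" if "u \<in> carrier ?R" for u
    using that by (simp add: compose_def cu_id_def fun_eq_iff restrict_def) metis
  have inj: "inj_on ?\<alpha> (carrier ?L)" using 1 by (rule inj_on_inverseI)
  have "inv_into (carrier ?L) ?\<alpha> v = \<beta> v" if "v \<in> carrier ?R" for v
    using inv_into_f_f[OF inj gen_cu_mor_closed[OF cu_mor_gen[OF \<beta>(1)] that]] 2[OF that] by simp
  then have "tensor_assoc_inv S T P = restrict \<beta> (carrier ?R)"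
    by (simp add: tensor_assoc_inv_def restrict_def fun_eq_iff)
  also have "\<dots> = \<beta>" using extensional_restrict gen_cu_mor_extensional cu_mor_gen \<beta>(1) by metis
  finally have eq: "tensor_assoc_inv S T P = \<beta>" .
  show "tensor_assoc_inv S T P \<in> cu_mor ?R ?L"
    "a \<in> carrier S \<Longrightarrow> b \<in> carrier T \<Longrightarrow> c \<in> carrier P \<Longrightarrow>
      tensor_assoc_inv S T P (pure_tensor S (T \<otimes>\<^sub>C\<^sub>u P) a (pure_tensor T P b c))
        = pure_tensor (S \<otimes>\<^sub>C\<^sub>u T) P (pure_tensor S T a b) c"
    using \<beta> eq by auto
qed

lemma cu_id_apply: "a \<in> carrier S \<Longrightarrow> cu_id S a = a"
  by (simp add: cu_id_def)

lemma restrict_cu_mor_compose: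
  assumes "cu_semigroup S" "cu_semigroup T" "cu_semigroup P"
    "(\<lambda>a\<in>carrier S. f a) \<in> cu_mor S T" "g \<in> cu_mor T P"
  shows "(\<lambda>a\<in>carrier S. g (f a)) \<in> cu_mor S P"
proof -
  have "compose (carrier S) g (\<lambda>a\<in>carrier S. f a) = (\<lambda>a\<in>carrier S. g (f a))"
    by (auto simp: compose_def)
  then show ?thesis using cu_mor_compose[OF assms] by simp
qed

lemma middle_flip_spec:
  assumes cu: "cu_semigroup A" "cu_semigroup B" "cu_semigroup C" "cu_semigroup D"
  shows "middle_flip A B C D \<in> cu_mor ((A \<otimes>\<^sub>C\<^sub>u B) \<otimes>\<^sub>C\<^sub>u (C \<otimes>\<^sub>C\<^sub>u D)) ((A \<otimes>\<^sub>C\<^sub>u C) \<otimes>\<^sub>C\<^sub>u (B \<otimes>\<^sub>C\<^sub>u D))"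
    "a \<in> carrier A \<Longrightarrow> b \<in> carrier B \<Longrightarrow> c \<in> carrier C \<Longrightarrow> d \<in> carrier D \<Longrightarrow>
      middle_flip A B C D
        (pure_tensor (A \<otimes>\<^sub>C\<^sub>u B) (C \<otimes>\<^sub>C\<^sub>u D) (pure_tensor A B a b) (pure_tensor C D c d)) =
      pure_tensor (A \<otimes>\<^sub>C\<^sub>u C) (B \<otimes>\<^sub>C\<^sub>u D) (pure_tensor A C a c) (pure_tensor B D b d)"
proof -
  note AB = cu_tensor[OF cu(1,2)] and CD = cu_tensor[OF cu(3,4)] and BD = cu_tensor[OF cu(2,4)]
    and BC = cu_tensor[OF cu(2,3)] and CB = cu_tensor[OF cu(3,2)] and AC = cu_tensor[OF cu(1,3)]
  note X1 = cu_tensor[OF cu(2) CD] and X2 = cu_tensor[OF BC cu(4)] and X3 = cu_tensor[OF CB cu(4)]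
    and X4 = cu_tensor[OF cu(3) BD]
  note Y0 = cu_tensor[OF AB CD] and Y1 = cu_tensor[OF cu(1) X1] and Y2 = cu_tensor[OF cu(1) X2]
    and Y3 = cu_tensor[OF cu(1) X3] and Y4 = cu_tensor[OF cu(1) X4] and Y5 = cu_tensor[OF AC BD]
  note idA = cu_id_mor[OF cu(1)] and idD = cu_id_mor[OF cu(4)]
  note m1 = tensor_assoc_spec[OF cu(1,2) CD]
    and m2 = tensor_mor_spec[OF cu(1) X1 cu(1) X2 idA tensor_assoc_inv_spec(1)[OF cu(2-4)]]
    and fl = tensor_mor_spec[OF BC cu(4) CB cu(4) tensor_flip_spec(1)[OF cu(2,3)] idD]
  note m3 = tensor_mor_spec[OF cu(1) X2 cu(1) X3 idA fl(1)]
    and m4 = tensor_mor_spec[OF cu(1) X3 cu(1) X4 idA tensor_assoc_spec(1)[OF cu(3,2,4)]]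
    and m5 = tensor_assoc_inv_spec[OF cu(1,3) BD]
  \<comment> \<open>\<open>middle_flip\<close> is one restriction of a nested application instead of
    an iterated \<open>compose\<close>, so the innermost map is brought into restricted form and the
    others are added outwards.\<close>
  have m1': "(\<lambda>u\<in>carrier ((A \<otimes>\<^sub>C\<^sub>u B) \<otimes>\<^sub>C\<^sub>u (C \<otimes>\<^sub>C\<^sub>u D)). tensor_assoc A B (C \<otimes>\<^sub>C\<^sub>u D) u)
      \<in> cu_mor ((A \<otimes>\<^sub>C\<^sub>u B) \<otimes>\<^sub>C\<^sub>u (C \<otimes>\<^sub>C\<^sub>u D)) (A \<otimes>\<^sub>C\<^sub>u (B \<otimes>\<^sub>C\<^sub>u (C \<otimes>\<^sub>C\<^sub>u D)))"
    using m1(1) extensional_restrict[OF gen_cu_mor_extensional[OF cu_mor_gen[OF m1(1)]]] by simp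
  show "middle_flip A B C D \<in> cu_mor ((A \<otimes>\<^sub>C\<^sub>u B) \<otimes>\<^sub>C\<^sub>u (C \<otimes>\<^sub>C\<^sub>u D)) ((A \<otimes>\<^sub>C\<^sub>u C) \<otimes>\<^sub>C\<^sub>u (B \<otimes>\<^sub>C\<^sub>u D))"
    unfolding middle_flip_def
    by (rule restrict_cu_mor_compose[OF Y0 Y4 Y5 restrict_cu_mor_compose[OF Y0 Y3 Y4
          restrict_cu_mor_compose[OF Y0 Y2 Y3 restrict_cu_mor_compose[OF Y0 Y1 Y2 m1' m2(1)] m3(1)]
          m4(1)] m5(1)])
  assume abcd: "a \<in> carrier A" "b \<in> carrier B" "c \<in> carrier C" "d \<in> carrier D"
  note cl = pure_closed[OF cu(1,2)] pure_closed[OF cu(3,4)] pure_closed[OF AB CD]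
    pure_closed[OF cu(2) CD] pure_closed[OF cu(2,3)] pure_closed[OF BC cu(4)]
    pure_closed[OF cu(3,2)] pure_closed[OF CB cu(4)] pure_closed[OF cu(2,4)] pure_closed[OF cu(3) BD]
  show "middle_flip A B C D
        (pure_tensor (A \<otimes>\<^sub>C\<^sub>u B) (C \<otimes>\<^sub>C\<^sub>u D) (pure_tensor A B a b) (pure_tensor C D c d)) =
      pure_tensor (A \<otimes>\<^sub>C\<^sub>u C) (B \<otimes>\<^sub>C\<^sub>u D) (pure_tensor A C a c) (pure_tensor B D b d)"
    unfolding middle_flip_def
    by (simp add: abcd cl m1(2) m2(2) m3(2) m4(2) m5(2) fl(2) cu_id_apply
        tensor_assoc_inv_spec(2)[OF cu(2-4)] tensor_flip_spec(2)[OF cu(2,3)]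
        tensor_assoc_spec(2)[OF cu(3,2,4)])
qed

section \<open>Dense chains and transport of structure\<close>

text \<open>The rationals of the unit interval are inserted one after the other; each new value
  interpolates between its two neighbours among the finitely many points treated so far.\<close>

lemma dense_chain_between:
  fixes R :: "'x \<Rightarrow> 'x \<Rightarrow> bool"
  assumes trans: "\<And>x y z. R x y \<Longrightarrow> R y z \<Longrightarrow> R x z"
    and interp: "\<And>x z. R x z \<Longrightarrow> \<exists>y. R x y \<and> R y z"
    and xy: "R x y"
  shows "\<exists>p :: rat \<Rightarrow> 'x. p 0 = x \<and> p 1 = y \<and> (\<forall>s t. 0 \<le> s \<longrightarrow> s < t \<longrightarrow> t \<le> 1 \<longrightarrow> R (p s) (p t))"
proof -
  \<comment> \<open>An enumeration, with repetitions, of the rationals from 0 to 1; codes of other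
    rationals default to 0, a point that is present from the start.\<close>
  define e :: "nat \<Rightarrow> rat" where "e n = (if from_nat n \<in> {0..1::rat} then from_nat n else 0)" for n
  have e01: "0 \<le> e n" "e n \<le> 1" for n by (auto simp: e_def)
  have e_surj: "\<exists>n. e n = r" if "0 \<le> r" "r \<le> 1" for r
    using that by (intro exI[of _ "to_nat r"]) (simp add: e_def)
  define F where "F n = {0, 1} \<union> e ` {..<n}" for n
  have F: "finite (F n)" "0 \<in> F n" "1 \<in> F n" "\<And>r. r \<in> F n \<Longrightarrow> 0 \<le> r \<and> r \<le> 1" for n
    using e01 by (auto simp: F_def)
  have F_Suc: "F (Suc n) = insert (e n) (F n)" for n by (auto simp: F_def lessThan_Suc)
  have F_mono: "F m \<subseteq> F n" if "m \<le> n" for m n using that by (auto simp: F_def)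
  \<comment> \<open>Only the values on the points \<open>F n\<close> treated so far are constrained;
    values elsewhere are placeholders.\<close>
  define ok where "ok n p \<longleftrightarrow> p 0 = x \<and> p 1 = y \<and> (\<forall>s\<in>F n. \<forall>t\<in>F n. s < t \<longrightarrow> R (p s) (p t))"
    for n and p :: "rat \<Rightarrow> 'x"
  have "\<exists>P. \<forall>n. ok n (P n) \<and> (\<forall>s\<in>F n. P (Suc n) s = P n s)"
  proof (rule dependent_nat_choice)
    show "\<exists>p. ok 0 p"
      using xy by (intro exI[of _ "\<lambda>r. if r = 0 then x else y"]) (auto simp: ok_def F_def)
    fix p n assume p: "ok n p"
    show "\<exists>p'. ok (Suc n) p' \<and> (\<forall>s\<in>F n. p' s = p s)"
    proof (cases "e n \<in> F n")
      case True
      then show ?thesis using p by (intro exI[of _ p]) (auto simp: ok_def F_Suc insert_absorb)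
    next
      case False
      define r where "r = e n"
      have r: "0 < r" "r < 1" "r \<notin> F n"
        using False F(2,3)[of n] e01[of n] by (auto simp: r_def less_le)
      \<comment> \<open>\<open>l\<close> and \<open>u\<close> are the neighbours of the new point
        among those already treated; both exist because 0 and 1 belong to
        \<open>F n\<close>.\<close>
      define l where "l = Max {s \<in> F n. s < r}"
      define u where "u = Min {s \<in> F n. r < s}"
      have l: "l \<in> F n" "l < r" "\<And>s. s \<in> F n \<Longrightarrow> s < r \<Longrightarrow> s \<le> l"
      proof -
        have "finite {s \<in> F n. s < r}" "0 \<in> {s \<in> F n. s < r}" using F(1,2)[of n] r by auto
        from Max_in[OF this(1)] Max_ge[OF this(1)] this(2)
        show "l \<in> F n" "l < r" "\<And>s. s \<in> F n \<Longrightarrow> s < r \<Longrightarrow> s \<le> l"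
          unfolding l_def by blast+
      qed
      have u: "u \<in> F n" "r < u" "\<And>s. s \<in> F n \<Longrightarrow> r < s \<Longrightarrow> u \<le> s"
      proof -
        have "finite {s \<in> F n. r < s}" "1 \<in> {s \<in> F n. r < s}" using F(1,3)[of n] r by auto
        from Min_in[OF this(1)] Min_le[OF this(1)] this(2)
        show "u \<in> F n" "r < u" "\<And>s. s \<in> F n \<Longrightarrow> r < s \<Longrightarrow> u \<le> s"
          unfolding u_def by blast+
      qed
      have Rp: "R (p s) (p t)" if "s \<in> F n" "t \<in> F n" "s < t" for s t
        using p that by (auto simp: ok_def)
      obtain z where z: "R (p l) z" "R z (p u)" using interp Rp l u by (meson less_trans)
      have low: "R (p s) z" if "s \<in> F n" "s < r" for s
        using l(3)[OF that] Rp[OF that(1) l(1)] z(1) trans by (cases "s = l") auto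
      have up: "R z (p s)" if "s \<in> F n" "r < s" for s
        using u(3)[OF that] Rp[OF u(1) that(1)] z(2) trans by (cases "s = u") auto
      have "ok (Suc n) (p(r := z))"
        using p r low up Rp unfolding ok_def F_Suc r_def[symmetric] by auto
      then show ?thesis using r(3) by (intro exI[of _ "p(r := z)"]) auto
    qed
  qed
  then obtain P where P: "\<And>n. ok n (P n)" "\<And>n s. s \<in> F n \<Longrightarrow> P (Suc n) s = P n s" by blast
  \<comment> \<open>Later stages keep earlier values, so the final value at a point can be read off
    at any stage that contains it.\<close>
  have stable: "P n s = P m s" if "m \<le> n" "s \<in> F m" for m n s
    using that(1)
  proof (induction rule: dec_induct)
    case (step k)
    then show ?case using P(2)[of s k] F_mono[of m k] that(2) by auto
  qed simp
  have "\<exists>n. r \<in> F n" if "0 \<le> r" "r \<le> 1" for r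
    using e_surj[OF that] by (auto simp: F_def intro!: exI[of _ "Suc _"])
  then obtain N where N: "\<And>r. 0 \<le> r \<Longrightarrow> r \<le> 1 \<Longrightarrow> r \<in> F (N r)" by metis
  show ?thesis
  proof (intro exI[of _ "\<lambda>r. P (N r) r"] conjI allI impI)
    show "P (N 0) 0 = x" "P (N 1) 1 = y" using P(1) by (auto simp: ok_def)
    fix s t :: rat assume st: "0 \<le> s" "s < t" "t \<le> 1"
    let ?m = "max (N s) (N t)"
    have "s \<in> F (N s)" "t \<in> F (N t)" using N st by auto
    then have "P (N s) s = P ?m s" "P (N t) t = P ?m t" "s \<in> F ?m" "t \<in> F ?m"
      using stable[of "N s" ?m s] stable[of "N t" ?m t] F_mono[of "N s" ?m] F_mono[of "N t" ?m] by auto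
    then show "R (P (N s) s) (P (N t) t)" using P(1)[of ?m] st by (auto simp: ok_def)
  qed
qed

text \<open>A chain from \<open>x n\<close> to \<open>x (Suc n)\<close> is laid between
  \<open>n\<close> and \<open>n + 1\<close>, giving a map \<open>g\<close> on the nonnegative
  rationals; \<open>t / (1 - t)\<close> carries the open unit interval onto the positive
  ones.\<close>

lemma dense_chain:
  fixes R :: "'x \<Rightarrow> 'x \<Rightarrow> bool"
  assumes trans: "\<And>x y z. R x y \<Longrightarrow> R y z \<Longrightarrow> R x z"
    and interp: "\<And>x z. R x z \<Longrightarrow> \<exists>y. R x y \<and> R y z"
    and x: "\<And>n. R (x n) (x (Suc n))"
  obtains f :: "rat \<Rightarrow> 'x" where "\<And>s t. s \<in> I\<^sub>Q \<Longrightarrow> t \<in> I\<^sub>Q \<Longrightarrow> s < t \<Longrightarrow> R (f s) (f t)"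
    "\<And>n. \<exists>t\<in>I\<^sub>Q. R (x n) (f t)" "\<And>t. t \<in> I\<^sub>Q \<Longrightarrow> \<exists>n. R (f t) (x n)"
proof -
  have "\<forall>n. \<exists>p :: rat \<Rightarrow> 'x. p 0 = x n \<and> p 1 = x (Suc n) \<and>
      (\<forall>s t. 0 \<le> s \<longrightarrow> s < t \<longrightarrow> t \<le> 1 \<longrightarrow> R (p s) (p t))"
    using dense_chain_between[of R "x _" "x (Suc _)"] trans interp x by blast
  then obtain P :: "nat \<Rightarrow> rat \<Rightarrow> 'x" where P: "\<And>n. P n 0 = x n" "\<And>n. P n 1 = x (Suc n)"
    "\<And>n s t. 0 \<le> s \<Longrightarrow> s < t \<Longrightarrow> t \<le> 1 \<Longrightarrow> R (P n s) (P n t)"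
    by metis
  have xlt: "R (x m) (x n)" if "m < n" for m n
    using that by (induction n) (use x trans in \<open>auto simp: less_Suc_eq\<close>)
  define g where "g u = P (nat \<lfloor>u\<rfloor>) (frac u)" for u :: rat
  have gx: "R (g u) (x (Suc (nat \<lfloor>u\<rfloor>)))" for u
    using P(3)[of "frac u" 1 "nat \<lfloor>u\<rfloor>"] P(2) frac_lt_1[of u] by (simp add: g_def)
  have g_of_nat: "g (of_nat n) = x n" for n
    using P(1) by (simp add: g_def frac_def)
  have g_mono: "R (g s) (g t)" if st: "0 \<le> s" "s < t" for s t
  proof (cases "\<lfloor>s\<rfloor> = \<lfloor>t\<rfloor>")
    case True
    then have "frac s < frac t" using st by (simp add: frac_def)
    then show ?thesis using P(3)[of "frac s" "frac t"] True frac_lt_1[of t] by (simp add: g_def)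
  next
    case False
    then have "\<lfloor>s\<rfloor> < \<lfloor>t\<rfloor>" "0 \<le> \<lfloor>s\<rfloor>" using st floor_mono[of s t] by auto
    then have lt: "Suc (nat \<lfloor>s\<rfloor>) \<le> nat \<lfloor>t\<rfloor>"
      unfolding Suc_le_eq by (subst nat_less_eq_zless)
    have 1: "R (g s) (x (nat \<lfloor>t\<rfloor>))"
    proof (cases "Suc (nat \<lfloor>s\<rfloor>) = nat \<lfloor>t\<rfloor>")
      case True then show ?thesis using gx[of s] by simp
    next
      case False
      then have "R (x (Suc (nat \<lfloor>s\<rfloor>))) (x (nat \<lfloor>t\<rfloor>))" using lt by (intro xlt) simp
      then show ?thesis by (rule trans[OF gx[of s]])
    qed
    show ?thesis
    proof (cases "frac t = 0")
      case True show ?thesis using 1 unfolding g_def[of t] True P(1) .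
    next
      case False
      then have "R (x (nat \<lfloor>t\<rfloor>)) (g t)"
        using P(3)[of 0 "frac t" "nat \<lfloor>t\<rfloor>"] P(1) frac_lt_1[of t] by (simp add: g_def less_le)
      then show ?thesis using 1 trans by blast
    qed
  qed
  show ?thesis
  proof (rule that[of "\<lambda>t. g (t / (1 - t))"])
    show "R (g (s / (1 - s))) (g (t / (1 - t)))" if "s \<in> I\<^sub>Q" "t \<in> I\<^sub>Q" "s < t" for s t
      using that by (intro g_mono) (auto simp: I\<^sub>Q_def field_simps)
    show "\<exists>t\<in>I\<^sub>Q. R (x n) (g (t / (1 - t)))" for n
    proof
      \<comment> \<open>This fraction is the preimage of \<open>n + 1\<close> under
        \<open>t / (1 - t)\<close>, where \<open>g\<close> takes the value
        \<open>x (Suc n)\<close>.\<close>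
      let ?t = "of_nat (Suc n) / of_nat (Suc (Suc n)) :: rat"
      have "?t / (1 - ?t) = of_nat (Suc n)" by (simp add: field_simps)
      then show "R (x n) (g (?t / (1 - ?t)))" using g_of_nat[of "Suc n"] x[of n] by metis
      show "?t \<in> I\<^sub>Q" by (simp add: I\<^sub>Q_def)
    qed
    show "\<exists>n. R (g (t / (1 - t))) (x n)" if "t \<in> I\<^sub>Q" for t using gx by blast
  qed
qed

text \<open>The internal hom consists of classes of paths, not of ideals, so the axioms are moved
  along an additive order isomorphism. Suprema and \<open>\<lless>\<close> depend on the order
  alone, which is why they are transported too.\<close>

lemma cu_semigroup_transport:
  fixes H :: "('a, 'm) posemigroup_scheme" and Q :: "('b, 'n) posemigroup_scheme"
  assumes Q: "cu_semigroup Q" and bij: "bij_betw i (carrier H) (carrier Q)"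
    and closed: "\<And>x y. x \<in> carrier H \<Longrightarrow> y \<in> carrier H \<Longrightarrow> x \<oplus>\<^bsub>H\<^esub> y \<in> carrier H"
    and add: "\<And>x y. x \<in> carrier H \<Longrightarrow> y \<in> carrier H \<Longrightarrow> i (x \<oplus>\<^bsub>H\<^esub> y) = i x \<oplus>\<^bsub>Q\<^esub> i y"
    and zero: "\<zero>\<^bsub>H\<^esub> \<in> carrier H" "i \<zero>\<^bsub>H\<^esub> = \<zero>\<^bsub>Q\<^esub>"
    and leq: "\<And>x y. x \<in> carrier H \<Longrightarrow> y \<in> carrier H \<Longrightarrow> x \<preceq>\<^bsub>H\<^esub> y \<longleftrightarrow> i x \<preceq>\<^bsub>Q\<^esub> i y"
  shows "cu_semigroup H"
    "\<And>A s. A \<subseteq> carrier H \<Longrightarrow> s \<in> carrier H \<Longrightarrow> is_supremum H A s \<longleftrightarrow> is_supremum Q (i ` A) (i s)"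
    "\<And>x y. x \<in> carrier H \<Longrightarrow> y \<in> carrier H \<Longrightarrow> x \<lless>\<^bsub>H\<^esub> y \<longleftrightarrow> i x \<lless>\<^bsub>Q\<^esub> i y"
proof -
  interpret Q: cu_semigroup Q by fact
  have ic: "i x \<in> carrier Q" if "x \<in> carrier H" for x using bij that by (auto simp: bij_betw_def)
  have inj: "i x = i y \<Longrightarrow> x = y" if "x \<in> carrier H" "y \<in> carrier H" for x y
    using bij that by (auto simp: bij_betw_def inj_on_def)
  have onto: "\<exists>x\<in>carrier H. i x = q" if "q \<in> carrier Q" for q
    using bij_betw_imp_surj_on[OF bij] that by (metis imageE)
  have pos: "positively_ordered_semigroup H"
  proof -
    have "comm_monoid H"
    proof (rule comm_monoidI)
      show "x \<oplus>\<^bsub>H\<^esub> y \<oplus>\<^bsub>H\<^esub> z = x \<oplus>\<^bsub>H\<^esub> (y \<oplus>\<^bsub>H\<^esub> z)"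
        if "x \<in> carrier H" "y \<in> carrier H" "z \<in> carrier H" for x y z
        using that by (intro inj) (simp_all add: closed add ic Q.m_assoc)
      show "\<zero>\<^bsub>H\<^esub> \<oplus>\<^bsub>H\<^esub> x = x" if "x \<in> carrier H" for x
        using that by (intro inj) (simp_all add: closed add ic zero)
      show "x \<oplus>\<^bsub>H\<^esub> y = y \<oplus>\<^bsub>H\<^esub> x" if "x \<in> carrier H" "y \<in> carrier H" for x y
        using that by (intro inj) (simp_all add: closed add ic Q.m_comm)
    qed (simp_all add: closed zero)
    then interpret H: comm_monoid H .
    show ?thesis
    proof
      show "x = y" if "x \<in> carrier H" "y \<in> carrier H" "x \<preceq>\<^bsub>H\<^esub> y" "y \<preceq>\<^bsub>H\<^esub> x" for x y
        using that inj leq Q.leq_antisym ic by simp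
      show "x \<preceq>\<^bsub>H\<^esub> z" if "x \<in> carrier H" "y \<in> carrier H" "z \<in> carrier H" "x \<preceq>\<^bsub>H\<^esub> y" "y \<preceq>\<^bsub>H\<^esub> z" for x y z
        using that leq Q.leq_trans[of "i x" "i y" "i z"] ic by simp
    qed (simp_all add: leq add zero ic closed Q.leq_refl Q.add_mono Q.zero_leq)
  qed
  interpret H: positively_ordered_semigroup H by (rule pos)
  show sup: "is_supremum H A s \<longleftrightarrow> is_supremum Q (i ` A) (i s)"
    if "A \<subseteq> carrier H" "s \<in> carrier H" for A s
  proof -
    have A: "a \<in> carrier H" if "a \<in> A" for a using that \<open>A \<subseteq> carrier H\<close> by blast
    have "(\<forall>u\<in>carrier Q. (\<forall>a\<in>A. i a \<preceq>\<^bsub>Q\<^esub> u) \<longrightarrow> i s \<preceq>\<^bsub>Q\<^esub> u) \<longleftrightarrow>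
      (\<forall>u\<in>carrier H. (\<forall>a\<in>A. i a \<preceq>\<^bsub>Q\<^esub> i u) \<longrightarrow> i s \<preceq>\<^bsub>Q\<^esub> i u)"
      by (simp flip: bij_betw_imp_surj_on[OF bij])
    then show ?thesis using that A by (simp add: is_supremum_def leq ic)
  qed
  have inc: "increasing_seq H c \<longleftrightarrow> increasing_seq Q (\<lambda>n. i (c n))" if "\<And>n. c n \<in> carrier H" for c
    using that by (simp add: increasing_seq_def leq ic)
  have supr: "is_supremum H (range c) s \<longleftrightarrow> is_supremum Q (range (\<lambda>n. i (c n))) (i s)"
    if "\<And>n. c n \<in> carrier H" "s \<in> carrier H" for c :: "nat \<Rightarrow> 'a" and s
    using sup[of "range c" s] that by (auto simp: image_image)
  have lift: "\<exists>c. (\<forall>n. c n \<in> carrier H) \<and> d = (\<lambda>n. i (c n))" if "\<And>n. d n \<in> carrier Q" for d :: "nat \<Rightarrow> 'b"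
    using that onto by (intro exI[of _ "\<lambda>n. inv_into (carrier H) i (d n)"])
      (metis bij bij_betw_def f_inv_into_f inv_into_into)
  show wb: "x \<lless>\<^bsub>H\<^esub> y \<longleftrightarrow> i x \<lless>\<^bsub>Q\<^esub> i y" if xy: "x \<in> carrier H" "y \<in> carrier H" for x y
  proof
    assume wb: "x \<lless>\<^bsub>H\<^esub> y"
    show "i x \<lless>\<^bsub>Q\<^esub> i y"
      unfolding way_below_def
    proof (intro allI impI)
      fix d q assume d: "increasing_seq Q d" "is_supremum Q (range d) q" "i y \<preceq>\<^bsub>Q\<^esub> q"
      obtain c where c: "\<And>n. c n \<in> carrier H" "d = (\<lambda>n. i (c n))"
        using lift Q.increasing_seq_carrier[OF d(1)] by blast
      obtain s where s: "s \<in> carrier H" "q = i s" using onto Q.is_supremum_carrier[OF d(2)] by blast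
      obtain k where "x \<preceq>\<^bsub>H\<^esub> c k"
        using H.way_below_supremum[OF wb, of c s] inc supr c s d leq xy by blast
      then show "\<exists>k. i x \<preceq>\<^bsub>Q\<^esub> d k" using c leq xy by auto
    qed
  next
    assume wb: "i x \<lless>\<^bsub>Q\<^esub> i y"
    show "x \<lless>\<^bsub>H\<^esub> y"
      unfolding way_below_def
    proof (intro allI impI)
      fix c s assume c: "increasing_seq H c" "is_supremum H (range c) s" "y \<preceq>\<^bsub>H\<^esub> s"
      note cs = H.increasing_seq_carrier[OF c(1)] H.is_supremum_carrier[OF c(2)]
      show "\<exists>k. x \<preceq>\<^bsub>H\<^esub> c k"
        using Q.way_below_supremum[OF wb, of "\<lambda>n. i (c n)" "i s"] inc supr c cs leq xy by simp
    qed
  qed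
  show "cu_semigroup H"
  proof
    show O1: "\<exists>s. is_supremum H (range c) s" if "increasing_seq H c" for c
    proof -
      have cc: "c n \<in> carrier H" for n using H.increasing_seq_carrier[OF that] .
      have "increasing_seq Q (\<lambda>n. i (c n))" using inc[OF cc] that by simp
      then obtain q where q: "is_supremum Q (range (\<lambda>n. i (c n))) q" using Q.O1 by blast
      obtain s where "s \<in> carrier H" "i s = q" using onto[OF Q.is_supremum_carrier[OF q]] by blast
      then show ?thesis using supr[of c s, OF cc] q by blast
    qed
    show "\<exists>c. (\<forall>n. c n \<in> carrier H) \<and> (\<forall>n. c n \<lless>\<^bsub>H\<^esub> c (Suc n)) \<and> is_supremum H (range c) x"
      if x: "x \<in> carrier H" for x
    proof -
      obtain d where d: "\<And>n. d n \<in> carrier Q" "\<And>n. d n \<lless>\<^bsub>Q\<^esub> d (Suc n)" "is_supremum Q (range d) (i x)"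
        using Q.O2[OF ic[OF x]] by blast
      obtain c where c: "\<And>n. c n \<in> carrier H" "d = (\<lambda>n. i (c n))" using lift d(1) by blast
      then show ?thesis using d wb supr x by (intro exI[of _ c]) simp
    qed
    show "a' \<oplus>\<^bsub>H\<^esub> b' \<lless>\<^bsub>H\<^esub> a \<oplus>\<^bsub>H\<^esub> b"
      if "a \<in> carrier H" "a' \<in> carrier H" "b \<in> carrier H" "b' \<in> carrier H" "a' \<lless>\<^bsub>H\<^esub> a" "b' \<lless>\<^bsub>H\<^esub> b" for a a' b b'
      using that by (simp add: wb closed add Q.O3 ic)
    show "supremum H (range (\<lambda>n. c n \<oplus>\<^bsub>H\<^esub> d n)) = supremum H (range c) \<oplus>\<^bsub>H\<^esub> supremum H (range d)"
      if cd: "increasing_seq H c" "increasing_seq H d" for c d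
    proof -
      note cc = H.increasing_seq_carrier[OF cd(1)] and dc = H.increasing_seq_carrier[OF cd(2)]
      obtain s t where st: "is_supremum H (range c) s" "is_supremum H (range d) t" using O1 cd by blast
      note sc = H.is_supremum_carrier[OF st(1)] and tc = H.is_supremum_carrier[OF st(2)]
      have "is_supremum Q (range (\<lambda>n. i (c n) \<oplus>\<^bsub>Q\<^esub> i (d n))) (i s \<oplus>\<^bsub>Q\<^esub> i t)"
        using Q.is_supremum_add[of "\<lambda>n. i (c n)" "\<lambda>n. i (d n)" "i s" "i t"]
          inc cd cc dc supr st sc tc by simp
      then have "is_supremum H (range (\<lambda>n. c n \<oplus>\<^bsub>H\<^esub> d n)) (s \<oplus>\<^bsub>H\<^esub> t)"
        using supr[of "\<lambda>n. c n \<oplus>\<^bsub>H\<^esub> d n" "s \<oplus>\<^bsub>H\<^esub> t"] cc dc sc tc by (simp add: closed add)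
      then show ?thesis using H.supremum_eq st by metis
    qed
  qed
qed

section \<open>The internal hom\<close>

lemma I\<^sub>Q_nonempty: "1/2 \<in> I\<^sub>Q"
  by (simp add: I\<^sub>Q_def)

lemma I\<^sub>Q_above: "t \<in> I\<^sub>Q \<Longrightarrow> \<exists>u\<in>I\<^sub>Q. t < u"
  using dense[of t 1] by (auto simp: I\<^sub>Q_def)

lemma I\<^sub>Q_affine: "s \<in> I\<^sub>Q \<Longrightarrow> t \<in> I\<^sub>Q \<Longrightarrow> s < t \<Longrightarrow> r \<in> I\<^sub>Q \<Longrightarrow>
  s + r * (t - s) \<in> I\<^sub>Q \<and> s < s + r * (t - s) \<and> s + r * (t - s) < t"
proof -
  assume *: "s \<in> I\<^sub>Q" "t \<in> I\<^sub>Q" "s < t" "r \<in> I\<^sub>Q"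
  moreover define d where "d = r * (t - s)"
  ultimately have "0 < d" "d < t - s" by (simp_all add: I\<^sub>Q_def)
  then show ?thesis using * unfolding d_def[symmetric] by (auto simp: I\<^sub>Q_def)
qed

section \<open>Generalized morphisms as a round monoid\<close>

context cu_pair
begin

abbreviation mor :: "('a \<Rightarrow> 'b) set" where "mor \<equiv> gen_cu_mor S T"

abbreviation hom :: "('a, 'b) path set posemigroup" where "hom \<equiv> \<lbrakk>S, T\<rbrakk>\<^sub>C\<^sub>u"

lemma mor_precD: "mor_prec S T \<phi> \<psi> \<Longrightarrow> a \<in> carrier S \<Longrightarrow> a' \<in> carrier S \<Longrightarrow> a' \<lless>\<^bsub>S\<^esub> a \<Longrightarrow>
    \<phi> a' \<lless>\<^bsub>T\<^esub> \<psi> a"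
  by (simp add: mor_prec_def)

text \<open>\<open>mor_prec\<close> compares values at arguments related by \<open>\<lless>\<close>;
  approximating \<open>a\<close> from below and using continuity of \<open>\<phi>\<close> brings
  both sides to the same argument.\<close>

lemma mor_prec_leq:
  assumes "\<phi> \<in> mor" "\<psi> \<in> mor" "mor_prec S T \<phi> \<psi>" "a \<in> carrier S"
  shows "\<phi> a \<preceq>\<^bsub>T\<^esub> \<psi> a"
proof -
  obtain c where c: "way_below_seq S c" "is_supremum S (range c) a"
    using S.way_below_approx assms(4) by blast
  have cc: "c n \<in> carrier S" "c n \<lless>\<^bsub>S\<^esub> a" for n
    using S.way_below_seq_supremum[OF c] c(1) by (auto simp: way_below_seq_def)
  note sup = gen_cu_mor_supremum[OF S.cu_semigroup_axioms T.cu_semigroup_axioms assms(1)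
      S.way_below_seq_increasing[OF c(1)] c(2)]
  show ?thesis
    by (rule T.is_supremum_least[OF sup gen_cu_mor_closed[OF assms(2,4)]])
      (rule T.way_below_leq[OF mor_precD[OF assms(3,4) cc] gen_cu_mor_closed[OF assms(1) cc(1)]
          gen_cu_mor_closed[OF assms(2,4)]])
qed

lemma leq_mor_prec_trans:
  assumes "\<phi> \<in> mor" "\<chi> \<in> mor" "\<And>a. a \<in> carrier S \<Longrightarrow> \<phi> a \<preceq>\<^bsub>T\<^esub> \<chi> a" "mor_prec S T \<chi> \<psi>"
  shows "mor_prec S T \<phi> \<psi>"
  unfolding mor_prec_def
  by (intro ballI impI T.leq_way_below_trans[OF assms(3) mor_precD[OF assms(4)]])
    (simp_all add: gen_cu_mor_closed[OF assms(1)] gen_cu_mor_closed[OF assms(2)])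

lemma mor_prec_trans:
  "\<phi> \<in> mor \<Longrightarrow> \<chi> \<in> mor \<Longrightarrow> \<psi> \<in> mor \<Longrightarrow> mor_prec S T \<phi> \<chi> \<Longrightarrow> mor_prec S T \<chi> \<psi> \<Longrightarrow> mor_prec S T \<phi> \<psi>"
  using leq_mor_prec_trans mor_prec_leq by blast

definition mor_plus :: "('a \<Rightarrow> 'b) \<Rightarrow> ('a \<Rightarrow> 'b) \<Rightarrow> 'a \<Rightarrow> 'b"
  where "mor_plus f g = (\<lambda>a\<in>carrier S. f a \<oplus>\<^bsub>T\<^esub> g a)"

definition mor_zero :: "'a \<Rightarrow> 'b"
  where "mor_zero = (\<lambda>a\<in>carrier S. \<zero>\<^bsub>T\<^esub>)"

lemma mor_plus_closed: "f \<in> mor \<Longrightarrow> g \<in> mor \<Longrightarrow> mor_plus f g \<in> mor"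
  unfolding mor_plus_def using gen_cu_mor_plus S.cu_semigroup_axioms T.cu_semigroup_axioms by blast

lemma mor_zero_closed: "mor_zero \<in> mor"
  unfolding mor_zero_def using gen_cu_mor_const_zero S.cu_semigroup_axioms T.cu_semigroup_axioms by blast

lemma mor_prec_plus:
  assumes "f \<in> mor" "g \<in> mor" "f' \<in> mor" "g' \<in> mor" "mor_prec S T f g" "mor_prec S T f' g'"
  shows "mor_prec S T (mor_plus f f') (mor_plus g g')"
  unfolding mor_prec_def mor_plus_def
  using T.O3 mor_precD[OF assms(5)] mor_precD[OF assms(6)] assms(1-4) by (simp add: gen_cu_mor_closed)

lemma mor_prec_zero: "mor_prec S T mor_zero f"
  unfolding mor_prec_def mor_zero_def using T.zero_way_below by simp

text \<open>The relation \<open>mor_prec\<close> need not interpolate; its restriction to pairs that are joined by a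
  path does.\<close>

definition path_prec :: "('a \<Rightarrow> 'b) \<Rightarrow> ('a \<Rightarrow> 'b) \<Rightarrow> bool"
  where "path_prec g h \<longleftrightarrow> g \<in> mor \<and> h \<in> mor \<and> (\<exists>p :: rat \<Rightarrow> 'a \<Rightarrow> 'b.
    (\<forall>t\<in>I\<^sub>Q. p t \<in> mor \<and> mor_prec S T g (p t) \<and> mor_prec S T (p t) h) \<and>
    (\<forall>s\<in>I\<^sub>Q. \<forall>t\<in>I\<^sub>Q. s < t \<longrightarrow> mor_prec S T (p s) (p t)))"

lemma path_precI:
  assumes "g \<in> mor" "h \<in> mor" "\<And>t. t \<in> I\<^sub>Q \<Longrightarrow> p t \<in> mor" "\<And>t. t \<in> I\<^sub>Q \<Longrightarrow> mor_prec S T g (p t)"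
    "\<And>t. t \<in> I\<^sub>Q \<Longrightarrow> mor_prec S T (p t) h"
    "\<And>s t. s \<in> I\<^sub>Q \<Longrightarrow> t \<in> I\<^sub>Q \<Longrightarrow> s < t \<Longrightarrow> mor_prec S T (p s) (p t)"
  shows "path_prec g h"
  using assms unfolding path_prec_def by blast

lemma path_precE:
  assumes "path_prec g h"
  obtains p where "\<And>t. t \<in> I\<^sub>Q \<Longrightarrow> p t \<in> mor" "\<And>t. t \<in> I\<^sub>Q \<Longrightarrow> mor_prec S T g (p t)"
    "\<And>t. t \<in> I\<^sub>Q \<Longrightarrow> mor_prec S T (p t) h"
    "\<And>s t. s \<in> I\<^sub>Q \<Longrightarrow> t \<in> I\<^sub>Q \<Longrightarrow> s < t \<Longrightarrow> mor_prec S T (p s) (p t)"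
  using assms unfolding path_prec_def by metis

lemma path_prec_mor: "path_prec g h \<Longrightarrow> g \<in> mor \<and> h \<in> mor"
  by (simp add: path_prec_def)

lemma path_prec_mor_prec: "path_prec g h \<Longrightarrow> mor_prec S T g h"
  using mor_prec_trans I\<^sub>Q_nonempty unfolding path_prec_def by blast

lemma path_prec_leq: "path_prec g h \<Longrightarrow> a \<in> carrier S \<Longrightarrow> g a \<preceq>\<^bsub>T\<^esub> h a"
  using mor_prec_leq path_prec_mor path_prec_mor_prec by blast

text \<open>The path from \<open>g\<close> to \<open>k\<close> also serves from \<open>g\<close> to
  \<open>h\<close>, since only its upper bound changes. This lets the weaker relation in
  \<open>path_le\<close> act on ideals.\<close>

lemma path_prec_mor_prec_trans:
  assumes "path_prec g k" "h \<in> mor" "mor_prec S T k h"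
  shows "path_prec g h"
proof -
  obtain p where p: "\<And>t. t \<in> I\<^sub>Q \<Longrightarrow> p t \<in> mor" "\<And>t. t \<in> I\<^sub>Q \<Longrightarrow> mor_prec S T g (p t)"
    "\<And>t. t \<in> I\<^sub>Q \<Longrightarrow> mor_prec S T (p t) k"
    "\<And>s t. s \<in> I\<^sub>Q \<Longrightarrow> t \<in> I\<^sub>Q \<Longrightarrow> s < t \<Longrightarrow> mor_prec S T (p s) (p t)"
    using path_precE[OF assms(1)] by blast
  show ?thesis
  proof (rule path_precI[of g h p])
    show "mor_prec S T (p t) h" if "t \<in> I\<^sub>Q" for t
      using mor_prec_trans[OF p(1)[OF that] _ assms(2) p(3)[OF that] assms(3)]
        path_prec_mor[OF assms(1)] by blast
  qed (use assms path_prec_mor p in auto)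
qed

text \<open>The part of the path between \<open>s\<close> and \<open>t\<close>, reparametrised
  affinely, joins its two ends.\<close>

lemma path_prec_segment:
  assumes p: "\<And>t. t \<in> I\<^sub>Q \<Longrightarrow> p t \<in> mor"
    "\<And>s t. s \<in> I\<^sub>Q \<Longrightarrow> t \<in> I\<^sub>Q \<Longrightarrow> s < t \<Longrightarrow> mor_prec S T (p s) (p t)"
    and st: "s \<in> I\<^sub>Q" "t \<in> I\<^sub>Q" "s < t"
  shows "path_prec (p s) (p t)"
proof (rule path_precI[of _ _ "\<lambda>r. p (s + r * (t - s))"])
  show "mor_prec S T (p (s + q * (t - s))) (p (s + r * (t - s)))"
    if "q \<in> I\<^sub>Q" "r \<in> I\<^sub>Q" "q < r" for q r
    using I\<^sub>Q_affine[OF st] that st(3) by (intro p(2)) auto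
qed (use I\<^sub>Q_affine[OF st] p st in auto)

text \<open>The midpoint of the joining path interpolates; the two halves, rescaled to the unit
  interval, are the required witnesses.\<close>

lemma path_prec_interpolation:
  assumes "path_prec g h"
  shows "\<exists>k. path_prec g k \<and> path_prec k h"
proof -
  obtain p where p: "\<And>t. t \<in> I\<^sub>Q \<Longrightarrow> p t \<in> mor" "\<And>t. t \<in> I\<^sub>Q \<Longrightarrow> mor_prec S T g (p t)"
    "\<And>t. t \<in> I\<^sub>Q \<Longrightarrow> mor_prec S T (p t) h"
    "\<And>s t. s \<in> I\<^sub>Q \<Longrightarrow> t \<in> I\<^sub>Q \<Longrightarrow> s < t \<Longrightarrow> mor_prec S T (p s) (p t)"
    using path_precE[OF assms] by blast
  note gh = path_prec_mor[OF assms]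
  have "path_prec g (p (1/2))"
    by (rule path_precI[of _ _ "\<lambda>r. p (r / 2)"]) (use gh p in \<open>auto simp: I\<^sub>Q_def\<close>)
  moreover have "path_prec (p (1/2)) h"
    by (rule path_precI[of _ _ "\<lambda>r. p ((1 + r) / 2)"]) (use gh p in \<open>auto simp: I\<^sub>Q_def\<close>)
  ultimately show ?thesis by blast
qed

sublocale H: round_monoid mor mor_plus mor_zero path_prec
proof
  show "f \<in> mor \<and> g \<in> mor" if "path_prec f g" for f g using path_prec_mor that .
  show "path_prec f h" if "path_prec f g" "path_prec g h" for f g h
    using path_prec_mor_prec_trans[OF that(1)] path_prec_mor[OF that(2)] path_prec_mor_prec[OF that(2)]
    by blast
  show "\<exists>g. path_prec f g \<and> path_prec g h" if "path_prec f h" for f h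
    using path_prec_interpolation that .
  show "path_prec (mor_plus f f') (mor_plus g g')" if fg: "path_prec f g" "path_prec f' g'" for f f' g g'
  proof -
    obtain p where p: "\<And>t. t \<in> I\<^sub>Q \<Longrightarrow> p t \<in> mor" "\<And>t. t \<in> I\<^sub>Q \<Longrightarrow> mor_prec S T f (p t)"
      "\<And>t. t \<in> I\<^sub>Q \<Longrightarrow> mor_prec S T (p t) g"
      "\<And>s t. s \<in> I\<^sub>Q \<Longrightarrow> t \<in> I\<^sub>Q \<Longrightarrow> s < t \<Longrightarrow> mor_prec S T (p s) (p t)"
      using path_precE[OF fg(1)] by blast
    obtain p' where p': "\<And>t. t \<in> I\<^sub>Q \<Longrightarrow> p' t \<in> mor" "\<And>t. t \<in> I\<^sub>Q \<Longrightarrow> mor_prec S T f' (p' t)"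
      "\<And>t. t \<in> I\<^sub>Q \<Longrightarrow> mor_prec S T (p' t) g'"
      "\<And>s t. s \<in> I\<^sub>Q \<Longrightarrow> t \<in> I\<^sub>Q \<Longrightarrow> s < t \<Longrightarrow> mor_prec S T (p' s) (p' t)"
      using path_precE[OF fg(2)] by blast
    show ?thesis
      by (rule path_precI[of _ _ "\<lambda>t. mor_plus (p t) (p' t)"])
        (use path_prec_mor[OF fg(1)] path_prec_mor[OF fg(2)] p p' in
          \<open>auto intro: mor_plus_closed mor_prec_plus\<close>)
  qed
  \<comment> \<open>A constant path suffices, since \<open>mor_zero\<close> is related by
    \<open>mor_prec\<close> even to itself.\<close>
  show "path_prec mor_zero f" if "f \<in> mor" for f
    by (rule path_precI[of _ _ "\<lambda>t. mor_zero"]) (auto simp: that mor_zero_closed mor_prec_zero)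
  show "mor_zero \<in> mor" by (rule mor_zero_closed)
  show "path_prec f (mor_plus h g)" if "g \<in> mor" "h \<in> mor" "path_prec f (mor_plus g h)" for f g h
  proof -
    have "mor_plus h g = mor_plus g h"
      using that(1,2) by (auto simp: mor_plus_def gen_cu_mor_closed T.m_comm)
    then show ?thesis using that(3) by simp
  qed
  show "mor_plus (mor_plus f g) h = mor_plus f (mor_plus g h)"
    if "f \<in> mor" "g \<in> mor" "h \<in> mor" for f g h
    using that by (auto simp: mor_plus_def gen_cu_mor_closed T.m_assoc)
  show "mor_plus mor_zero f = f" if f: "f \<in> mor" for f
    by (rule gen_cu_mor_eqI[OF mor_plus_closed[OF mor_zero_closed f] f])
      (simp add: mor_plus_def mor_zero_def gen_cu_mor_closed[OF f])
qed

end

lemma iso_cu_mor: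
  fixes H :: "('a, 'm) posemigroup_scheme" and Q :: "('b, 'n) posemigroup_scheme"
  assumes H: "cu_semigroup H" and Q: "cu_semigroup Q" and bij: "bij_betw i (carrier H) (carrier Q)"
    and add: "\<And>x y. x \<in> carrier H \<Longrightarrow> y \<in> carrier H \<Longrightarrow> i (x \<oplus>\<^bsub>H\<^esub> y) = i x \<oplus>\<^bsub>Q\<^esub> i y"
    and zero: "i \<zero>\<^bsub>H\<^esub> = \<zero>\<^bsub>Q\<^esub>"
    and leq: "\<And>x y. x \<in> carrier H \<Longrightarrow> y \<in> carrier H \<Longrightarrow> x \<preceq>\<^bsub>H\<^esub> y \<longleftrightarrow> i x \<preceq>\<^bsub>Q\<^esub> i y"
  shows "(\<lambda>x\<in>carrier H. i x) \<in> cu_mor H Q"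
    "(\<lambda>q\<in>carrier Q. inv_into (carrier H) i q) \<in> cu_mor Q H"
proof -
  \<comment> \<open>Stated with types of its own, so that it applies to \<open>i\<close> and, with
    the roles exchanged, to its inverse.\<close>
  have *: "(\<lambda>x\<in>carrier H. i x) \<in> cu_mor H Q"
    if H: "cu_semigroup H" and Q: "cu_semigroup Q" and bij: "bij_betw i (carrier H) (carrier Q)"
      and add: "\<And>x y. x \<in> carrier H \<Longrightarrow> y \<in> carrier H \<Longrightarrow> i (x \<oplus>\<^bsub>H\<^esub> y) = i x \<oplus>\<^bsub>Q\<^esub> i y"
      and zero: "i \<zero>\<^bsub>H\<^esub> = \<zero>\<^bsub>Q\<^esub>"
      and leq: "\<And>x y. x \<in> carrier H \<Longrightarrow> y \<in> carrier H \<Longrightarrow> x \<preceq>\<^bsub>H\<^esub> y \<longleftrightarrow> i x \<preceq>\<^bsub>Q\<^esub> i y"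
    for H :: "('c, 'p) posemigroup_scheme" and Q :: "('d, 'q) posemigroup_scheme" and i
  proof -
    interpret H: cu_semigroup H by fact
    interpret Q: cu_semigroup Q by fact
    have ic: "i x \<in> carrier Q" if "x \<in> carrier H" for x
      using bij that by (auto simp: bij_betw_def)
    have sup: "is_supremum H A s \<longleftrightarrow> is_supremum Q (i ` A) (i s)"
      if "A \<subseteq> carrier H" "s \<in> carrier H" for A s
      by (rule cu_semigroup_transport(2)[of Q i H A s]) (use Q bij add zero leq that in simp_all)
    have wb: "x \<lless>\<^bsub>H\<^esub> y \<longleftrightarrow> i x \<lless>\<^bsub>Q\<^esub> i y" if "x \<in> carrier H" "y \<in> carrier H" for x y
      by (rule cu_semigroup_transport(3)[of Q i H x y]) (use Q bij add zero leq that in simp_all)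
    have "(\<lambda>x\<in>carrier H. i x) \<in> gen_cu_mor H Q"
    proof (rule gen_cu_morI[OF H Q])
      fix c s u assume c: "increasing_seq H c" "is_supremum H (range c) s" and u: "u \<in> carrier Q"
        and le: "\<And>n. (\<lambda>x\<in>carrier H. i x) (c n) \<preceq>\<^bsub>Q\<^esub> u"
      have cc: "range c \<subseteq> carrier H" "s \<in> carrier H"
        using H.increasing_seq_carrier[OF c(1)] H.is_supremum_carrier[OF c(2)] by auto
      have "is_supremum Q (i ` range c) (i s)" using sup[OF cc] c(2) by simp
      then show "(\<lambda>x\<in>carrier H. i x) s \<preceq>\<^bsub>Q\<^esub> u"
        using le u cc by (simp add: is_supremum_def image_subset_iff)
    qed (use add zero leq ic in auto)
    then show ?thesis using wb by (auto simp: cu_mor_def)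
  qed
  show "(\<lambda>x\<in>carrier H. i x) \<in> cu_mor H Q" by (rule *) fact+
  interpret H: cu_semigroup H by fact
  interpret Q: cu_semigroup Q by fact
  let ?j = "inv_into (carrier H) i"
  have bj: "bij_betw ?j (carrier Q) (carrier H)" using bij_betw_inv_into[OF bij] .
  have jc: "?j q \<in> carrier H" if "q \<in> carrier Q" for q using bj that by (auto simp: bij_betw_def)
  have ij: "i (?j q) = q" if "q \<in> carrier Q" for q using bij_betw_inv_into_right[OF bij that] .
  have ji: "?j (i x) = x" if "x \<in> carrier H" for x using bij_betw_inv_into_left[OF bij that] .
  show "(\<lambda>q\<in>carrier Q. ?j q) \<in> cu_mor Q H"
  proof (rule *[OF Q H bj])
    show "?j (x \<oplus>\<^bsub>Q\<^esub> y) = ?j x \<oplus>\<^bsub>H\<^esub> ?j y" if "x \<in> carrier Q" "y \<in> carrier Q" for x y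
      using ji[of "?j x \<oplus>\<^bsub>H\<^esub> ?j y"] add[of "?j x" "?j y"] jc ij that by simp
    show "?j \<zero>\<^bsub>Q\<^esub> = \<zero>\<^bsub>H\<^esub>" using ji[of "\<zero>\<^bsub>H\<^esub>"] zero by simp
    show "x \<preceq>\<^bsub>Q\<^esub> y \<longleftrightarrow> ?j x \<preceq>\<^bsub>H\<^esub> ?j y" if "x \<in> carrier Q" "y \<in> carrier Q" for x y
      using leq[of "?j x" "?j y"] jc ij that by simp
  qed
qed

section \<open>Classes of paths as ideals\<close>

context cu_pair
begin

definition path_ideal :: "('a, 'b) path \<Rightarrow> ('a \<Rightarrow> 'b) set"
  where "path_ideal f = {h. \<exists>t\<in>I\<^sub>Q. path_prec h (f t)}"

lemma path_mor: "f \<in> paths S T \<Longrightarrow> t \<in> I\<^sub>Q \<Longrightarrow> f t \<in> mor"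
  by (auto simp: paths_def)

lemma path_mor_prec: "f \<in> paths S T \<Longrightarrow> s \<in> I\<^sub>Q \<Longrightarrow> t \<in> I\<^sub>Q \<Longrightarrow> s < t \<Longrightarrow> mor_prec S T (f s) (f t)"
  by (auto simp: paths_def)

lemma path_path_prec: "f \<in> paths S T \<Longrightarrow> s \<in> I\<^sub>Q \<Longrightarrow> t \<in> I\<^sub>Q \<Longrightarrow> s < t \<Longrightarrow> path_prec (f s) (f t)"
  using path_prec_segment path_mor path_mor_prec by blast

lemma path_in_ideal: "f \<in> paths S T \<Longrightarrow> t \<in> I\<^sub>Q \<Longrightarrow> f t \<in> path_ideal f"
  using path_path_prec I\<^sub>Q_above unfolding path_ideal_def by blast

lemma path_ideal_carrier:
  assumes f: "f \<in> paths S T" shows "path_ideal f \<in> carrier H.completion"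
proof -
  \<comment> \<open>An enumeration of the index set, with 1/2 as the value at codes of rationals
    outside it; it supplies the countable cofinal family.\<close>
  define e :: "nat \<Rightarrow> rat" where "e n = (if from_nat n \<in> I\<^sub>Q then from_nat n else 1/2)" for n
  have e: "e n \<in> I\<^sub>Q" for n using I\<^sub>Q_nonempty by (simp add: e_def)
  show ?thesis
  proof (rule H.ideal_intro[where c = "\<lambda>n. f (e n)"])
    show "h \<in> path_ideal f" if "g \<in> path_ideal f" "path_prec h g" for g h
      using that H.prec_trans unfolding path_ideal_def by blast
    show "f (e n) \<in> path_ideal f" for n using path_in_ideal[OF f e] .
    show "\<exists>n. path_prec h (f (e n))" if h: "h \<in> path_ideal f" for h
    proof -
      obtain t where "t \<in> I\<^sub>Q" "path_prec h (f t)" using h by (auto simp: path_ideal_def)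
      then show ?thesis by (intro exI[of _ "to_nat t"]) (simp add: e_def)
    qed
    show "\<exists>k\<in>path_ideal f. path_prec g k \<and> path_prec h k"
      if gh: "g \<in> path_ideal f" "h \<in> path_ideal f" for g h
    proof -
      obtain s t where st: "s \<in> I\<^sub>Q" "path_prec g (f s)" "t \<in> I\<^sub>Q" "path_prec h (f t)"
        using gh by (auto simp: path_ideal_def)
      have "max s t \<in> I\<^sub>Q" using st by (auto simp: max_def)
      then obtain u where u: "u \<in> I\<^sub>Q" "s < u" "t < u" using I\<^sub>Q_above by fastforce
      then have "path_prec g (f u)" "path_prec h (f u)"
        using st path_path_prec[OF f] H.prec_trans by blast+
      then show ?thesis using path_in_ideal[OF f u(1)] by blast
    qed
  qed
qed

text \<open>The two relations match because each member of a path is joined to a later one by a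
  segment and so lies in the ideal, while \<open>mor_prec\<close> can be absorbed at the upper end
  of a \<open>path_prec\<close>.\<close>

lemma path_le_iff:
  assumes f: "f \<in> paths S T" and g: "g \<in> paths S T"
  shows "path_le S T f g \<longleftrightarrow> path_ideal f \<subseteq> path_ideal g"
proof
  assume "path_le S T f g"
  then show "path_ideal f \<subseteq> path_ideal g"
    using path_prec_mor_prec_trans path_mor[OF g] unfolding path_le_def path_ideal_def by blast
next
  assume "path_ideal f \<subseteq> path_ideal g"
  then show "path_le S T f g"
    using path_in_ideal[OF f] path_prec_mor_prec unfolding path_le_def path_ideal_def by blast
qed

text \<open>\<open>dense_chain\<close> turns the generating sequence of \<open>I\<close> into a
  family indexed by the rationals and cofinal with it.\<close>

lemma path_ideal_surj:
  assumes "I \<in> carrier H.completion"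
  obtains f where "f \<in> paths S T" "path_ideal f = I"
proof -
  obtain x where x: "H.chain x" "I = H.ideal_of x" using H.completion_cases[OF assms] .
  obtain f where f: "\<And>s t. s \<in> I\<^sub>Q \<Longrightarrow> t \<in> I\<^sub>Q \<Longrightarrow> s < t \<Longrightarrow> path_prec (f s) (f t)"
    "\<And>n. \<exists>t\<in>I\<^sub>Q. path_prec (x n) (f t)" "\<And>t. t \<in> I\<^sub>Q \<Longrightarrow> \<exists>n. path_prec (f t) (x n)"
  proof (rule dense_chain[of path_prec x])
    show "path_prec (x n) (x (Suc n))" for n using x(1) by (simp add: H.chain_def)
  qed (use H.prec_trans H.prec_interpolation in blast)+
  let ?f = "restrict f I\<^sub>Q"
  have "?f \<in> paths S T"
  proof -
    have "f t \<in> mor" if "t \<in> I\<^sub>Q" for t using f(3)[OF that] path_prec_mor by blast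
    then show ?thesis unfolding paths_def using path_prec_mor_prec[OF f(1)] by simp
  qed
  moreover have "path_ideal ?f = I"
  proof
    show "path_ideal ?f \<subseteq> I"
      using f(3) H.prec_trans unfolding path_ideal_def x H.ideal_of_def by fastforce
    show "I \<subseteq> path_ideal ?f"
    proof
      fix h assume "h \<in> I"
      then obtain n where n: "path_prec h (x n)" by (auto simp: x H.ideal_of_def)
      obtain t where t: "t \<in> I\<^sub>Q" "path_prec (x n) (f t)" using f(2) by blast
      then show "h \<in> path_ideal ?f"
        unfolding path_ideal_def using H.prec_trans[OF n t(2)] by auto
    qed
  qed
  ultimately show ?thesis using that by blast
qed

lemma path_equiv_iff:
  "(f, g) \<in> path_equiv S T \<longleftrightarrow> f \<in> paths S T \<and> g \<in> paths S T \<and> path_ideal f = path_ideal g"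
  using path_le_iff by (auto simp: path_equiv_def)

lemma path_class_eq: "f \<in> paths S T \<Longrightarrow>
    path_class S T f = {g \<in> paths S T. path_ideal g = path_ideal f}"
  by (auto simp: path_class_def path_equiv_iff)

text \<open>All representatives have the same ideal, so the union over the class avoids choosing
  one.\<close>

definition ihom_ideal :: "('a, 'b) path set \<Rightarrow> ('a \<Rightarrow> 'b) set"
  where "ihom_ideal X = (\<Union>f\<in>X. path_ideal f)"

lemma path_class_self: "f \<in> paths S T \<Longrightarrow> f \<in> path_class S T f"
  by (simp add: path_class_eq)

lemma ihom_ideal_class: "f \<in> paths S T \<Longrightarrow> ihom_ideal (path_class S T f) = path_ideal f"
  using path_class_self by (auto simp: ihom_ideal_def path_class_eq)

lemma carrier_ihom: "carrier hom = path_class S T ` paths S T"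
  by (auto simp: ihom_def quotient_def path_class_def)

lemma path_class_in: "f \<in> paths S T \<Longrightarrow> path_class S T f \<in> carrier hom"
  by (simp add: carrier_ihom)

lemma ihom_mem:
  assumes "X \<in> carrier hom" "f \<in> X"
  shows "f \<in> paths S T" "path_ideal f = ihom_ideal X" "X = path_class S T f"
proof -
  obtain g where g: "g \<in> paths S T" "X = path_class S T g" using assms(1) by (auto simp: carrier_ihom)
  show f: "f \<in> paths S T" using g assms(2) by (simp add: path_class_eq)
  have eq: "path_ideal f = path_ideal g" using g assms(2) by (simp add: path_class_eq)
  then show "path_ideal f = ihom_ideal X" using ihom_ideal_class g by simp
  show "X = path_class S T f" using g f eq by (simp add: path_class_eq)
qed

lemma ihom_nonempty:
  assumes "X \<in> carrier hom" obtains f where "f \<in> X"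
  using assms path_class_self by (auto simp: carrier_ihom)

lemma ihom_ideal_bij: "bij_betw ihom_ideal (carrier hom) (carrier H.completion)"
  unfolding bij_betw_def
proof
  show "inj_on ihom_ideal (carrier hom)"
  proof (rule inj_onI)
    fix X Y assume XY: "X \<in> carrier hom" "Y \<in> carrier hom" "ihom_ideal X = ihom_ideal Y"
    obtain f where f: "f \<in> X" using ihom_nonempty[OF XY(1)] .
    obtain g where g: "g \<in> Y" using ihom_nonempty[OF XY(2)] .
    show "X = Y"
      using ihom_mem[OF XY(1) f] ihom_mem[OF XY(2) g] XY(3) by (simp add: path_class_eq)
  qed
  show "ihom_ideal ` carrier hom = carrier H.completion"
  proof
    show "ihom_ideal ` carrier hom \<subseteq> carrier H.completion"
      by (auto simp: carrier_ihom ihom_ideal_class path_ideal_carrier)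
    show "carrier H.completion \<subseteq> ihom_ideal ` carrier hom"
    proof
      fix I assume "I \<in> carrier H.completion"
      then obtain f where "f \<in> paths S T" "path_ideal f = I" by (rule path_ideal_surj)
      then show "I \<in> ihom_ideal ` carrier hom"
        using ihom_ideal_class path_class_in by (metis imageI)
    qed
  qed
qed

lemma ihom_ideal_carrier: "X \<in> carrier hom \<Longrightarrow> ihom_ideal X \<in> carrier H.completion"
  using ihom_ideal_bij by (auto simp: bij_betw_def)

lemma ihom_leq_iff:
  assumes "X \<in> carrier hom" "Y \<in> carrier hom"
  shows "X \<preceq>\<^bsub>hom\<^esub> Y \<longleftrightarrow> ihom_ideal X \<subseteq> ihom_ideal Y"
proof -
  obtain f where f: "f \<in> X" using ihom_nonempty[OF assms(1)] .
  obtain g where g: "g \<in> Y" using ihom_nonempty[OF assms(2)] .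
  have "path_le S T f' g' \<longleftrightarrow> ihom_ideal X \<subseteq> ihom_ideal Y" if "f' \<in> X" "g' \<in> Y" for f' g'
    using path_le_iff ihom_mem[OF assms(1) that(1)] ihom_mem[OF assms(2) that(2)] by simp
  then show ?thesis using f g by (auto simp: ihom_def)
qed

lemma path_add_apply: "t \<in> I\<^sub>Q \<Longrightarrow> path_add S T f g t = mor_plus (f t) (g t)"
  by (simp add: path_add_def mor_plus_def)

lemma path_add_paths:
  assumes f: "f \<in> paths S T" and g: "g \<in> paths S T"
  shows "path_add S T f g \<in> paths S T"
    "path_ideal (path_add S T f g) = path_ideal f \<oplus>\<^bsub>H.completion\<^esub> path_ideal g"
proof -
  have ext: "path_add S T f g \<in> extensional I\<^sub>Q" by (simp add: path_add_def extensional_def)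
  show "path_add S T f g \<in> paths S T"
    unfolding paths_def
    using mor_plus_closed mor_prec_plus path_mor[OF f] path_mor[OF g] path_mor_prec[OF f]
      path_mor_prec[OF g] ext by (simp add: path_add_apply PiE_iff)
  show "path_ideal (path_add S T f g) = path_ideal f \<oplus>\<^bsub>H.completion\<^esub> path_ideal g" (is "?L = ?R")
  proof
    show "?L \<subseteq> ?R"
      using path_in_ideal[OF f] path_in_ideal[OF g]
      by (auto simp: path_ideal_def[of "path_add S T f g"] path_add_apply H.completion_add)
    show "?R \<subseteq> ?L"
    proof
      fix k assume "k \<in> ?R"
      then obtain h h' s t where *: "path_prec k (mor_plus h h')" "s \<in> I\<^sub>Q" "path_prec h (f s)"
        "t \<in> I\<^sub>Q" "path_prec h' (g t)"
        by (auto simp: H.completion_add path_ideal_def)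
      have "max s t \<in> I\<^sub>Q" using * by (auto simp: max_def)
      then obtain u where u: "u \<in> I\<^sub>Q" "s < u" "t < u" using I\<^sub>Q_above by fastforce
      have "path_prec h (f u)" using H.prec_trans[OF *(3) path_path_prec[OF f *(2) u(1,2)]] .
      moreover have "path_prec h' (g u)" using H.prec_trans[OF *(5) path_path_prec[OF g *(4) u(1,3)]] .
      ultimately have "path_prec k (mor_plus (f u) (g u))"
        using H.prec_trans[OF *(1) H.prec_plus] by blast
      then show "k \<in> ?L" unfolding path_ideal_def mem_Collect_eq
        by (intro bexI[of _ u]) (simp_all add: path_add_apply u(1))
    qed
  qed
qed

lemma ihom_add:
  assumes "X \<in> carrier hom" "Y \<in> carrier hom" "f \<in> X" "g \<in> Y"
  shows "X \<oplus>\<^bsub>hom\<^esub> Y = path_class S T (path_add S T f g)"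
proof -
  have "path_class S T (path_add S T f' g') = path_class S T (path_add S T f g)"
    if "f' \<in> X" "g' \<in> Y" for f' g'
  proof -
    note m = ihom_mem[OF assms(1) that(1)] ihom_mem[OF assms(2) that(2)]
      ihom_mem[OF assms(1,3)] ihom_mem[OF assms(2,4)]
    have "path_ideal (path_add S T f' g') = path_ideal (path_add S T f g)"
      unfolding path_add_paths(2)[OF m(1,4)] path_add_paths(2)[OF m(7,10)] m(2,5,8,11) ..
    then show ?thesis
      unfolding path_class_eq[OF path_add_paths(1)[OF m(1,4)]]
        path_class_eq[OF path_add_paths(1)[OF m(7,10)]] by simp
  qed
  then have "(\<Union>f'\<in>X. \<Union>g'\<in>Y. path_class S T (path_add S T f' g')) =
      (\<Union>f'\<in>X. \<Union>g'\<in>Y. path_class S T (path_add S T f g))" by simp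
  also have "\<dots> = path_class S T (path_add S T f g)" using assms(3,4) by auto
  finally show ?thesis by (simp add: ihom_def)
qed

lemma path_zero_paths:
  "path_zero S T \<in> paths S T" "path_ideal (path_zero S T) = \<zero>\<^bsub>H.completion\<^esub>"
proof -
  have *: "path_zero S T t = mor_zero" if "t \<in> I\<^sub>Q" for t
    using that by (simp add: path_zero_def mor_zero_def)
  have "path_zero S T \<in> extensional I\<^sub>Q" by (simp add: path_zero_def extensional_def)
  then show "path_zero S T \<in> paths S T"
    unfolding paths_def using mor_zero_closed mor_prec_zero by (simp add: * PiE_iff)
  show "path_ideal (path_zero S T) = \<zero>\<^bsub>H.completion\<^esub>"
    using I\<^sub>Q_nonempty by (auto simp: path_ideal_def H.completion_zero *)
qed

lemma ihom_add_closed: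
  assumes "X \<in> carrier hom" "Y \<in> carrier hom"
  shows "X \<oplus>\<^bsub>hom\<^esub> Y \<in> carrier hom"
    "ihom_ideal (X \<oplus>\<^bsub>hom\<^esub> Y) = ihom_ideal X \<oplus>\<^bsub>H.completion\<^esub> ihom_ideal Y"
proof -
  obtain f where f: "f \<in> X" using ihom_nonempty[OF assms(1)] .
  obtain g where g: "g \<in> Y" using ihom_nonempty[OF assms(2)] .
  note fm = ihom_mem[OF assms(1) f] and gm = ihom_mem[OF assms(2) g]
  note pa = path_add_paths[OF fm(1) gm(1)]
  show "X \<oplus>\<^bsub>hom\<^esub> Y \<in> carrier hom"
    "ihom_ideal (X \<oplus>\<^bsub>hom\<^esub> Y) = ihom_ideal X \<oplus>\<^bsub>H.completion\<^esub> ihom_ideal Y"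
    unfolding ihom_add[OF assms f g]
    using path_class_in[OF pa(1)] ihom_ideal_class[OF pa(1)] pa(2) fm gm by simp_all
qed

lemma ihom_zero:
  "\<zero>\<^bsub>hom\<^esub> \<in> carrier hom" "ihom_ideal \<zero>\<^bsub>hom\<^esub> = \<zero>\<^bsub>H.completion\<^esub>"
proof -
  have "\<zero>\<^bsub>hom\<^esub> = path_class S T (path_zero S T)" by (simp add: ihom_def)
  then show "\<zero>\<^bsub>hom\<^esub> \<in> carrier hom" "ihom_ideal \<zero>\<^bsub>hom\<^esub> = \<zero>\<^bsub>H.completion\<^esub>"
    using path_class_in[OF path_zero_paths(1)] ihom_ideal_class[OF path_zero_paths(1)]
      path_zero_paths(2) by simp_all
qed

lemma ihom_leq_iff':
  "X \<in> carrier hom \<Longrightarrow> Y \<in> carrier hom \<Longrightarrow>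
    X \<preceq>\<^bsub>hom\<^esub> Y \<longleftrightarrow> ihom_ideal X \<preceq>\<^bsub>H.completion\<^esub> ihom_ideal Y"
  by (simp add: ihom_leq_iff H.completion_leq)

lemma cu_semigroup_ihom: "cu_semigroup hom"
  by (rule cu_semigroup_transport(1)[OF H.cu_semigroup_completion ihom_ideal_bij])
    (rule ihom_add_closed ihom_zero ihom_leq_iff'; assumption)+

lemma ihom_supremum_iff:
  assumes "A \<subseteq> carrier hom" "s \<in> carrier hom"
  shows "is_supremum hom A s \<longleftrightarrow> is_supremum H.completion (ihom_ideal ` A) (ihom_ideal s)"
  by (rule cu_semigroup_transport(2)[OF H.cu_semigroup_completion ihom_ideal_bij _ _ _ _ _ assms])
    (rule ihom_add_closed ihom_zero ihom_leq_iff'; assumption)+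

lemma ihom_way_below_iff:
  assumes "x \<in> carrier hom" "y \<in> carrier hom"
  shows "x \<lless>\<^bsub>hom\<^esub> y \<longleftrightarrow> ihom_ideal x \<lless>\<^bsub>H.completion\<^esub> ihom_ideal y"
  by (rule cu_semigroup_transport(3)[OF H.cu_semigroup_completion ihom_ideal_bij _ _ _ _ _ assms])
    (rule ihom_add_closed ihom_zero ihom_leq_iff'; assumption)+

lemma ihom_iso:
  "(\<lambda>x\<in>carrier hom. ihom_ideal x) \<in> cu_mor hom H.completion"
  "(\<lambda>I\<in>carrier H.completion. inv_into (carrier hom) ihom_ideal I) \<in> cu_mor H.completion hom"
  by (rule iso_cu_mor[OF cu_semigroup_ihom H.cu_semigroup_completion ihom_ideal_bij];
      rule ihom_add_closed ihom_zero ihom_leq_iff'; assumption)+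

end

section \<open>The endpoint map\<close>

context cu_pair
begin

text \<open>Evaluation at \<open>a\<close>, extended from morphisms to ideals; on the ideal of
  \<open>X\<close> it computes the endpoint of \<open>X\<close> at \<open>a\<close>.\<close>

definition eval_ext :: "'a \<Rightarrow> ('a \<Rightarrow> 'b) set \<Rightarrow> 'b"
  where "eval_ext a = H.ext T (\<lambda>h. h a)"

context
  fixes a assumes a: "a \<in> carrier S"
begin

lemma eval_closed: "h \<in> mor \<Longrightarrow> h a \<in> carrier T"
  using a by (rule gen_cu_mor_closed[rotated])

lemma eval_plus: "g \<in> mor \<Longrightarrow> h \<in> mor \<Longrightarrow> mor_plus g h a = g a \<oplus>\<^bsub>T\<^esub> h a"
  using a by (simp add: mor_plus_def)

lemma eval_zero: "mor_zero a = \<zero>\<^bsub>T\<^esub>"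
  using a by (simp add: mor_zero_def)

lemma eval_prec: "path_prec g h \<Longrightarrow> g a \<preceq>\<^bsub>T\<^esub> h a"
  using path_prec_leq a by blast

lemmas eval_axioms = T.cu_semigroup_axioms eval_closed eval_prec eval_plus eval_zero

lemma eval_ext_gen: "eval_ext a \<in> gen_cu_mor H.completion T"
  unfolding eval_ext_def by (rule H.ext_gen_cu_mor) (simp_all add: eval_axioms)

lemma eval_ext_supremum:
  "I \<in> carrier H.completion \<Longrightarrow> is_supremum T ((\<lambda>h. h a) ` I) (eval_ext a I)"
  unfolding eval_ext_def by (rule H.is_supremum_ext) (simp_all add: eval_axioms)

lemma eval_ext_chain:
  assumes "H.chain x"
  shows "is_supremum T (range (\<lambda>n. x n a)) (eval_ext a (H.ideal_of x))"
proof -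
  have "is_supremum T ((\<lambda>h. h a) ` H.ideal_of x) s \<longleftrightarrow> is_supremum T (range (\<lambda>n. x n a)) s" for s
    by (rule H.ext_chain(2)) (simp_all add: eval_axioms assms)
  then show ?thesis using eval_ext_supremum[OF H.ideal_of_in[OF assms]] by simp
qed

text \<open>The representative picked by \<open>SOME\<close> does not matter: its values at
  \<open>a\<close> are cofinal with the values of all members of the ideal.\<close>

lemma endpoint_eq:
  assumes X: "X \<in> carrier hom"
  shows "endpoint S T X a = eval_ext a (ihom_ideal X)"
proof -
  define f where "f = (SOME f. f \<in> X)"
  have "f \<in> X" unfolding f_def using someI_ex ihom_nonempty[OF X] by metis
  note f = ihom_mem[OF X this]
  have I: "path_ideal f \<in> carrier H.completion" using path_ideal_carrier[OF f(1)] .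
  have "is_supremum T ((\<lambda>t. f t a) ` I\<^sub>Q) (eval_ext a (path_ideal f))"
  proof (rule T.is_supremum_cofinal[OF eval_ext_supremum[OF I]])
    show "(\<lambda>h. h a) ` path_ideal f \<subseteq> carrier T"
      using H.ideal_subset[OF I] eval_closed by blast
    show "(\<lambda>t. f t a) ` I\<^sub>Q \<subseteq> carrier T" using path_mor[OF f(1)] eval_closed by blast
    show "\<exists>c\<in>(\<lambda>t. f t a) ` I\<^sub>Q. b \<preceq>\<^bsub>T\<^esub> c" if "b \<in> (\<lambda>h. h a) ` path_ideal f" for b
      using that eval_prec by (auto simp: path_ideal_def)
    show "\<exists>c\<in>(\<lambda>h. h a) ` path_ideal f. b \<preceq>\<^bsub>T\<^esub> c" if "b \<in> (\<lambda>t. f t a) ` I\<^sub>Q" for b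
      using that path_in_ideal[OF f(1)] T.leq_refl eval_closed[OF path_mor[OF f(1)]] by blast
  qed
  then have "supremum T ((\<lambda>t. f t a) ` I\<^sub>Q) = eval_ext a (ihom_ideal X)"
    using T.supremum_eq f(2) by simp
  then show ?thesis using a by (simp add: endpoint_def f_def)
qed

end

lemma endpoint_leq:
  assumes "X \<in> carrier hom" "h \<in> ihom_ideal X" "a \<in> carrier S"
  shows "h a \<preceq>\<^bsub>T\<^esub> endpoint S T X a"
  using eval_ext_supremum[OF assms(3) ihom_ideal_carrier[OF assms(1)]] assms(2)
  unfolding endpoint_eq[OF assms(3,1)] by (auto simp: is_supremum_def)

lemma endpoint_least:
  assumes "X \<in> carrier hom" "a \<in> carrier S" "u \<in> carrier T"
    "\<And>h. h \<in> ihom_ideal X \<Longrightarrow> h a \<preceq>\<^bsub>T\<^esub> u"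
  shows "endpoint S T X a \<preceq>\<^bsub>T\<^esub> u"
  using eval_ext_supremum[OF assms(2) ihom_ideal_carrier[OF assms(1)]] assms(3,4)
  unfolding endpoint_eq[OF assms(2,1)] by (auto simp: is_supremum_def)

text \<open>Along a generating chain of its ideal, the endpoint is a pointwise supremum of an
  increasing sequence of generalized morphisms.\<close>

lemma endpoint_mor:
  assumes X: "X \<in> carrier hom"
  shows "endpoint S T X \<in> mor"
proof -
  obtain x where x: "H.chain x" "ihom_ideal X = H.ideal_of x"
    using H.completion_cases[OF ihom_ideal_carrier[OF X]] .
  have p: "path_prec (x n) (x (Suc n))" for n using x(1) by (simp add: H.chain_def)
  show ?thesis
  proof (rule gen_cu_mor_pointwise_supremum[OF S.cu_semigroup_axioms T.cu_semigroup_axioms])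
    show "x n \<in> mor" for n using path_prec_mor[OF p] by blast
    show "x n a \<preceq>\<^bsub>T\<^esub> x (Suc n) a" if "a \<in> carrier S" for n a using path_prec_leq[OF p that] .
    show "endpoint S T X \<in> extensional (carrier S)" by (simp add: endpoint_def Let_def)
    show "is_supremum T (range (\<lambda>n. x n a)) (endpoint S T X a)" if "a \<in> carrier S" for a
      using eval_ext_chain[OF that x(1)] endpoint_eq[OF that X] x(2) by simp
  qed
qed

lemma endpoint_bimorphism_gen: "gen_cu_bimorphism hom S T (endpoint S T)"
  unfolding gen_cu_bimorphism_def
proof (intro conjI ballI)
  fix a assume a: "a \<in> carrier S"
  have "compose (carrier hom) (eval_ext a) (\<lambda>x\<in>carrier hom. ihom_ideal x)
      \<in> gen_cu_mor hom T"
    by (rule gen_cu_mor_compose[OF cu_semigroup_ihom H.cu_semigroup_completion T.cu_semigroup_axioms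
          cu_mor_gen[OF ihom_iso(1)] eval_ext_gen[OF a]])
  also have "compose (carrier hom) (eval_ext a) (\<lambda>x\<in>carrier hom. ihom_ideal x) =
      (\<lambda>x\<in>carrier hom. endpoint S T x a)"
    using endpoint_eq[OF a] by (auto simp: compose_def)
  finally show "(\<lambda>x\<in>carrier hom. endpoint S T x a) \<in> gen_cu_mor hom T" .
next
  fix X assume "X \<in> carrier hom"
  note m = endpoint_mor[OF this]
  show "(\<lambda>a\<in>carrier S. endpoint S T X a) \<in> mor"
    using m extensional_restrict[OF gen_cu_mor_extensional[OF m]] by simp
qed

text \<open>\<open>X \<lless> Y\<close> bounds the whole ideal of \<open>X\<close> by one element
  \<open>k\<close> of the ideal of \<open>Y\<close>, and \<open>k\<close> lies below a member of any
  path representing \<open>Y\<close>. Thus information about endpoints returns to the level of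
  paths.\<close>

lemma endpoint_way_below:
  assumes X: "X \<in> carrier hom" and Y: "Y \<in> carrier hom"
    and wb: "X \<lless>\<^bsub>hom\<^esub> Y" and g: "g \<in> Y"
  obtains t where "t \<in> I\<^sub>Q" "\<And>a. a \<in> carrier S \<Longrightarrow> endpoint S T X a \<preceq>\<^bsub>T\<^esub> g t a"
proof -
  note gm = ihom_mem[OF Y g]
  obtain k where k: "k \<in> ihom_ideal Y" "\<And>h. h \<in> ihom_ideal X \<Longrightarrow> path_prec h k"
    using wb H.way_below_completion_iff[OF ihom_ideal_carrier[OF X] ihom_ideal_carrier[OF Y]]
    unfolding ihom_way_below_iff[OF X Y] by blast
  obtain t where t: "t \<in> I\<^sub>Q" "path_prec k (g t)" using k(1) gm(2) by (auto simp: path_ideal_def)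
  have "endpoint S T X a \<preceq>\<^bsub>T\<^esub> g t a" if "a \<in> carrier S" for a
    by (rule endpoint_least[OF X that gen_cu_mor_closed[OF path_mor[OF gm(1) t(1)] that]])
      (rule path_prec_leq[OF H.prec_trans[OF k(2) t(2)] that])
  then show ?thesis using that t(1) by blast
qed

text \<open>The opposite comparison: suprema of increasing sequences of ideals are unions, so a
  single member of a path of \<open>X\<close> already belongs to the ideal of some
  \<open>c n\<close>.\<close>

lemma endpoint_supremum:
  assumes X: "X \<in> carrier hom" and f: "f \<in> X" and s: "s \<in> I\<^sub>Q"
    and c: "increasing_seq hom c" "is_supremum hom (range c) X"
  obtains n where "\<And>a. a \<in> carrier S \<Longrightarrow> f s a \<preceq>\<^bsub>T\<^esub> endpoint S T (c n) a"
proof -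
  have cc: "c n \<in> carrier hom" for n using c(1) by (simp add: increasing_seq_def)
  have inc: "increasing_seq H.completion (\<lambda>n. ihom_ideal (c n))"
    using c(1) ihom_leq_iff'[OF cc cc] ihom_ideal_carrier[OF cc] by (simp add: increasing_seq_def)
  have "is_supremum H.completion (range (\<lambda>n. ihom_ideal (c n))) (ihom_ideal X)"
    using c(2) ihom_supremum_iff[of "range c", OF _ X] cc by (auto simp: image_image)
  then have "ihom_ideal X = (\<Union>n. ihom_ideal (c n))" using H.is_supremum_iff[OF inc] by blast
  moreover have "f s \<in> ihom_ideal X"
    using path_in_ideal[OF _ s] ihom_mem[OF X f] by metis
  ultimately obtain n where "f s \<in> ihom_ideal (c n)" by blast
  then show ?thesis using that endpoint_leq[OF cc] by blast
qed

lemma path_leq_endpoint: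
  assumes "X \<in> carrier hom" "f \<in> X" "s \<in> I\<^sub>Q" "a \<in> carrier S"
  shows "f s a \<preceq>\<^bsub>T\<^esub> endpoint S T X a"
  using endpoint_leq[OF assms(1) _ assms(4)] path_in_ideal[OF _ assms(3)] ihom_mem[OF assms(1,2)]
  by metis

lemma endpoint_bimorphism: "cu_bimorphism hom S T (endpoint S T)"
proof (rule cu_bimorphismI[OF cu_semigroup_ihom S.cu_semigroup_axioms T.cu_semigroup_axioms
      endpoint_bimorphism_gen])
  fix X Y a b
  assume XY: "X \<in> carrier hom" "Y \<in> carrier hom" "Y \<lless>\<^bsub>hom\<^esub> X"
    and ab: "a \<in> carrier S" "b \<in> carrier S" "b \<lless>\<^bsub>S\<^esub> a"
  obtain g where g: "g \<in> X" using ihom_nonempty[OF XY(1)] .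
  note gp = ihom_mem(1)[OF XY(1) g]
  obtain t where t: "t \<in> I\<^sub>Q" "endpoint S T Y b \<preceq>\<^bsub>T\<^esub> g t b"
    using endpoint_way_below[OF XY(2,1,3) g] ab(2) by metis
  \<comment> \<open>The endpoint of \<open>Y\<close> is only known to lie below \<open>g t\<close>;
    passing to a later \<open>u\<close> supplies the strict step.\<close>
  obtain u where u: "u \<in> I\<^sub>Q" "t < u" using I\<^sub>Q_above t(1) by blast
  have "g t b \<lless>\<^bsub>T\<^esub> g u a" using mor_precD[OF path_mor_prec[OF gp t(1) u] ab] .
  note cl = gen_cu_mor_closed[OF endpoint_mor[OF XY(2)] ab(2)]
    gen_cu_mor_closed[OF path_mor[OF gp t(1)] ab(2)] gen_cu_mor_closed[OF path_mor[OF gp u(1)] ab(1)]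
    gen_cu_mor_closed[OF endpoint_mor[OF XY(1)] ab(1)]
  have "endpoint S T Y b \<lless>\<^bsub>T\<^esub> g u a"
    using T.leq_way_below_trans[OF t(2) \<open>g t b \<lless>\<^bsub>T\<^esub> g u a\<close> cl(1,2)] .
  then show "endpoint S T Y b \<lless>\<^bsub>T\<^esub> endpoint S T X a"
    using T.way_below_leq_trans[OF _ path_leq_endpoint[OF XY(1) g u(1) ab(1)] cl(3,4)] by blast
qed

text \<open>A pointwise inequality suffices, because a path supplies the margin itself:
  \<open>g t\<close> is related by \<open>mor_prec\<close> to \<open>g u\<close> for every later
  \<open>u\<close>.\<close>

lemma path_leI:
  assumes f: "f \<in> paths S T" and g: "g \<in> paths S T"
    and le: "\<And>s. s \<in> I\<^sub>Q \<Longrightarrow> \<exists>t\<in>I\<^sub>Q. \<forall>a\<in>carrier S. f s a \<preceq>\<^bsub>T\<^esub> g t a"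
  shows "path_le S T f g"
  unfolding path_le_def
proof
  fix s assume s: "s \<in> I\<^sub>Q"
  obtain t where t: "t \<in> I\<^sub>Q" "\<And>a. a \<in> carrier S \<Longrightarrow> f s a \<preceq>\<^bsub>T\<^esub> g t a" using le[OF s] by blast
  obtain u where u: "u \<in> I\<^sub>Q" "t < u" using I\<^sub>Q_above t(1) by blast
  show "\<exists>t\<in>I\<^sub>Q. mor_prec S T (f s) (g t)"
    using leq_mor_prec_trans[OF path_mor[OF f s] path_mor[OF g t(1)] t(2) path_mor_prec[OF g t(1) u]] u(1)
    by blast
qed

text \<open>The path \<open>f\<close> and a path of \<open>X\<close> interleave with the same
  endpoints of the \<open>c n\<close>, the latter by \<open>endpoint_way_below\<close> and
  \<open>endpoint_supremum\<close>. A bare path \<open>f\<close> is used because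
  \<open>ihom_map\<close> is given by representatives.\<close>

lemma ihom_eqI:
  assumes X: "X \<in> carrier hom" "way_below_seq hom c" "is_supremum hom (range c) X"
    and f: "f \<in> paths S T"
    and below: "\<And>s. s \<in> I\<^sub>Q \<Longrightarrow> \<exists>n. \<forall>a\<in>carrier S. f s a \<preceq>\<^bsub>T\<^esub> endpoint S T (c n) a"
    and above: "\<And>n. \<exists>s\<in>I\<^sub>Q. \<forall>a\<in>carrier S. endpoint S T (c n) a \<preceq>\<^bsub>T\<^esub> f s a"
  shows "path_class S T f = X"
proof -
  interpret I: cu_semigroup hom by (rule cu_semigroup_ihom)
  obtain g where g: "g \<in> X" using ihom_nonempty[OF X(1)] .
  note gm = ihom_mem[OF X(1) g]
  have cc: "c n \<in> carrier hom" for n using X(2) by (simp add: way_below_seq_def)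
  have cl: "endpoint S T (c n) a \<in> carrier T" if "a \<in> carrier S" for n a
    using gen_cu_mor_closed[OF endpoint_mor[OF cc] that] .
  have fc: "f s a \<in> carrier T" "g s a \<in> carrier T" if "s \<in> I\<^sub>Q" "a \<in> carrier S" for s a
    using gen_cu_mor_closed[OF path_mor[OF f that(1)] that(2)]
      gen_cu_mor_closed[OF path_mor[OF gm(1) that(1)] that(2)] by auto
  have "path_le S T f g"
  proof (rule path_leI[OF f gm(1)])
    fix s assume s: "s \<in> I\<^sub>Q"
    obtain n where n: "\<And>a. a \<in> carrier S \<Longrightarrow> f s a \<preceq>\<^bsub>T\<^esub> endpoint S T (c n) a" using below[OF s] by blast
    obtain t where t: "t \<in> I\<^sub>Q" "\<And>a. a \<in> carrier S \<Longrightarrow> endpoint S T (c n) a \<preceq>\<^bsub>T\<^esub> g t a"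
      using endpoint_way_below[OF cc X(1) I.way_below_seq_supremum[OF X(2,3)] g] by metis
    show "\<exists>t\<in>I\<^sub>Q. \<forall>a\<in>carrier S. f s a \<preceq>\<^bsub>T\<^esub> g t a"
      using T.leq_trans[OF fc(1)[OF s] cl fc(2)[OF t(1)] n t(2)] t(1) by blast
  qed
  moreover have "path_le S T g f"
  proof (rule path_leI[OF gm(1) f])
    fix s assume s: "s \<in> I\<^sub>Q"
    obtain n where n: "\<And>a. a \<in> carrier S \<Longrightarrow> g s a \<preceq>\<^bsub>T\<^esub> endpoint S T (c n) a"
      using endpoint_supremum[OF X(1) g s I.way_below_seq_increasing[OF X(2)] X(3)] by metis
    obtain t where t: "t \<in> I\<^sub>Q" "\<And>a. a \<in> carrier S \<Longrightarrow> endpoint S T (c n) a \<preceq>\<^bsub>T\<^esub> f t a"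
      using above by blast
    show "\<exists>t\<in>I\<^sub>Q. \<forall>a\<in>carrier S. g s a \<preceq>\<^bsub>T\<^esub> f t a"
      using T.leq_trans[OF fc(2)[OF s] cl fc(1)[OF t(1)] n t(2)] t(1) by blast
  qed
  ultimately have "path_ideal f = path_ideal g" using path_le_iff f gm(1) by blast
  then show ?thesis using path_class_eq[OF f] path_class_eq[OF gm(1)] gm(3) by simp
qed

text \<open>This replaces injectivity of the endpoint map: a path representing \<open>X\<close>
  interleaves with the endpoints of the \<open>c n\<close>, hence with those of the
  \<open>d n\<close>, and so represents \<open>Y\<close>.\<close>

lemma ihom_eq_if_endpoints:
  assumes X: "X \<in> carrier hom" "way_below_seq hom c" "is_supremum hom (range c) X"
    and Y: "Y \<in> carrier hom" "way_below_seq hom d" "is_supremum hom (range d) Y"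
    and eq: "\<And>n a. a \<in> carrier S \<Longrightarrow> endpoint S T (c n) a = endpoint S T (d n) a"
  shows "X = Y"
proof -
  interpret I: cu_semigroup hom by (rule cu_semigroup_ihom)
  obtain f where f: "f \<in> X" using ihom_nonempty[OF X(1)] .
  note fm = ihom_mem[OF X(1) f]
  have cc: "c n \<in> carrier hom" for n using X(2) by (simp add: way_below_seq_def)
  have "path_class S T f = Y"
  proof (rule ihom_eqI[OF Y fm(1)])
    fix s assume s: "s \<in> I\<^sub>Q"
    obtain n where "\<And>a. a \<in> carrier S \<Longrightarrow> f s a \<preceq>\<^bsub>T\<^esub> endpoint S T (c n) a"
      using endpoint_supremum[OF X(1) f s I.way_below_seq_increasing[OF X(2)] X(3)] by metis
    then show "\<exists>n. \<forall>a\<in>carrier S. f s a \<preceq>\<^bsub>T\<^esub> endpoint S T (d n) a" using eq by auto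
  next
    fix n
    obtain t where "t \<in> I\<^sub>Q" "\<And>a. a \<in> carrier S \<Longrightarrow> endpoint S T (c n) a \<preceq>\<^bsub>T\<^esub> f t a"
      using endpoint_way_below[OF cc X(1) I.way_below_seq_supremum[OF X(2,3)] f] by metis
    then show "\<exists>s\<in>I\<^sub>Q. \<forall>a\<in>carrier S. endpoint S T (d n) a \<preceq>\<^bsub>T\<^esub> f s a" using eq by auto
  qed
  then show ?thesis using fm(3) by simp
qed

end

section \<open>Currying\<close>

context cu_pair
begin

context
  fixes A :: "('c, 'm) posemigroup_scheme" and \<phi> :: "'c \<Rightarrow> 'a \<Rightarrow> 'b"
  assumes A: "cu_semigroup A" and \<phi>: "cu_bimorphism A S T \<phi>"
begin

interpretation A: cu_semigroup A by (rule A)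

definition partial :: "'c \<Rightarrow> 'a \<Rightarrow> 'b"
  where "partial a = (\<lambda>s\<in>carrier S. \<phi> a s)"

text \<open>The value at \<open>a\<close> is built from the elements way below \<open>a\<close>. The
  single morphism \<open>partial a\<close> would give only the endpoint, which does not determine an
  element of the internal hom.\<close>

definition curry_ideal :: "'c \<Rightarrow> ('a \<Rightarrow> 'b) set"
  where "curry_ideal a = {h. \<exists>a'\<in>carrier A. a' \<lless>\<^bsub>A\<^esub> a \<and> path_prec h (partial a')}"

lemma partial_mor: "a \<in> carrier A \<Longrightarrow> partial a \<in> mor"
  unfolding partial_def
  using gen_cu_bimorphism_right[OF cu_bimorphism_gen[OF A S.cu_semigroup_axioms T.cu_semigroup_axioms \<phi>]] .

lemma partial_mor_prec:
  "a \<in> carrier A \<Longrightarrow> b \<in> carrier A \<Longrightarrow> a \<lless>\<^bsub>A\<^esub> b \<Longrightarrow> mor_prec S T (partial a) (partial b)"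
  unfolding mor_prec_def partial_def using cu_bimorphism_way_below[OF \<phi>] by simp

text \<open>Interpolation in \<open>A\<close> gives a dense chain from \<open>a\<close> to
  \<open>b\<close>, and \<open>partial\<close> maps it to the path that \<open>path_prec\<close>
  asks for.\<close>

lemma partial_path_prec:
  assumes "a \<in> carrier A" "b \<in> carrier A" "a \<lless>\<^bsub>A\<^esub> b"
  shows "path_prec (partial a) (partial b)"
proof -
  define R where "R u v \<longleftrightarrow> u \<in> carrier A \<and> v \<in> carrier A \<and> u \<lless>\<^bsub>A\<^esub> v" for u v
  have "\<exists>p :: rat \<Rightarrow> 'c. p 0 = a \<and> p 1 = b \<and>
      (\<forall>s t. 0 \<le> s \<longrightarrow> s < t \<longrightarrow> t \<le> 1 \<longrightarrow> R (p s) (p t))"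
  proof (rule dense_chain_between)
    show "R u w" if "R u v" "R v w" for u v w using that A.way_below_trans unfolding R_def by blast
    show "\<exists>v. R u v \<and> R v w" if uw: "R u w" for u w
    proof -
      obtain v where "v \<in> carrier A" "u \<lless>\<^bsub>A\<^esub> v" "v \<lless>\<^bsub>A\<^esub> w"
        using A.way_below_interpolation uw unfolding R_def by metis
      then show ?thesis using uw unfolding R_def by blast
    qed
    show "R a b" using assms by (simp add: R_def)
  qed
  then obtain p :: "rat \<Rightarrow> 'c" where p: "p 0 = a" "p 1 = b"
    "\<And>s t. 0 \<le> s \<Longrightarrow> s < t \<Longrightarrow> t \<le> 1 \<Longrightarrow> R (p s) (p t)" by blast
  have R: "mor_prec S T (partial u) (partial v)" "partial u \<in> mor" if "R u v" for u v
    using that partial_mor_prec partial_mor by (auto simp: R_def)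
  show ?thesis
  proof (rule path_precI[of _ _ "\<lambda>t. partial (p t)"])
    show "partial (p t) \<in> mor" if "t \<in> I\<^sub>Q" for t
      using R(2)[OF p(3)[of t 1]] that by (simp add: I\<^sub>Q_def)
    show "mor_prec S T (partial a) (partial (p t))" if "t \<in> I\<^sub>Q" for t
      using R(1)[OF p(3)[of 0 t]] that p(1) by (simp add: I\<^sub>Q_def)
    show "mor_prec S T (partial (p t)) (partial b)" if "t \<in> I\<^sub>Q" for t
      using R(1)[OF p(3)[of t 1]] that p(2) by (simp add: I\<^sub>Q_def)
    show "mor_prec S T (partial (p s)) (partial (p t))" if "s \<in> I\<^sub>Q" "t \<in> I\<^sub>Q" "s < t" for s t
      using R(1)[OF p(3)[of s t]] that by (simp add: I\<^sub>Q_def)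
  qed (use assms partial_mor in auto)
qed

text \<open>Any approximating sequence of \<open>a\<close> computes the ideal, so sums and zero can
  be treated with convenient sequences.\<close>

lemma curry_ideal_of:
  assumes c: "way_below_seq A c" "is_supremum A (range c) a"
  shows "H.chain (\<lambda>n. partial (c n))" "curry_ideal a = H.ideal_of (\<lambda>n. partial (c n))"
proof -
  have cc: "c n \<in> carrier A" "c n \<lless>\<^bsub>A\<^esub> c (Suc n)" for n using c(1) by (auto simp: way_below_seq_def)
  have a: "a \<in> carrier A" using A.is_supremum_carrier[OF c(2)] .
  show "H.chain (\<lambda>n. partial (c n))" using partial_path_prec cc by (simp add: H.chain_def)
  show "curry_ideal a = H.ideal_of (\<lambda>n. partial (c n))"
  proof
    show "H.ideal_of (\<lambda>n. partial (c n)) \<subseteq> curry_ideal a"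
      using cc(1) A.way_below_seq_supremum[OF c] by (auto simp: H.ideal_of_def curry_ideal_def)
    show "curry_ideal a \<subseteq> H.ideal_of (\<lambda>n. partial (c n))"
    proof
      fix h assume "h \<in> curry_ideal a"
      then obtain a' where a': "a' \<in> carrier A" "a' \<lless>\<^bsub>A\<^esub> a" "path_prec h (partial a')"
        by (auto simp: curry_ideal_def)
      obtain k where "a' \<lless>\<^bsub>A\<^esub> c k"
        using A.way_below_supremum'[OF a'(2,1) a A.way_below_seq_increasing[OF c(1)] c(2)] .
      then have "path_prec h (partial (c k))"
        using H.prec_trans[OF a'(3) partial_path_prec[OF a'(1) cc(1)]] by blast
      then show "h \<in> H.ideal_of (\<lambda>n. partial (c n))" by (auto simp: H.ideal_of_def)
    qed
  qed
qed

lemma curry_ideal_carrier: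
  assumes "a \<in> carrier A" shows "curry_ideal a \<in> carrier H.completion"
proof -
  obtain c where "way_below_seq A c" "is_supremum A (range c) a" using A.way_below_approx[OF assms] .
  from curry_ideal_of[OF this] show ?thesis using H.ideal_of_in by simp
qed

lemma curry_ideal_add:
  assumes "a \<in> carrier A" "b \<in> carrier A"
  shows "curry_ideal (a \<oplus>\<^bsub>A\<^esub> b) = curry_ideal a \<oplus>\<^bsub>H.completion\<^esub> curry_ideal b"
proof -
  obtain c where c: "way_below_seq A c" "is_supremum A (range c) a" using A.way_below_approx[OF assms(1)] .
  obtain d where d: "way_below_seq A d" "is_supremum A (range d) b" using A.way_below_approx[OF assms(2)] .
  have cc: "c n \<in> carrier A" "d n \<in> carrier A" for n using c(1) d(1) by (auto simp: way_below_seq_def)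
  have cd: "way_below_seq A (\<lambda>n. c n \<oplus>\<^bsub>A\<^esub> d n)"
    using c(1) d(1) A.O3 by (simp add: way_below_seq_def)
  note bi = cu_bimorphism_gen[OF A S.cu_semigroup_axioms T.cu_semigroup_axioms \<phi>]
  have "partial (c n \<oplus>\<^bsub>A\<^esub> d n) = mor_plus (partial (c n)) (partial (d n))" for n
    using restrict_gen_cu_morD(2)[OF A gen_cu_bimorphism_left[OF bi] cc]
    by (auto simp: partial_def mor_plus_def)
  then have "curry_ideal (a \<oplus>\<^bsub>A\<^esub> b) = H.ideal_of (\<lambda>n. mor_plus (partial (c n)) (partial (d n)))"
    using curry_ideal_of(2)[OF cd A.is_supremum_add[OF A.way_below_seq_increasing[OF c(1)]
          A.way_below_seq_increasing[OF d(1)] c(2) d(2)]] by simp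
  then show ?thesis
    using H.ideal_of_add(2)[OF curry_ideal_of(1)[OF c] curry_ideal_of(1)[OF d]]
      curry_ideal_of(2)[OF c] curry_ideal_of(2)[OF d] by simp
qed

lemma curry_ideal_zero: "curry_ideal \<zero>\<^bsub>A\<^esub> = \<zero>\<^bsub>H.completion\<^esub>"
proof -
  have "partial \<zero>\<^bsub>A\<^esub> = mor_zero"
    using \<phi> by (auto simp: partial_def mor_zero_def cu_bimorphism_def)
  moreover have "way_below_seq A (\<lambda>n. \<zero>\<^bsub>A\<^esub>)" by (simp add: way_below_seq_def A.zero_way_below)
  ultimately show ?thesis
    using curry_ideal_of(2)[of "\<lambda>n. \<zero>\<^bsub>A\<^esub>" "\<zero>\<^bsub>A\<^esub>"] A.is_supremum_const[of "\<zero>\<^bsub>A\<^esub>"]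
    by (simp add: H.ideal_of_def H.completion_zero)
qed

lemma curry_ideal_mor: "(\<lambda>a\<in>carrier A. curry_ideal a) \<in> cu_mor A H.completion"
proof -
  have "(\<lambda>a\<in>carrier A. curry_ideal a) \<in> gen_cu_mor A H.completion"
  proof (rule gen_cu_morI[OF A H.cu_semigroup_completion])
    show "(\<lambda>a\<in>carrier A. curry_ideal a) \<in> carrier A \<rightarrow>\<^sub>E carrier H.completion"
      using curry_ideal_carrier by simp
    show "(\<lambda>a\<in>carrier A. curry_ideal a) a \<preceq>\<^bsub>H.completion\<^esub> (\<lambda>a\<in>carrier A. curry_ideal a) b"
      if "a \<in> carrier A" "b \<in> carrier A" "a \<preceq>\<^bsub>A\<^esub> b" for a b
      using that A.way_below_leq_trans[OF _ that(3,1,2)]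
      by (auto simp: H.completion_leq curry_ideal_def)
    fix c s u assume c: "increasing_seq A c" "is_supremum A (range c) s"
      and le: "\<And>n. (\<lambda>a\<in>carrier A. curry_ideal a) (c n) \<preceq>\<^bsub>H.completion\<^esub> u"
    have cc: "c n \<in> carrier A" for n using A.increasing_seq_carrier[OF c(1)] .
    have s: "s \<in> carrier A" using A.is_supremum_carrier[OF c(2)] .
    have "curry_ideal s \<subseteq> (\<Union>n. curry_ideal (c n))"
    proof
      fix h assume "h \<in> curry_ideal s"
      then obtain a' where a': "a' \<in> carrier A" "a' \<lless>\<^bsub>A\<^esub> s" "path_prec h (partial a')"
        by (auto simp: curry_ideal_def)
      obtain k where "a' \<lless>\<^bsub>A\<^esub> c k" using A.way_below_supremum'[OF a'(2,1) s c] .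
      then show "h \<in> (\<Union>n. curry_ideal (c n))" using a' by (auto simp: curry_ideal_def)
    qed
    then show "(\<lambda>a\<in>carrier A. curry_ideal a) s \<preceq>\<^bsub>H.completion\<^esub> u"
      using le cc s by (auto simp: H.completion_leq)
  qed (simp_all add: curry_ideal_add curry_ideal_zero)
  moreover have "curry_ideal a \<lless>\<^bsub>H.completion\<^esub> curry_ideal b"
    if ab: "a \<in> carrier A" "b \<in> carrier A" "a \<lless>\<^bsub>A\<^esub> b" for a b
  proof -
    obtain c where c: "c \<in> carrier A" "a \<lless>\<^bsub>A\<^esub> c" "c \<lless>\<^bsub>A\<^esub> b"
      using A.way_below_interpolation[OF ab(3,1,2)] .
    \<comment> \<open>The second interpolation is for membership: \<open>partial c\<close> has to
      lie below \<open>partial d\<close> with \<open>d\<close> still way below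
      \<open>b\<close>.\<close>
    obtain d where d: "d \<in> carrier A" "c \<lless>\<^bsub>A\<^esub> d" "d \<lless>\<^bsub>A\<^esub> b"
      using A.way_below_interpolation[OF c(3,1) ab(2)] .
    show ?thesis
    proof (rule H.way_below_completionI[OF curry_ideal_carrier[OF ab(2)]])
      show "partial c \<in> curry_ideal b"
        using partial_path_prec[OF c(1) d(1,2)] d by (auto simp: curry_ideal_def)
      show "path_prec h (partial c)" if "h \<in> curry_ideal a" for h
      proof -
        obtain e where e: "e \<in> carrier A" "e \<lless>\<^bsub>A\<^esub> a" "path_prec h (partial e)"
          using \<open>h \<in> curry_ideal a\<close> by (auto simp: curry_ideal_def)
        show ?thesis
          using H.prec_trans[OF e(3) partial_path_prec[OF e(1) c(1)]]
            A.way_below_trans[OF e(2) c(2) e(1) ab(1) c(1)] by blast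
      qed
    qed
  qed
  ultimately show ?thesis by (simp add: cu_mor_def)
qed

text \<open>The ideal-valued map is carried back to classes of paths. Its endpoint at
  \<open>a\<close> is the supremum of \<open>\<phi> (c n) s\<close> over an approximating sequence
  of \<open>a\<close>, which is \<open>\<phi> a s\<close> by continuity.\<close>

lemma curry_exists:
  "\<exists>\<alpha>\<in>cu_mor A hom. \<forall>a\<in>carrier A. \<forall>s\<in>carrier S. endpoint S T (\<alpha> a) s = \<phi> a s"
proof
  let ?j = "\<lambda>I\<in>carrier H.completion. inv_into (carrier hom) ihom_ideal I"
  let ?\<alpha> = "compose (carrier A) ?j (\<lambda>a\<in>carrier A. curry_ideal a)"
  show \<alpha>: "?\<alpha> \<in> cu_mor A hom"
    by (rule cu_mor_compose[OF A H.cu_semigroup_completion cu_semigroup_ihom curry_ideal_mor ihom_iso(2)])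
  show "\<forall>a\<in>carrier A. \<forall>s\<in>carrier S. endpoint S T (?\<alpha> a) s = \<phi> a s"
  proof (intro ballI)
    fix a s assume a: "a \<in> carrier A" and s: "s \<in> carrier S"
    obtain c where c: "way_below_seq A c" "is_supremum A (range c) a" using A.way_below_approx[OF a] .
    have cc: "c n \<in> carrier A" for n using c(1) by (simp add: way_below_seq_def)
    have "ihom_ideal (?\<alpha> a) = curry_ideal a"
      using a bij_betw_inv_into_right[OF ihom_ideal_bij curry_ideal_carrier[OF a]]
        curry_ideal_carrier[OF a] by (simp add: compose_def)
    then have "endpoint S T (?\<alpha> a) s = eval_ext s (H.ideal_of (\<lambda>n. partial (c n)))"
      using endpoint_eq[OF s gen_cu_mor_closed[OF cu_mor_gen[OF \<alpha>] a]] curry_ideal_of(2)[OF c] by simp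
    moreover have "is_supremum T (range (\<lambda>n. partial (c n) s)) \<dots>"
      by (rule eval_ext_chain[OF s curry_ideal_of(1)[OF c]])
    moreover have "is_supremum T (range (\<lambda>n. \<phi> (c n) s)) (\<phi> a s)"
      by (rule restrict_gen_cu_mor_supremum[OF A T.cu_semigroup_axioms gen_cu_bimorphism_left[OF
              cu_bimorphism_gen[OF A S.cu_semigroup_axioms T.cu_semigroup_axioms \<phi>] s]
            A.way_below_seq_increasing[OF c(1)] c(2)])
    ultimately show "endpoint S T (?\<alpha> a) s = \<phi> a s"
      using T.is_supremum_unique s by (simp add: partial_def)
  qed
qed

end

lemma cu_mor_way_below_seq:
  assumes "cu_semigroup A" "cu_semigroup B" "f \<in> cu_mor A B" "way_below_seq A c" "is_supremum A (range c) a"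
  shows "way_below_seq B (\<lambda>n. f (c n))" "is_supremum B (range (\<lambda>n. f (c n))) (f a)"
proof -
  interpret A: cu_semigroup A by fact
  note g = cu_mor_gen[OF assms(3)]
  show "way_below_seq B (\<lambda>n. f (c n))"
    using assms(4) gen_cu_mor_closed[OF g] cu_mor_way_below[OF assms(3)] by (simp add: way_below_seq_def)
  show "is_supremum B (range (\<lambda>n. f (c n))) (f a)"
    using gen_cu_mor_supremum[OF assms(1,2) g A.way_below_seq_increasing[OF assms(4)] assms(5)] .
qed

text \<open>A Cu-morphism sends an approximating sequence of \<open>a\<close> to one of its image,
  so equality of endpoints on all of \<open>A\<close> gives the termwise hypothesis of
  \<open>ihom_eq_if_endpoints\<close>. Here preservation of \<open>\<lless>\<close> is
  essential.\<close>

lemma curry_unique: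
  assumes A: "cu_semigroup A" and \<alpha>: "\<alpha> \<in> cu_mor A hom" and \<beta>: "\<beta> \<in> cu_mor A hom"
    and eq: "\<And>a s. a \<in> carrier A \<Longrightarrow> s \<in> carrier S \<Longrightarrow> endpoint S T (\<alpha> a) s = endpoint S T (\<beta> a) s"
  shows "\<alpha> = \<beta>"
proof (rule gen_cu_mor_eqI[OF cu_mor_gen[OF \<alpha>] cu_mor_gen[OF \<beta>]])
  interpret A: cu_semigroup A by fact
  fix a assume a: "a \<in> carrier A"
  obtain c where c: "way_below_seq A c" "is_supremum A (range c) a" using A.way_below_approx[OF a] .
  show "\<alpha> a = \<beta> a"
  proof (rule ihom_eq_if_endpoints[OF gen_cu_mor_closed[OF cu_mor_gen[OF \<alpha>] a]
        cu_mor_way_below_seq[OF A cu_semigroup_ihom \<alpha> c] gen_cu_mor_closed[OF cu_mor_gen[OF \<beta>] a]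
        cu_mor_way_below_seq[OF A cu_semigroup_ihom \<beta> c]])
    show "endpoint S T (\<alpha> (c n)) s = endpoint S T (\<beta> (c n)) s" if "s \<in> carrier S" for n s
      using eq that c(1) by (simp add: way_below_seq_def)
  qed
qed

end

section \<open>The currying bijection and evaluation\<close>

lemmas cu_ihom = cu_pair.cu_semigroup_ihom[OF cu_pair.intro]

lemma cu_uncurry_spec:
  assumes cu: "cu_semigroup A" "cu_semigroup S" "cu_semigroup T" and \<alpha>: "\<alpha> \<in> cu_mor A \<lbrakk>S, T\<rbrakk>\<^sub>C\<^sub>u"
  shows "cu_uncurry A S T \<alpha> \<in> cu_mor (A \<otimes>\<^sub>C\<^sub>u S) T"
    "a \<in> carrier A \<Longrightarrow> s \<in> carrier S \<Longrightarrow>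
      cu_uncurry A S T \<alpha> (pure_tensor A S a s) = endpoint S T (\<alpha> a) s"
proof -
  note * = theI'[OF cu_pair.tensor_mor_ex1[OF cu_pair.intro[OF cu(1,2)] cu(3)
      cu_bimorphism_precompose_left[OF cu(1) cu_ihom[OF cu(2,3)] cu(2,3)
        cu_pair.endpoint_bimorphism[OF cu_pair.intro[OF cu(2,3)]] \<alpha>]], folded cu_uncurry_def]
  show "cu_uncurry A S T \<alpha> \<in> cu_mor (A \<otimes>\<^sub>C\<^sub>u S) T"
    "a \<in> carrier A \<Longrightarrow> s \<in> carrier S \<Longrightarrow>
      cu_uncurry A S T \<alpha> (pure_tensor A S a s) = endpoint S T (\<alpha> a) s"
    using * by auto
qed

text \<open>Existence is \<open>curry_exists\<close> for the bimorphism underlying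
  \<open>\<beta>\<close>, and uniqueness is \<open>curry_unique\<close>; so the \<open>THE\<close>
  in \<open>cu_curry\<close> is well defined.\<close>

lemma cu_curry_spec:
  assumes cu: "cu_semigroup A" "cu_semigroup S" "cu_semigroup T" and \<beta>: "\<beta> \<in> cu_mor (A \<otimes>\<^sub>C\<^sub>u S) T"
  shows "cu_curry A S T \<beta> \<in> cu_mor A \<lbrakk>S, T\<rbrakk>\<^sub>C\<^sub>u"
    "a \<in> carrier A \<Longrightarrow> s \<in> carrier S \<Longrightarrow>
      endpoint S T (cu_curry A S T \<beta> a) s = \<beta> (pure_tensor A S a s)"
proof -
  note AS = cu_pair.intro[OF cu(1,2)] and ST = cu_pair.intro[OF cu(2,3)]
  note X = cu_tensor[OF cu(1,2)]
  have "cu_bimorphism A S T (\<lambda>a s. \<beta> (pure_tensor A S a s))"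
    by (rule cu_bimorphism_compose[OF cu(1,2) X cu(3) pure_bimorphism[OF cu(1,2)] \<beta>])
  from cu_pair.curry_exists[OF ST cu(1) this]
  obtain \<alpha> where \<alpha>: "\<alpha> \<in> cu_mor A \<lbrakk>S, T\<rbrakk>\<^sub>C\<^sub>u" "\<And>a s. a \<in> carrier A \<Longrightarrow> s \<in> carrier S \<Longrightarrow>
      endpoint S T (\<alpha> a) s = \<beta> (pure_tensor A S a s)" by blast
  have "\<exists>!\<alpha>. \<alpha> \<in> cu_mor A \<lbrakk>S, T\<rbrakk>\<^sub>C\<^sub>u \<and> cu_uncurry A S T \<alpha> = \<beta>"
  proof (rule ex1I[of _ \<alpha>])
    show "\<alpha> \<in> cu_mor A \<lbrakk>S, T\<rbrakk>\<^sub>C\<^sub>u \<and> cu_uncurry A S T \<alpha> = \<beta>"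
    proof
      show "cu_uncurry A S T \<alpha> = \<beta>"
        by (rule cu_pair.tensor_eqI[OF AS cu(3)])
          (simp_all add: cu_uncurry_spec[OF cu \<alpha>(1)] \<alpha>(2) cu_mor_gen \<beta>)
    qed (rule \<alpha>(1))
    fix \<gamma> assume \<gamma>: "\<gamma> \<in> cu_mor A \<lbrakk>S, T\<rbrakk>\<^sub>C\<^sub>u \<and> cu_uncurry A S T \<gamma> = \<beta>"
    show "\<gamma> = \<alpha>"
      by (rule cu_pair.curry_unique[OF ST cu(1)])
        (use \<gamma> \<alpha> cu_uncurry_spec(2)[OF cu, of \<gamma>] in auto)
  qed
  note * = theI'[OF this, folded cu_curry_def]
  show "cu_curry A S T \<beta> \<in> cu_mor A \<lbrakk>S, T\<rbrakk>\<^sub>C\<^sub>u" using * by blast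
  show "endpoint S T (cu_curry A S T \<beta> a) s = \<beta> (pure_tensor A S a s)"
    if "a \<in> carrier A" "s \<in> carrier S"
    using * cu_uncurry_spec(2)[OF cu _ that, of "cu_curry A S T \<beta>"] by simp
qed

lemma cu_eval_spec:
  assumes cu: "cu_semigroup S" "cu_semigroup T"
  shows "cu_eval S T \<in> cu_mor (\<lbrakk>S, T\<rbrakk>\<^sub>C\<^sub>u \<otimes>\<^sub>C\<^sub>u S) T"
    "x \<in> carrier \<lbrakk>S, T\<rbrakk>\<^sub>C\<^sub>u \<Longrightarrow> s \<in> carrier S \<Longrightarrow>
      cu_eval S T (pure_tensor \<lbrakk>S, T\<rbrakk>\<^sub>C\<^sub>u S x s) = endpoint S T x s"
  unfolding cu_eval_def
  using cu_uncurry_spec[OF cu_ihom[OF cu] cu cu_id_mor[OF cu_ihom[OF cu]]]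
  by (simp_all add: cu_id_apply)

section \<open>The external tensor product\<close>

text \<open>Currying, the middle flip and evaluation are computed on pure tensors. These two facts
  are all that the final argument uses about the external tensor product.\<close>

lemma ext_tensor_spec:
  assumes cu: "cu_semigroup S\<^sub>1" "cu_semigroup T\<^sub>1" "cu_semigroup S\<^sub>2" "cu_semigroup T\<^sub>2"
  shows "cu_bimorphism \<lbrakk>S\<^sub>1, T\<^sub>1\<rbrakk>\<^sub>C\<^sub>u \<lbrakk>S\<^sub>2, T\<^sub>2\<rbrakk>\<^sub>C\<^sub>u \<lbrakk>S\<^sub>1 \<otimes>\<^sub>C\<^sub>u S\<^sub>2, T\<^sub>1 \<otimes>\<^sub>C\<^sub>u T\<^sub>2\<rbrakk>\<^sub>C\<^sub>u (ext_tensor S\<^sub>1 T\<^sub>1 S\<^sub>2 T\<^sub>2)"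
    "x \<in> carrier \<lbrakk>S\<^sub>1, T\<^sub>1\<rbrakk>\<^sub>C\<^sub>u \<Longrightarrow> y \<in> carrier \<lbrakk>S\<^sub>2, T\<^sub>2\<rbrakk>\<^sub>C\<^sub>u \<Longrightarrow> a \<in> carrier S\<^sub>1 \<Longrightarrow> b \<in> carrier S\<^sub>2 \<Longrightarrow>
      endpoint (S\<^sub>1 \<otimes>\<^sub>C\<^sub>u S\<^sub>2) (T\<^sub>1 \<otimes>\<^sub>C\<^sub>u T\<^sub>2) (ext_tensor S\<^sub>1 T\<^sub>1 S\<^sub>2 T\<^sub>2 x y) (pure_tensor S\<^sub>1 S\<^sub>2 a b) =
      pure_tensor T\<^sub>1 T\<^sub>2 (endpoint S\<^sub>1 T\<^sub>1 x a) (endpoint S\<^sub>2 T\<^sub>2 y b)"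
proof -
  let ?H1 = "\<lbrakk>S\<^sub>1, T\<^sub>1\<rbrakk>\<^sub>C\<^sub>u" and ?H2 = "\<lbrakk>S\<^sub>2, T\<^sub>2\<rbrakk>\<^sub>C\<^sub>u"
  note H1 = cu_ihom[OF cu(1,2)] and H2 = cu_ihom[OF cu(3,4)]
  note SS = cu_tensor[OF cu(1,3)] and TT = cu_tensor[OF cu(2,4)] and HH = cu_tensor[OF H1 H2]
  note HS1 = cu_tensor[OF H1 cu(1)] and HS2 = cu_tensor[OF H2 cu(3)]
  note HHSS = cu_tensor[OF HH SS] and HSHS = cu_tensor[OF HS1 HS2]
  note mf = middle_flip_spec[OF H1 H2 cu(1,3)]
  note ev1 = cu_eval_spec[OF cu(1,2)] and ev2 = cu_eval_spec[OF cu(3,4)]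
  note tm = tensor_mor_spec[OF HS1 HS2 cu(2,4) ev1(1) ev2(1)]
  note \<beta> = cu_mor_compose[OF HHSS HSHS TT mf(1) tm(1)]
  note ct = cu_curry_spec[OF HH SS TT \<beta>, folded ext_tensor_mor_def]
  have "cu_bimorphism ?H1 ?H2 \<lbrakk>S\<^sub>1 \<otimes>\<^sub>C\<^sub>u S\<^sub>2, T\<^sub>1 \<otimes>\<^sub>C\<^sub>u T\<^sub>2\<rbrakk>\<^sub>C\<^sub>u
      (\<lambda>x y. ext_tensor_mor S\<^sub>1 T\<^sub>1 S\<^sub>2 T\<^sub>2 (pure_tensor ?H1 ?H2 x y))"
    by (rule cu_bimorphism_compose[OF H1 H2 HH cu_ihom[OF SS TT] pure_bimorphism[OF H1 H2] ct(1)])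
  then show "cu_bimorphism ?H1 ?H2 \<lbrakk>S\<^sub>1 \<otimes>\<^sub>C\<^sub>u S\<^sub>2, T\<^sub>1 \<otimes>\<^sub>C\<^sub>u T\<^sub>2\<rbrakk>\<^sub>C\<^sub>u (ext_tensor S\<^sub>1 T\<^sub>1 S\<^sub>2 T\<^sub>2)"
    by (simp add: ext_tensor_def[abs_def])
  assume xyab: "x \<in> carrier ?H1" "y \<in> carrier ?H2" "a \<in> carrier S\<^sub>1" "b \<in> carrier S\<^sub>2"
  show "endpoint (S\<^sub>1 \<otimes>\<^sub>C\<^sub>u S\<^sub>2) (T\<^sub>1 \<otimes>\<^sub>C\<^sub>u T\<^sub>2) (ext_tensor S\<^sub>1 T\<^sub>1 S\<^sub>2 T\<^sub>2 x y) (pure_tensor S\<^sub>1 S\<^sub>2 a b) =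
      pure_tensor T\<^sub>1 T\<^sub>2 (endpoint S\<^sub>1 T\<^sub>1 x a) (endpoint S\<^sub>2 T\<^sub>2 y b)"
    unfolding ext_tensor_def
    using xyab by (simp add: ct(2) compose_def mf(2) tm(2) ev1(2) ev2(2) pure_closed[OF H1 H2]
        pure_closed[OF cu(1,3)] pure_closed[OF HH SS] pure_closed[OF H1 cu(1)] pure_closed[OF H2 cu(3)])
qed

text \<open>The joint \<open>\<lless>\<close>-condition makes the diagonal sequence approximating;
  this is how the approximating sequences of the three factors are combined in the theorem.\<close>

lemma cu_bimorphism_way_below_seq:
  assumes cu: "cu_semigroup S" "cu_semigroup T" "cu_semigroup P" and \<phi>: "cu_bimorphism S T P \<phi>"
    and c: "way_below_seq S c" "is_supremum S (range c) a"
    and d: "way_below_seq T d" "is_supremum T (range d) b"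
  shows "way_below_seq P (\<lambda>n. \<phi> (c n) (d n))" "is_supremum P (range (\<lambda>n. \<phi> (c n) (d n))) (\<phi> a b)"
proof -
  interpret S: cu_semigroup S by fact
  interpret T: cu_semigroup T by fact
  show "way_below_seq P (\<lambda>n. \<phi> (c n) (d n))"
    using c(1) d(1) cu_bimorphism_closed[OF \<phi>] cu_bimorphism_way_below[OF \<phi>]
    by (simp add: way_below_seq_def)
  show "is_supremum P (range (\<lambda>n. \<phi> (c n) (d n))) (\<phi> a b)"
    using gen_cu_bimorphism_supremum(2)[OF cu cu_bimorphism_gen[OF cu \<phi>]
        S.way_below_seq_increasing[OF c(1)] c(2) T.way_below_seq_increasing[OF d(1)] d(2)] .
qed

lemma compose_path:
  assumes cu: "cu_semigroup S" "cu_semigroup T" "cu_semigroup S'" "cu_semigroup T'"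
    and \<alpha>: "\<alpha> \<in> cu_mor S' S" and \<beta>: "\<beta> \<in> cu_mor T T'" and f: "f \<in> paths S T"
  shows "(\<lambda>t\<in>I\<^sub>Q. compose (carrier S') \<beta> (compose (carrier S') (f t) \<alpha>)) \<in> paths S' T'"
proof -
  interpret ST: cu_pair S T using cu by (simp add: cu_pair.intro)
  note g\<alpha> = cu_mor_gen[OF \<alpha>] and g\<beta> = cu_mor_gen[OF \<beta>]
  note fm = ST.path_mor[OF f]
  have "compose (carrier S') \<beta> (compose (carrier S') (f t) \<alpha>) \<in> gen_cu_mor S' T'" if "t \<in> I\<^sub>Q" for t
    by (rule gen_cu_mor_compose[OF cu(3,2,4) gen_cu_mor_compose[OF cu(3,1,2) g\<alpha> fm[OF that]] g\<beta>])
  moreover have "\<beta> (f s (\<alpha> a')) \<lless>\<^bsub>T'\<^esub> \<beta> (f t (\<alpha> a))"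
    if "s \<in> I\<^sub>Q" "t \<in> I\<^sub>Q" "s < t" "a \<in> carrier S'" "a' \<in> carrier S'" "a' \<lless>\<^bsub>S'\<^esub> a" for s t a a'
    using that by (intro cu_mor_way_below[OF \<beta>] gen_cu_mor_closed[OF fm] gen_cu_mor_closed[OF g\<alpha>]
        ST.mor_precD[OF ST.path_mor_prec[OF f]] cu_mor_way_below[OF \<alpha>])
  ultimately show ?thesis by (simp add: paths_def mor_prec_def compose_def)
qed

text \<open>\<open>ihom_map\<close> is a union over representatives, and each of them is shown to
  give \<open>Y\<close>. A representative interleaves with the endpoints of the \<open>c n\<close>;
  precomposing with \<open>\<alpha>\<close> and using monotonicity of \<open>\<beta>\<close> turns
  this into interleaving with the endpoints of the \<open>d n\<close>.\<close>

lemma ihom_map_eqI: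
  assumes cu: "cu_semigroup S" "cu_semigroup T" "cu_semigroup S'" "cu_semigroup T'"
    and \<alpha>: "\<alpha> \<in> cu_mor S' S" and \<beta>: "\<beta> \<in> cu_mor T T'"
    and X: "X \<in> carrier \<lbrakk>S, T\<rbrakk>\<^sub>C\<^sub>u" "way_below_seq \<lbrakk>S, T\<rbrakk>\<^sub>C\<^sub>u c" "is_supremum \<lbrakk>S, T\<rbrakk>\<^sub>C\<^sub>u (range c) X"
    and Y: "Y \<in> carrier \<lbrakk>S', T'\<rbrakk>\<^sub>C\<^sub>u" "way_below_seq \<lbrakk>S', T'\<rbrakk>\<^sub>C\<^sub>u d" "is_supremum \<lbrakk>S', T'\<rbrakk>\<^sub>C\<^sub>u (range d) Y"
    and eq: "\<And>n a. a \<in> carrier S' \<Longrightarrow> \<beta> (endpoint S T (c n) (\<alpha> a)) = endpoint S' T' (d n) a"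
  shows "ihom_map S T S' T' \<alpha> \<beta> X = Y"
proof -
  interpret ST: cu_pair S T using cu by (simp add: cu_pair.intro)
  interpret ST': cu_pair S' T' using cu by (simp add: cu_pair.intro)
  interpret I: cu_semigroup "\<lbrakk>S, T\<rbrakk>\<^sub>C\<^sub>u" by (rule ST.cu_semigroup_ihom)
  let ?F = "\<lambda>f. \<lambda>t\<in>I\<^sub>Q. compose (carrier S') \<beta> (compose (carrier S') (f t) \<alpha>)"
  note ac = gen_cu_mor_closed[OF cu_mor_gen[OF \<alpha>]]
  have cc: "c n \<in> carrier \<lbrakk>S, T\<rbrakk>\<^sub>C\<^sub>u" for n using X(2) by (simp add: way_below_seq_def)
  have ec: "endpoint S T (c n) s \<in> carrier T" if "s \<in> carrier S" for n s
    using gen_cu_mor_closed[OF ST.endpoint_mor[OF cc] that] .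
  have "path_class S' T' (?F f) = Y" if f: "f \<in> X" for f
  proof -
    note fp = ST.ihom_mem(1)[OF X(1) f]
    have fc: "f t s \<in> carrier T" if "t \<in> I\<^sub>Q" "s \<in> carrier S" for t s
      using gen_cu_mor_closed[OF ST.path_mor[OF fp that(1)] that(2)] .
    show ?thesis
    proof (rule ST'.ihom_eqI[OF Y compose_path[OF cu \<alpha> \<beta> fp]])
      fix s assume s: "s \<in> I\<^sub>Q"
      obtain n where n: "\<And>a. a \<in> carrier S \<Longrightarrow> f s a \<preceq>\<^bsub>T\<^esub> endpoint S T (c n) a"
        using ST.endpoint_supremum[OF X(1) f s I.way_below_seq_increasing[OF X(2)] X(3)] by metis
      have "?F f s a \<preceq>\<^bsub>T'\<^esub> endpoint S' T' (d n) a" if a: "a \<in> carrier S'" for a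
        using gen_cu_mor_mono[OF cu_mor_gen[OF \<beta>] fc[OF s ac[OF a]] ec[OF ac[OF a]] n[OF ac[OF a]]]
        unfolding eq[OF a] using s a by (simp add: compose_def)
      then show "\<exists>n. \<forall>a\<in>carrier S'. ?F f s a \<preceq>\<^bsub>T'\<^esub> endpoint S' T' (d n) a" by blast
    next
      fix n
      obtain t where t: "t \<in> I\<^sub>Q" "\<And>a. a \<in> carrier S \<Longrightarrow> endpoint S T (c n) a \<preceq>\<^bsub>T\<^esub> f t a"
        using ST.endpoint_way_below[OF cc X(1) I.way_below_seq_supremum[OF X(2,3)] f] by metis
      have "endpoint S' T' (d n) a \<preceq>\<^bsub>T'\<^esub> ?F f t a" if a: "a \<in> carrier S'" for a
        using gen_cu_mor_mono[OF cu_mor_gen[OF \<beta>] ec[OF ac[OF a]] fc[OF t(1) ac[OF a]] t(2)[OF ac[OF a]]]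
        unfolding eq[OF a] using t(1) a by (simp add: compose_def)
      then show "\<exists>s\<in>I\<^sub>Q. \<forall>a\<in>carrier S'. endpoint S' T' (d n) a \<preceq>\<^bsub>T'\<^esub> ?F f s a" using t(1) by blast
    qed
  qed
  moreover obtain f where "f \<in> X" using ST.ihom_nonempty[OF X(1)] .
  ultimately show ?thesis unfolding ihom_map_def by blast
qed

theorem proposition3p14:
  fixes S\<^sub>1 :: "'s1 posemigroup" and S\<^sub>2 :: "'s2 posemigroup"
    and T\<^sub>1 :: "'t1 posemigroup" and T\<^sub>2 :: "'t2 posemigroup"
    and P\<^sub>1 :: "'p1 posemigroup" and P\<^sub>2 :: "'p2 posemigroup"
  assumes "cu_semigroup S\<^sub>1" and "cu_semigroup S\<^sub>2"
    and "cu_semigroup T\<^sub>1" and "cu_semigroup T\<^sub>2"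
    and "cu_semigroup P\<^sub>1" and "cu_semigroup P\<^sub>2"
    and "x \<in> carrier \<lbrakk>S\<^sub>1, S\<^sub>2\<rbrakk>\<^sub>C\<^sub>u"
    and "y \<in> carrier \<lbrakk>T\<^sub>1, T\<^sub>2\<rbrakk>\<^sub>C\<^sub>u"
    and "z \<in> carrier \<lbrakk>P\<^sub>1, P\<^sub>2\<rbrakk>\<^sub>C\<^sub>u"
  shows
    "ihom_map
       ((S\<^sub>1 \<otimes>\<^sub>C\<^sub>u T\<^sub>1) \<otimes>\<^sub>C\<^sub>u P\<^sub>1) ((S\<^sub>2 \<otimes>\<^sub>C\<^sub>u T\<^sub>2) \<otimes>\<^sub>C\<^sub>u P\<^sub>2)
       (S\<^sub>1 \<otimes>\<^sub>C\<^sub>u (T\<^sub>1 \<otimes>\<^sub>C\<^sub>u P\<^sub>1)) (S\<^sub>2 \<otimes>\<^sub>C\<^sub>u (T\<^sub>2 \<otimes>\<^sub>C\<^sub>u P\<^sub>2))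
       (tensor_assoc_inv S\<^sub>1 T\<^sub>1 P\<^sub>1) (tensor_assoc S\<^sub>2 T\<^sub>2 P\<^sub>2)
       (ext_tensor (S\<^sub>1 \<otimes>\<^sub>C\<^sub>u T\<^sub>1) (S\<^sub>2 \<otimes>\<^sub>C\<^sub>u T\<^sub>2) P\<^sub>1 P\<^sub>2 (ext_tensor S\<^sub>1 S\<^sub>2 T\<^sub>1 T\<^sub>2 x y) z)
     = ext_tensor S\<^sub>1 S\<^sub>2 (T\<^sub>1 \<otimes>\<^sub>C\<^sub>u P\<^sub>1) (T\<^sub>2 \<otimes>\<^sub>C\<^sub>u P\<^sub>2) x (ext_tensor T\<^sub>1 T\<^sub>2 P\<^sub>1 P\<^sub>2 y z)"
proof -
  note S = assms(1,2) and T = assms(3,4) and P = assms(5,6)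
  note ST1 = cu_tensor[OF S(1) T(1)] and ST2 = cu_tensor[OF S(2) T(2)]
    and TP1 = cu_tensor[OF T(1) P(1)] and TP2 = cu_tensor[OF T(2) P(2)]
  note L1 = cu_tensor[OF ST1 P(1)] and L2 = cu_tensor[OF ST2 P(2)]
    and R1 = cu_tensor[OF S(1) TP1] and R2 = cu_tensor[OF S(2) TP2]
  note HS = cu_ihom[OF S] and HT = cu_ihom[OF T] and HP = cu_ihom[OF P]
  note HST = cu_ihom[OF ST1 ST2] and HTP = cu_ihom[OF TP1 TP2]
    and HL = cu_ihom[OF L1 L2] and HR = cu_ihom[OF R1 R2]
  note xy = ext_tensor_spec[OF S T] and yz = ext_tensor_spec[OF T P]
    and xy_z = ext_tensor_spec[OF ST1 ST2 P] and x_yz = ext_tensor_spec[OF S TP1 TP2]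
  note \<alpha> = tensor_assoc_inv_spec[OF S(1) T(1) P(1)] and \<beta> = tensor_assoc_spec[OF S(2) T(2) P(2)]
  obtain c where c: "way_below_seq \<lbrakk>S\<^sub>1, S\<^sub>2\<rbrakk>\<^sub>C\<^sub>u c" "is_supremum \<lbrakk>S\<^sub>1, S\<^sub>2\<rbrakk>\<^sub>C\<^sub>u (range c) x"
    using cu_semigroup.way_below_approx[OF HS assms(7)] .
  obtain d where d: "way_below_seq \<lbrakk>T\<^sub>1, T\<^sub>2\<rbrakk>\<^sub>C\<^sub>u d" "is_supremum \<lbrakk>T\<^sub>1, T\<^sub>2\<rbrakk>\<^sub>C\<^sub>u (range d) y"
    using cu_semigroup.way_below_approx[OF HT assms(8)] .
  obtain e where e: "way_below_seq \<lbrakk>P\<^sub>1, P\<^sub>2\<rbrakk>\<^sub>C\<^sub>u e" "is_supremum \<lbrakk>P\<^sub>1, P\<^sub>2\<rbrakk>\<^sub>C\<^sub>u (range e) z"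
    using cu_semigroup.way_below_approx[OF HP assms(9)] .
  have cde: "c n \<in> carrier \<lbrakk>S\<^sub>1, S\<^sub>2\<rbrakk>\<^sub>C\<^sub>u" "d n \<in> carrier \<lbrakk>T\<^sub>1, T\<^sub>2\<rbrakk>\<^sub>C\<^sub>u" "e n \<in> carrier \<lbrakk>P\<^sub>1, P\<^sub>2\<rbrakk>\<^sub>C\<^sub>u" for n
    using c(1) d(1) e(1) by (simp_all add: way_below_seq_def)
  let ?L = "\<lambda>x y z. ext_tensor (S\<^sub>1 \<otimes>\<^sub>C\<^sub>u T\<^sub>1) (S\<^sub>2 \<otimes>\<^sub>C\<^sub>u T\<^sub>2) P\<^sub>1 P\<^sub>2 (ext_tensor S\<^sub>1 S\<^sub>2 T\<^sub>1 T\<^sub>2 x y) z"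
    and ?R = "\<lambda>x y z. ext_tensor S\<^sub>1 S\<^sub>2 (T\<^sub>1 \<otimes>\<^sub>C\<^sub>u P\<^sub>1) (T\<^sub>2 \<otimes>\<^sub>C\<^sub>u P\<^sub>2) x (ext_tensor T\<^sub>1 T\<^sub>2 P\<^sub>1 P\<^sub>2 y z)"
  note xyc = cu_bimorphism_closed[OF xy(1)] and yzc = cu_bimorphism_closed[OF yz(1)]
  note Lc = cu_bimorphism_closed[OF xy_z(1) xyc] and Rc = cu_bimorphism_closed[OF x_yz(1) _ yzc]
  \<comment> \<open>Using the bimorphism property twice keeps one index for the three sequences, so
    both sides are approximated by the products of \<open>c n\<close>, \<open>d n\<close> and
    \<open>e n\<close>.\<close>
  note seqL = cu_bimorphism_way_below_seq[OF HST HP HL xy_z(1)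
      cu_bimorphism_way_below_seq[OF HS HT HST xy(1) c d] e]
  note seqR = cu_bimorphism_way_below_seq[OF HS HTP HR x_yz(1) c
      cu_bimorphism_way_below_seq[OF HT HP HTP yz(1) d e]]
  show ?thesis
  proof (rule ihom_map_eqI[OF L1 L2 R1 R2 \<alpha>(1) \<beta>(1) Lc[OF assms(7-9)] seqL Rc[OF assms(7-9)] seqR])
    fix n v assume v: "v \<in> carrier (S\<^sub>1 \<otimes>\<^sub>C\<^sub>u (T\<^sub>1 \<otimes>\<^sub>C\<^sub>u P\<^sub>1))"
    let ?X = "carrier (S\<^sub>1 \<otimes>\<^sub>C\<^sub>u (T\<^sub>1 \<otimes>\<^sub>C\<^sub>u P\<^sub>1))"
    let ?el = "endpoint ((S\<^sub>1 \<otimes>\<^sub>C\<^sub>u T\<^sub>1) \<otimes>\<^sub>C\<^sub>u P\<^sub>1) ((S\<^sub>2 \<otimes>\<^sub>C\<^sub>u T\<^sub>2) \<otimes>\<^sub>C\<^sub>u P\<^sub>2) (?L (c n) (d n) (e n))"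
      and ?er = "endpoint (S\<^sub>1 \<otimes>\<^sub>C\<^sub>u (T\<^sub>1 \<otimes>\<^sub>C\<^sub>u P\<^sub>1)) (S\<^sub>2 \<otimes>\<^sub>C\<^sub>u (T\<^sub>2 \<otimes>\<^sub>C\<^sub>u P\<^sub>2)) (?R (c n) (d n) (e n))"
    note elm = cu_pair.endpoint_mor[OF cu_pair.intro[OF L1 L2] Lc[OF cde]]
      and erm = cu_pair.endpoint_mor[OF cu_pair.intro[OF R1 R2] Rc[OF cde]]
    note ecl = gen_cu_mor_closed[OF cu_pair.endpoint_mor[OF cu_pair.intro[OF S] cde(1)]]
      gen_cu_mor_closed[OF cu_pair.endpoint_mor[OF cu_pair.intro[OF T] cde(2)]]
      gen_cu_mor_closed[OF cu_pair.endpoint_mor[OF cu_pair.intro[OF P] cde(3)]]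
    \<comment> \<open>On a triple pure tensor both sides are the tensor of the three endpoints at
      \<open>a\<close>, \<open>b\<close> and \<open>q\<close>, bracketed to the right: the inverse
      associator rebrackets the argument and the associator the value.\<close>
    have "compose ?X (tensor_assoc S\<^sub>2 T\<^sub>2 P\<^sub>2) (compose ?X ?el (tensor_assoc_inv S\<^sub>1 T\<^sub>1 P\<^sub>1)) = ?er"
    proof (rule triple_eq_right[OF S(1) T(1) P(1) R2 gen_cu_mor_compose[OF R1 L2 R2
            gen_cu_mor_compose[OF R1 L1 L2 cu_mor_gen[OF \<alpha>(1)] elm] cu_mor_gen[OF \<beta>(1)]] erm])
      fix a b q assume "a \<in> carrier S\<^sub>1" "b \<in> carrier T\<^sub>1" "q \<in> carrier P\<^sub>1"
      then show "compose ?X (tensor_assoc S\<^sub>2 T\<^sub>2 P\<^sub>2) (compose ?X ?el (tensor_assoc_inv S\<^sub>1 T\<^sub>1 P\<^sub>1))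
          (pure_tensor S\<^sub>1 (T\<^sub>1 \<otimes>\<^sub>C\<^sub>u P\<^sub>1) a (pure_tensor T\<^sub>1 P\<^sub>1 b q)) =
        ?er (pure_tensor S\<^sub>1 (T\<^sub>1 \<otimes>\<^sub>C\<^sub>u P\<^sub>1) a (pure_tensor T\<^sub>1 P\<^sub>1 b q))"
        by (simp add: compose_def pure_closed[OF T(1) P(1)] pure_closed[OF S(1) TP1]
            pure_closed[OF S(1) T(1)] \<alpha>(2) \<beta>(2) xy_z(2) x_yz(2) xy(2) yz(2) cde xyc yzc ecl)
    qed
    from fun_cong[OF this, of v] v
    show "tensor_assoc S\<^sub>2 T\<^sub>2 P\<^sub>2 (?el (tensor_assoc_inv S\<^sub>1 T\<^sub>1 P\<^sub>1 v)) = ?er v"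
      by (simp add: compose_def)
  qed
qed

end
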